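(* a) Let $\{q_k:k\in\mathbb N\}$ be a non-decreasing sequence. Then the maximal operator $t^{*}f:=\sup_{n\in\mathbb N_+}|t_nf|$ of the Nörlund summability method generated by $\{q_k\}$ is bounded from the Hardy space $H_{1/2}$ to the space $weak-L_{1/2}$. b) Let $0<p<1/2$ and let $\{q_k:k\in\mathbb N\}$ be a non-decreasing sequence satisfying the condition $$\frac{q_0}{Q_n}\ge\frac cn\qquad(n\in\mathbb N_+)$$ for some constant $c>0$. Then there exists a martingale $f\in H_p$ such that $$\sup_{n\in\mathbb N_+}\|t_nf\|_{weak-L_p}=\infty .$$
   Context: $\mathbb N_+$ is the set of positive integers, $\mathbb N=\mathbb N_+\cup\{0\}$. Fix a bounded sequence $m=(m_0,m_1,\dots)$ of integers $m_k\ge 2$. $G_m=\prod_{k\ge0}Z_{m_k}$, where $Z_{m_k}=\{0,\dots,m_k-1\}$ is the additive group modulo $m_k$, with the product of the discrete topologies; $\mu$ is the Haar measure with $\mu(G_m)=1$. $M_0:=1$, $M_{k+1}:=m_kM_k$; every $n\in\mathbb N$ is uniquely $n=\sum_{j\ge0}n_jM_j$ with $n_j\in Z_{m_j}$. $r_k(x):=\exp(2\pi i x_k/m_k)$, $\psi_n:=\prod_{k\ge0}r_k^{n_k}$ (Vilenkin system). $I_0(x):=G_m$, $I_n(x):=\{y: y_0=x_0,\dots,y_{n-1}=x_{n-1}\}$; $\mathcal F_n$ is the $\sigma$-algebra generated by $\{I_n(x):x\in G_m\}$. For $g\in L_1(G_m)$: $\widehat g(k):=\int g\overline{\psi_k}\,d\mu$,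 $S_ng:=\sum_{k=0}^{n-1}\widehat g(k)\psi_k$. A martingale is a sequence $f=(f^{(n)}:n\in\mathbb N)$ of integrable functions with $f^{(n)}$ $\mathcal F_n$-measurable and $S_{M_n}f^{(k)}=f^{(n)}$ for $n\le k$; $f^*:=\sup_n|f^{(n)}|$; $H_p$ is the set of martingales with $\|f\|_{H_p}:=\|f^*\|_p<\infty$, where $\|g\|_p:=(\int|g|^pd\mu)^{1/p}$. For a martingale, $\widehat f(i):=\lim_k\int f^{(k)}\overline{\psi_i}\,d\mu$ and $S_nf:=\sum_{k=0}^{n-1}\widehat f(k)\psi_k$. For a sequence $\{q_k:k\in\mathbb N\}$ of nonnegative numbers, $Q_n:=\sum_{k=0}^{n-1}q_k$ and the Nörlund means are $t_nf:=\frac1{Q_n}\sum_{k=1}^nq_{n-k}S_kf$ ($n\in\mathbb N_+$); it is always assumed that $q_0>0$ and $Q_n\to\infty$. $\|g\|_{weak-L_p}:=\sup_{\lambda>0}\lambda\,\mu(|g|>\lambda)^{1/p}$. An operator $T$ is bounded from $H_p$ to $X$ if there is a constant $C$ with $\|Tf\|_X\le C\|f\|_{H_p}$ for all $f\in H_p$. *)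

theory Defs
  imports "HOL-Probability.Probability"
begin

subsection \<open>The Vilenkin group and its Haar measure\<close>

text \<open>Elements of the group are the functions in the extensional product over all of \<open>nat\<close>, which
  imposes no condition beyond \<open>x k < m k\<close>.\<close>

definition vgroup :: "(nat \<Rightarrow> nat) \<Rightarrow> (nat \<Rightarrow> nat) set" where
  "vgroup m = (\<Pi>\<^sub>E k\<in>UNIV. {..<m k})"

definition vadd :: "(nat \<Rightarrow> nat) \<Rightarrow> (nat \<Rightarrow> nat) \<Rightarrow> (nat \<Rightarrow> nat) \<Rightarrow> (nat \<Rightarrow> nat)" where
  "vadd m x y = (\<lambda>k. (x k + y k) mod m k)"

definition vtop :: "(nat \<Rightarrow> nat) \<Rightarrow> (nat \<Rightarrow> nat) topology" where
  "vtop m = product_topology (\<lambda>k. discrete_topology {..<m k}) UNIV"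

text \<open>Normalised Haar measure, realised as the product of the uniform measures on the factors. The
  lemmas \<open>prob_space_haar\<close>, \<open>sets_haar\<close> and \<open>haar_translation\<close> below state the characterising
  properties: total mass 1, defined on the Borel sets, translation invariant.\<close>

definition haar :: "(nat \<Rightarrow> nat) \<Rightarrow> (nat \<Rightarrow> nat) measure" where
  "haar m = (\<Pi>\<^sub>M k\<in>UNIV. uniform_count_measure {..<m k})"

lemma space_haar: "space (haar m) = vgroup m"
  by (simp add: haar_def vgroup_def space_PiM space_uniform_count_measure)

lemma topspace_vtop: "topspace (vtop m) = vgroup m"
  by (simp add: vtop_def vgroup_def)

lemma prob_space_haar:
  assumes "\<And>k. 2 \<le> m k"
  shows "prob_space (haar m)"
proof -
  have "{..<m k} \<noteq> {}" for k
    using assms[of k] by (auto simp: lessThan_empty_iff)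
  then show ?thesis
    unfolding haar_def by (intro prob_space_PiM prob_space_uniform_count_measure) auto
qed

lemma vgroup_vadd:
  assumes "\<And>k. 2 \<le> m k"
  shows "vadd m a x \<in> vgroup m"
proof -
  have "m k > 0" for k using assms[of k] by simp
  then show ?thesis by (auto simp: vadd_def vgroup_def)
qed

lemma sets_haar:
  "sets (haar m) = sigma_sets (vgroup m) {U. openin (vtop m) U}"
proof
  have eq: "sets (haar m) = sigma_sets (vgroup m)
      {{f\<in>vgroup m. f i \<in> A} |i A. A \<subseteq> {..<m i}}"
    unfolding haar_def vgroup_def
    by (subst sets_PiM_single)
      (simp add: space_uniform_count_measure sets_uniform_count_measure)
  have op: "openin (vtop m) {f\<in>vgroup m. f i \<in> A}" if "A \<subseteq> {..<m i}" for i A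
  proof -
    have "continuous_map (vtop m) (discrete_topology {..<m i}) (\<lambda>f. f i)"
      unfolding vtop_def by (rule continuous_map_product_projection) simp
    from openin_continuous_map_preimage[OF this, of A] that show ?thesis
      by (simp add: topspace_vtop)
  qed
  show "sets (haar m) \<subseteq> sigma_sets (vgroup m) {U. openin (vtop m) U}"
    unfolding eq by (rule sigma_sets_subseteq) (use op in auto)
  define cyl where "cyl n x = {y\<in>vgroup m. \<forall>k<n. y k = x k}" for n and x :: "nat \<Rightarrow> nat"
  have cyl: "cyl n x \<in> sets (haar m)" for n x
  proof -
    have "cyl n x = {y\<in>space (haar m). \<forall>k<n. y k = x k}"
      by (simp add: cyl_def space_haar)
    also have "\<dots> = space (haar m) \<inter> (\<Inter>k\<in>{..<n}. {y\<in>space (haar m). y k = x k})"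
      by auto
    also have "\<dots> \<in> sets (haar m)"
    proof -
      have "{y\<in>space (haar m). y k = x k} \<in> sets (haar m)" for k
      proof -
        have "{y\<in>space (haar m). y k = x k} = {f\<in>vgroup m. f k \<in> {..<m k} \<inter> {x k}}"
          by (auto simp: space_haar vgroup_def)
        also have "\<dots> \<in> sets (haar m)"
          unfolding eq by (rule sigma_sets.Basic) blast
        finally show ?thesis .
      qed
      then show ?thesis by (cases "n = 0") (auto)
    qed
    finally show ?thesis .
  qed
  have "U \<in> sets (haar m)" if U: "openin (vtop m) U" for U
  proof -
    define K where "K = {(n, xs). length xs = n \<and> cyl n (\<lambda>k. xs ! k) \<subseteq> U}"
    have "U = (\<Union>(n, xs)\<in>K. cyl n (\<lambda>k. xs ! k))"
    proof
      show "(\<Union>(n, xs)\<in>K. cyl n (\<lambda>k. xs ! k)) \<subseteq> U" by (auto simp: K_def)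
      show "U \<subseteq> (\<Union>(n, xs)\<in>K. cyl n (\<lambda>k. xs ! k))"
      proof
        fix x assume x: "x \<in> U"
        from U x obtain V where V: "finite {i. V i \<noteq> {..<m i}}"
          "x \<in> (\<Pi>\<^sub>E i\<in>UNIV. V i)" "(\<Pi>\<^sub>E i\<in>UNIV. V i) \<subseteq> U"
          unfolding vtop_def openin_product_topology_alt by auto
        obtain n where n: "{i. V i \<noteq> {..<m i}} \<subseteq> {..<n}"
          using V(1) finite_nat_iff_bounded by blast
        have xG: "x \<in> vgroup m"
          using openin_subset[OF U] x by (auto simp: topspace_vtop)
        have "cyl n x \<subseteq> (\<Pi>\<^sub>E i\<in>UNIV. V i)"
        proof
          fix y assume y: "y \<in> cyl n x"
          have "y i \<in> V i" for i
          proof (cases "i < n")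
            case True
            then show ?thesis using y V(2) by (auto simp: cyl_def)
          next
            case False
            then have "V i = {..<m i}" using n by auto
            then show ?thesis using y by (auto simp: cyl_def vgroup_def)
          qed
          then show "y \<in> (\<Pi>\<^sub>E i\<in>UNIV. V i)" by auto
        qed
        moreover have "cyl n (\<lambda>k. map x [0..<n] ! k) = cyl n x"
          by (auto simp: cyl_def)
        ultimately have "(n, map x [0..<n]) \<in> K" "x \<in> cyl n (\<lambda>k. map x [0..<n] ! k)"
          using V(3) xG by (auto simp: K_def cyl_def)
        then show "x \<in> (\<Union>(n, xs)\<in>K. cyl n (\<lambda>k. xs ! k))" by blast
      qed
    qed
    also have "\<dots> \<in> sets (haar m)"
      by (rule sets.countable_UN') (auto simp: cyl)
    finally show ?thesis .
  qed
  then show "sigma_sets (vgroup m) {U. openin (vtop m) U} \<subseteq> sets (haar m)"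
    unfolding space_haar[symmetric] by (intro sets.sigma_sets_subset) auto
qed

lemma haar_translation:
  assumes m: "\<And>k. 2 \<le> m k"
  shows "distr (haar m) (haar m) (vadd m a) = haar m"
proof -
  have pos: "m k > 0" for k using m[of k] by simp
  define N where "N k = uniform_count_measure {..<m k}" for k
  have N: "prob_space (N k)" for k
    unfolding N_def by (rule prob_space_uniform_count_measure) (use pos[of k] in auto)
  have H: "haar m = PiM UNIV N" by (simp add: haar_def N_def[abs_def])
  define \<tau> where "\<tau> k j = (a k + j) mod m k" for k j
  have setsN: "sets (N k) = Pow {..<m k}" "space (N k) = {..<m k}" for k
    by (simp_all add: N_def sets_uniform_count_measure space_uniform_count_measure)
  have inj: "inj_on (\<tau> k) {..<m k}" for k
  proof (rule inj_onI)
    fix i j assume ij: "i \<in> {..<m k}" "j \<in> {..<m k}" "\<tau> k i = \<tau> k j"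
    then have "int ((a k + i) mod m k) = int ((a k + j) mod m k)" by (simp add: \<tau>_def)
    then have "(int (a k) + int i) mod int (m k) = (int (a k) + int j) mod int (m k)"
      by (simp only: of_nat_mod of_nat_add)
    then have "int (m k) dvd int i - int j" by (simp add: mod_eq_dvd_iff)
    then have "int i - int j = 0"
      using ij(1,2) zdvd_not_zless[of "int i - int j" "int (m k)"]
        zdvd_not_zless[of "int j - int i" "int (m k)"]
      by (cases "i < j"; cases "j < i") (auto simp: dvd_diff_commute)
    then show "i = j" by simp
  qed
  have maps: "\<tau> k ` {..<m k} \<subseteq> {..<m k}" for k
    using pos[of k] by (auto simp: \<tau>_def)
  have bij: "bij_betw (\<tau> k) {..<m k} {..<m k}" for k
    unfolding bij_betw_def using inj[of k] endo_inj_surj[OF _ maps inj] by auto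
  have meas: "vadd m a \<in> measurable (PiM UNIV N) (PiM UNIV N)"
  proof -
    have "(\<lambda>x. \<lambda>k\<in>UNIV. \<tau> k (x k)) \<in> measurable (PiM UNIV N) (PiM UNIV N)"
    proof (rule measurable_restrict)
      fix k :: nat
      have "\<tau> k \<in> measurable (N k) (N k)"
        using maps[of k] by (auto simp: measurable_def setsN)
      then show "(\<lambda>x. \<tau> k (x k)) \<in> measurable (PiM UNIV N) (N k)"
        by (rule measurable_compose[OF measurable_component_singleton, rotated]) simp
    qed
    then show ?thesis by (simp add: \<tau>_def vadd_def[abs_def] restrict_def)
  qed
  interpret P: product_prob_space N UNIV
    using N by (rule product_prob_spaceI)
  have "PiM UNIV N = distr (PiM UNIV N) (PiM UNIV N) (vadd m a)"
  proof (rule measure_eqI_PiM_infinite[OF refl])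
    show "finite_measure (PiM UNIV N)" by unfold_locales
    fix A and J :: "nat set" assume J: "finite J" "J \<subseteq> UNIV" and A: "\<And>i. i \<in> J \<Longrightarrow> A i \<in> sets (N i)"
    define B where "B i = \<tau> i -` A i \<inter> {..<m i}" for i
    have B: "B i \<in> sets (N i)" for i by (auto simp: B_def setsN)
    have cB: "emeasure (N i) (B i) = emeasure (N i) (A i)" if "i \<in> J" for i
    proof -
      have Ai: "A i \<subseteq> {..<m i}" using A[OF that] by (simp add: setsN)
      have "\<tau> i ` B i = A i"
      proof
        show "A i \<subseteq> \<tau> i ` B i"
        proof
          fix y assume y: "y \<in> A i"
          then have "y \<in> \<tau> i ` {..<m i}" using bij[of i] Ai by (auto simp: bij_betw_def)
          then show "y \<in> \<tau> i ` B i" using y by (auto simp: B_def)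
        qed
      qed (auto simp: B_def)
      moreover have "inj_on (\<tau> i) (B i)"
        using inj by (rule inj_on_subset) (auto simp: B_def)
      ultimately have "card (B i) = card (A i)" using card_image by metis
      then show ?thesis using Ai
        by (simp add: N_def emeasure_uniform_count_measure B_def)
    qed
    have "emeasure (distr (PiM UNIV N) (PiM UNIV N) (vadd m a)) (prod_emb UNIV N J (Pi\<^sub>E J A))
        = emeasure (PiM UNIV N) (vadd m a -` prod_emb UNIV N J (Pi\<^sub>E J A) \<inter> space (PiM UNIV N))"
      using meas J A by (intro emeasure_distr sets_PiM_I) auto
    also have "vadd m a -` prod_emb UNIV N J (Pi\<^sub>E J A) \<inter> space (PiM UNIV N)
        = prod_emb UNIV N J (Pi\<^sub>E J B)"
      using measurable_space[OF meas]
      by (auto simp: prod_emb_def space_PiM setsN B_def \<tau>_def vadd_def PiE_iff pos)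
    also have "emeasure (PiM UNIV N) \<dots> = (\<Prod>i\<in>J. emeasure (N i) (B i))"
      using J B by (intro P.emeasure_PiM_emb) auto
    also have "\<dots> = (\<Prod>i\<in>J. emeasure (N i) (A i))"
      using cB by (rule prod.cong[OF refl])
    also have "\<dots> = emeasure (PiM UNIV N) (prod_emb UNIV N J (Pi\<^sub>E J A))"
      using J A by (intro P.emeasure_PiM_emb[symmetric]) auto
    finally show "emeasure (PiM UNIV N) (prod_emb UNIV N J (Pi\<^sub>E J A))
      = emeasure (distr (PiM UNIV N) (PiM UNIV N) (vadd m a)) (prod_emb UNIV N J (Pi\<^sub>E J A))" by simp
  qed simp_all
  then show ?thesis unfolding H by (rule sym)
qed


subsection \<open>The Vilenkin system\<close>

definition gpow :: "(nat \<Rightarrow> nat) \<Rightarrow> nat \<Rightarrow> nat" where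
  "gpow m k = (\<Prod>j<k. m j)"

definition digit :: "(nat \<Rightarrow> nat) \<Rightarrow> nat \<Rightarrow> nat \<Rightarrow> nat" where
  "digit m n j = (n div gpow m j) mod m j"

lemma gpow_0: "gpow m 0 = 1"
  by (simp add: gpow_def)

lemma gpow_Suc: "gpow m (Suc k) = m k * gpow m k"
  by (simp add: gpow_def)

lemma gpow_gt:
  assumes "\<And>k. 2 \<le> m k"
  shows "k < gpow m k"
proof (induction k)
  case (Suc k)
  have "Suc k < 2 * gpow m k" using Suc by simp
  also have "\<dots> \<le> m k * gpow m k" using assms[of k] by (rule mult_le_mono1)
  finally show ?case by (simp add: gpow_Suc)
qed (simp add: gpow_0)

lemma digit_eq_0:
  assumes "\<And>k. 2 \<le> m k" "n \<le> j"
  shows "digit m n j = 0"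
proof -
  have "n < gpow m j"
    using gpow_gt[OF assms(1)] assms(2) by (rule le_less_trans[rotated])
  then show ?thesis by (simp add: digit_def)
qed

lemma finite_digit:
  assumes "\<And>k. 2 \<le> m k"
  shows "finite {j. digit m n j \<noteq> 0}"
proof (rule finite_subset)
  show "{j. digit m n j \<noteq> 0} \<subseteq> {..<n}"
  proof
    fix j assume "j \<in> {j. digit m n j \<noteq> 0}"
    then have "\<not> n \<le> j" using digit_eq_0[of m n j, OF assms] by auto
    then show "j \<in> {..<n}" by simp
  qed
qed simp

lemma digit_expansion_upto:
  "n = (\<Sum>j<K. digit m n j * gpow m j) + gpow m K * (n div gpow m K)"
proof (induction K)
  case (Suc K)
  have "gpow m (Suc K) = gpow m K * m K" by (simp add: gpow_Suc mult.commute)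
  then have "n div gpow m K = m K * (n div gpow m (Suc K)) + digit m n K"
    by (simp only: digit_def div_mult2_eq mult_div_mod_eq)
  then have "gpow m K * (n div gpow m K) = gpow m K * (m K * (n div gpow m (Suc K)) + digit m n K)"
    by (rule arg_cong)
  also have "\<dots> = digit m n K * gpow m K + gpow m (Suc K) * (n div gpow m (Suc K))"
    unfolding gpow_Suc by (simp only: algebra_simps)
  finally have step: "gpow m K * (n div gpow m K)
      = digit m n K * gpow m K + gpow m (Suc K) * (n div gpow m (Suc K))" .
  show ?case using Suc step unfolding sum.lessThan_Suc by linarith
qed (simp add: gpow_0)

lemma digit_sum:
  assumes m: "\<And>k. 2 \<le> m k" and a: "\<And>j. a j < m j"
  shows "(\<Sum>j<K. a j * gpow m j) < gpow m K"
proof (induction K)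
  case (Suc K)
  have "(\<Sum>j<Suc K. a j * gpow m j) < gpow m K + a K * gpow m K" using Suc by simp
  also have "\<dots> = Suc (a K) * gpow m K" by simp
  also have "\<dots> \<le> m K * gpow m K" using a[of K] by (intro mult_le_mono1) simp
  finally show ?case by (simp add: gpow_Suc)
qed (simp add: gpow_0)

lemma digit_unique_upto:
  assumes m: "\<And>k. 2 \<le> m k" and a: "\<And>j. a j < m j"
    and "n = (\<Sum>j<K. a j * gpow m j) + gpow m K * r" and "j < K"
  shows "digit m n j = a j"
  using assms(3,4)
proof (induction K arbitrary: r)
  case (Suc K)
  have n: "n = (\<Sum>j<K. a j * gpow m j) + gpow m K * (a K + m K * r)"
    using Suc.prems(1) by (simp add: gpow_Suc algebra_simps)
  show ?case
  proof (cases "j < K")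
    case True
    with Suc.IH[OF n] show ?thesis .
  next
    case False
    with Suc.prems have j: "j = K" by simp
    have "gpow m K \<noteq> 0" using gpow_gt[of m K] m by simp
    then have "n div gpow m K = a K + m K * r"
      using digit_sum[of m a K] m a by (simp add: n)
    then show ?thesis using a[of K] by (simp add: digit_def j)
  qed
qed simp

lemma digit_expansion_unique:
  assumes m: "\<And>k. 2 \<le> m k" and a: "\<And>j. a j < m j" and fin: "finite {j. a j \<noteq> 0}"
  shows "n = (\<Sum>j | a j \<noteq> 0. a j * gpow m j) \<longleftrightarrow> a = digit m n"
proof -
  have trunc: "(\<Sum>j | a j \<noteq> 0. a j * gpow m j) = (\<Sum>j<K. a j * gpow m j)"
    if "{j. a j \<noteq> 0} \<subseteq> {..<K}" for K
    using that by (intro sum.mono_neutral_left) auto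
  obtain K where K: "{j. a j \<noteq> 0} \<subseteq> {..<K}"
    using fin finite_nat_iff_bounded by blast
  show ?thesis
  proof
    assume n: "n = (\<Sum>j | a j \<noteq> 0. a j * gpow m j)"
    show "a = digit m n"
    proof
      fix j
      have "{j. a j \<noteq> 0} \<subseteq> {..<max K (Suc j)}" using K by auto
      from n[unfolded trunc[OF this]] show "a j = digit m n j"
        using digit_unique_upto[of m a n "max K (Suc j)" 0 j] m a by simp
    qed
  next
    assume eq: "a = digit m n"
    have z: "n div gpow m (max K n) = 0"
      using gpow_gt[of m "max K n"] m by simp
    have "n = (\<Sum>j<max K n. a j * gpow m j)"
      by (rule digit_expansion_upto[of n m "max K n", unfolded z mult_0_right add_0_right, folded eq])
    also have "\<dots> = (\<Sum>j | a j \<noteq> 0. a j * gpow m j)"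
      by (rule trunc[symmetric]) (use K in auto)
    finally show "n = (\<Sum>j | a j \<noteq> 0. a j * gpow m j)" .
  qed
qed

definition rad :: "(nat \<Rightarrow> nat) \<Rightarrow> nat \<Rightarrow> (nat \<Rightarrow> nat) \<Rightarrow> complex" where
  "rad m k x = exp (2 * of_real pi * \<i> * of_nat (x k) / of_nat (m k))"

text \<open>The infinite product defining \<open>\<psi>\<^sub>n\<close> is restricted to its finitely many nontrivial factors
  (see \<open>finite_digit\<close>).\<close>

definition psi :: "(nat \<Rightarrow> nat) \<Rightarrow> nat \<Rightarrow> (nat \<Rightarrow> nat) \<Rightarrow> complex" where
  "psi m n x = (\<Prod>k | digit m n k \<noteq> 0. rad m k x ^ digit m n k)"

definition fcoeff :: "(nat \<Rightarrow> nat) \<Rightarrow> ((nat \<Rightarrow> nat) \<Rightarrow> complex) \<Rightarrow> nat \<Rightarrow> complex" where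
  "fcoeff m g k = (LINT x|haar m. g x * cnj (psi m k x))"

definition fsum :: "(nat \<Rightarrow> nat) \<Rightarrow> nat \<Rightarrow> ((nat \<Rightarrow> nat) \<Rightarrow> complex) \<Rightarrow> (nat \<Rightarrow> nat) \<Rightarrow> complex" where
  "fsum m n g x = (\<Sum>k<n. fcoeff m g k * psi m k x)"


subsection \<open>Quasi-norms\<close>

text \<open>Real powers of extended nonnegative numbers, used for positive exponents only.\<close>

definition epowr :: "ennreal \<Rightarrow> real \<Rightarrow> ennreal" where
  "epowr x p = (if x = \<infinity> then \<infinity> else ennreal (enn2real x powr p))"

text \<open>Both quasi-norms take the modulus of the function as an \<open>ennreal\<close>-valued argument, since
  maximal functions may be infinite at some points.\<close>

definition Lp_norm :: "'a measure \<Rightarrow> real \<Rightarrow> ('a \<Rightarrow> ennreal) \<Rightarrow> ennreal" where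
  "Lp_norm M p g = epowr (\<integral>\<^sup>+ x. epowr (g x) p \<partial>M) (1 / p)"

definition weak_Lp_norm :: "'a measure \<Rightarrow> real \<Rightarrow> ('a \<Rightarrow> ennreal) \<Rightarrow> ennreal" where
  "weak_Lp_norm M p g =
     (SUP l\<in>{0::real<..}. ennreal l * epowr (emeasure M {x \<in> space M. g x > ennreal l}) (1 / p))"


subsection \<open>Martingales and Hardy spaces\<close>

definition cylinder :: "(nat \<Rightarrow> nat) \<Rightarrow> nat \<Rightarrow> (nat \<Rightarrow> nat) \<Rightarrow> (nat \<Rightarrow> nat) set" where
  "cylinder m n x = {y \<in> vgroup m. \<forall>k<n. y k = x k}"

definition filt :: "(nat \<Rightarrow> nat) \<Rightarrow> nat \<Rightarrow> (nat \<Rightarrow> nat) measure" where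
  "filt m n = sigma (vgroup m) {cylinder m n x |x. x \<in> vgroup m}"

definition martingale :: "(nat \<Rightarrow> nat) \<Rightarrow> (nat \<Rightarrow> (nat \<Rightarrow> nat) \<Rightarrow> complex) \<Rightarrow> bool" where
  "martingale m f \<longleftrightarrow>
     (\<forall>n. integrable (haar m) (f n)) \<and>
     (\<forall>n. f n \<in> borel_measurable (filt m n)) \<and>
     (\<forall>n k. n \<le> k \<longrightarrow> (\<forall>x\<in>vgroup m. fsum m (gpow m n) (f k) x = f n x))"

definition mart_max :: "(nat \<Rightarrow> (nat \<Rightarrow> nat) \<Rightarrow> complex) \<Rightarrow> (nat \<Rightarrow> nat) \<Rightarrow> ennreal" where
  "mart_max f x = (SUP n. ennreal (cmod (f n x)))"

definition Hp_norm :: "(nat \<Rightarrow> nat) \<Rightarrow> real \<Rightarrow> (nat \<Rightarrow> (nat \<Rightarrow> nat) \<Rightarrow> complex) \<Rightarrow> ennreal" where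
  "Hp_norm m p f = Lp_norm (haar m) p (mart_max f)"

definition Hp :: "(nat \<Rightarrow> nat) \<Rightarrow> real \<Rightarrow> (nat \<Rightarrow> (nat \<Rightarrow> nat) \<Rightarrow> complex) set" where
  "Hp m p = {f. martingale m f \<and> Hp_norm m p f < \<infinity>}"

definition mcoeff :: "(nat \<Rightarrow> nat) \<Rightarrow> (nat \<Rightarrow> (nat \<Rightarrow> nat) \<Rightarrow> complex) \<Rightarrow> nat \<Rightarrow> complex" where
  "mcoeff m f i = lim (\<lambda>k. LINT x|haar m. f k x * cnj (psi m i x))"

definition msum :: "(nat \<Rightarrow> nat) \<Rightarrow> nat \<Rightarrow> (nat \<Rightarrow> (nat \<Rightarrow> nat) \<Rightarrow> complex) \<Rightarrow> (nat \<Rightarrow> nat) \<Rightarrow> complex" where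
  "msum m n f x = (\<Sum>k<n. mcoeff m f k * psi m k x)"


subsection \<open>Noerlund means\<close>

definition Qsum :: "(nat \<Rightarrow> real) \<Rightarrow> nat \<Rightarrow> real" where
  "Qsum q n = (\<Sum>k<n. q k)"

definition norlund ::
  "(nat \<Rightarrow> nat) \<Rightarrow> (nat \<Rightarrow> real) \<Rightarrow> nat \<Rightarrow> (nat \<Rightarrow> (nat \<Rightarrow> nat) \<Rightarrow> complex) \<Rightarrow> (nat \<Rightarrow> nat) \<Rightarrow> complex" where
  "norlund m q n f x = (\<Sum>k=1..n. of_real (q (n - k)) * msum m k f x) / of_real (Qsum q n)"

definition norlund_max ::
  "(nat \<Rightarrow> nat) \<Rightarrow> (nat \<Rightarrow> real) \<Rightarrow> (nat \<Rightarrow> (nat \<Rightarrow> nat) \<Rightarrow> complex) \<Rightarrow> (nat \<Rightarrow> nat) \<Rightarrow> ennreal" where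
  "norlund_max m q f x = (SUP n\<in>{1..}. ennreal (cmod (norlund m q n f x)))"

end

theory Submission
  imports Defs
begin

text \<open>
  (a) By Abel summation, for non-decreasing weights each Noerlund mean is a convex combination of
  Fejer means, so it suffices to bound the maximal Fejer operator. Its kernels satisfy
  \<open>|n K\<^sub>n(x, t)| \<le> C \<Sum>\<^bsub>M\<^sub>A \<le> n\<^esub> M\<^sub>A \<Sum>\<^bsub>s \<le> A\<^esub> M\<^sub>s 1[x\<^sub>i = t\<^sub>i for i < A, i \<noteq> s]\<close>.
  To estimate \<open>\<mu>(\<sigma>\<^sup>*f > \<lambda>)\<close>, stop the martingale just before it exceeds \<open>2\<^sup>k \<lambda> / C\<close>. The
  martingale stopped at the lowest level is bounded and its Fejer means stay below \<open>\<lambda> / 2\<close>. The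
  differences of consecutive levels are sums of atoms. Outside its support an atom on a cylinder of
  measure \<open>1 / M\<^sub>n\<close> contributes terms
  \<open>2\<^sup>k \<lambda> M\<^sub>A M\<^sub>s / M\<^sub>n\<^sup>2 1[x\<^sub>i = t\<^sub>i for i < A, i \<noteq> s]\<close> with \<open>s \<le> A \<le> n\<close>; those with a coefficient above
  \<open>\<lambda>\<close> are discarded together with their supports, the others are integrated. Both costs are
  \<open>O(2\<^bsup>k/2\<^esup> / M\<^sub>n)\<close>, and summing over all atoms gives \<open>\<lambda>\<^bsup>-1/2\<^esup> \<integral> (f\<^sup>*)\<^bsup>1/2\<^esup> d\<mu>\<close>.

  (b) Let \<open>f = \<Sum>\<^sub>l M\<^bsub>\<alpha>(l)\<^esub>\<^sup>g (D\<^bsub>M(\<alpha>(l)+1)\<^esub> - D\<^bsub>M(\<alpha>(l))\<^esub>)\<close> with \<open>1 < g < 1/p - 1\<close>. The upper bound on \<open>g\<close> puts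
  \<open>f\<close> into the Hardy space. For \<open>n = M\<^bsub>\<alpha>(l)\<^esub> + 1\<close> the last partial sum adds a single
  character to \<open>t\<^sub>n f\<close>, with a coefficient of at least \<open>c M\<^bsub>\<alpha>(l)\<^esub>\<^sup>g / n\<close>, which tends to infinity since
  \<open>g > 1\<close> and dominates everything coming from smaller indices if \<open>\<alpha>\<close> grows fast enough.
\<close>

section \<open>The Vilenkin system\<close>

text \<open>The bound \<open>R\<close> is a parameter so that the constants of the kernel and weak
  type estimates can be written explicitly in terms of it.\<close>

locale vilenkin =
  fixes m :: "nat \<Rightarrow> nat" and R :: nat
  assumes m_ge: "2 \<le> m k" and m_le: "m k \<le> R"
begin

abbreviation M :: "nat \<Rightarrow> nat" where "M \<equiv> gpow m"

section \<open>Growth of the numbers \<open>M k\<close>\<close>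

lemma m_pos: "0 < m k"
  using m_ge[of k] by simp

lemma R_ge: "2 \<le> R"
  using m_ge[of 0] m_le[of 0] by simp

lemma M_pos: "0 < M k"
  using gpow_gt[of m k] m_ge by simp

lemma M_double: "2 * M k \<le> M (Suc k)"
  using m_ge[of k] by (simp add: gpow_Suc)

lemma M_Suc_le: "M (Suc k) \<le> R * M k"
  using m_le[of k] by (simp add: gpow_Suc)

lemma M_mono: "i \<le> j \<Longrightarrow> M i \<le> M j"
proof (rule lift_Suc_mono_le[of M])
  show "M n \<le> M (Suc n)" for n
    using M_double[of n] by simp
qed

lemma M_strict: "i < j \<Longrightarrow> M i < M j"
  using M_mono[of "Suc i" j] M_double[of i] M_pos[of i] by simp

lemma M_power2_le: "2 ^ d * M k \<le> M (k + d)"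
proof (induction d)
  case (Suc d)
  then show ?case using M_double[of "k + d"] by simp
qed simp

lemma sum_M_le: "(\<Sum>s\<le>n. M s) \<le> 2 * M n"
proof (induction n)
  case (Suc n)
  then show ?case using M_double[of n] by simp
qed simp

section \<open>Digits and characters\<close>

lemma digit_add:
  assumes "a < m A" "k < M A"
  shows "digit m (a * M A + k) j = (if j < A then digit m k j else if j = A then a else 0)"
proof (cases "j \<le> A")
  case True
  \<comment> \<open>The candidate expansion of \<open>a * M A + k\<close>: the digits of
    \<open>k\<close> with \<open>a\<close> placed in front. Uniqueness of expansions identifies it
    with the true digits.\<close>
  define c where "c j = (if j < A then digit m k j else if j = A then a else 0)" for j
  have c: "c j < m j" for j
    using assms(1) m_pos[of j] by (simp add: c_def digit_def)
  have "k = (\<Sum>j<A. digit m k j * M j)"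
    using digit_expansion_upto[of k m A] assms(2) by simp
  also have "\<dots> = (\<Sum>j<A. c j * M j)"
    by (simp add: c_def)
  finally have "a * M A + k = (\<Sum>j<Suc A. c j * M j) + M (Suc A) * 0"
    by (simp add: c_def)
  from digit_unique_upto[OF m_ge c this, of j] True show ?thesis
    by (simp add: c_def)
next
  case False
  have "a * M A + k < Suc a * M A" using assms(2) by simp
  also have "\<dots> \<le> m A * M A" using assms(1) by (intro mult_le_mono1) simp
  also have "\<dots> = M (Suc A)" by (simp add: gpow_Suc)
  also have "\<dots> \<le> M j" using False by (intro M_mono) simp
  finally show ?thesis using False by (simp add: digit_def)
qed

text \<open>A common index range for all characters below \<open>M N\<close>, so that they can be
  multiplied and compared factor by factor.\<close>

lemma psi_eq_prod:
  assumes "n < M N"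
  shows "psi m n x = (\<Prod>k<N. rad m k x ^ digit m n k)"
proof -
  have "digit m n k = 0" if "N \<le> k" for k
    using assms M_mono[OF that] by (simp add: digit_def)
  then have "{k. digit m n k \<noteq> 0} \<subseteq> {..<N}"
    using not_less by blast
  then show ?thesis unfolding psi_def
    by (intro prod.mono_neutral_left) auto
qed

lemma psi_0: "psi m 0 x = 1"
  using psi_eq_prod[of 0 0] M_pos[of 0] by simp

lemma psi_add:
  assumes "a < m A" "k < M A"
  shows "psi m (a * M A + k) x = rad m A x ^ a * psi m k x"
proof -
  have "a * M A + k < Suc a * M A" using assms(2) by simp
  also have "\<dots> \<le> m A * M A" using assms(1) by (intro mult_le_mono1) simp
  finally have "a * M A + k < M (Suc A)" by (simp add: gpow_Suc)
  from psi_eq_prod[OF this, of x] psi_eq_prod[OF assms(2), of x] show ?thesis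
    using assms by (simp add: digit_add)
qed

lemma cmod_rad: "cmod (rad m k x) = 1"
proof -
  have "rad m k x = exp (\<i> * of_real (2 * pi * real (x k) / real (m k)))"
    by (simp add: rad_def mult_ac)
  then show ?thesis by (simp only: norm_exp_i_times)
qed

lemma cmod_psi: "cmod (psi m n x) = 1"
  by (simp add: psi_def prod_norm[symmetric] norm_power cmod_rad)

lemma rad_root_power: "rad m k x ^ m k = 1"
proof -
  have "rad m k x ^ m k = exp (of_nat (m k) * (2 * of_real pi * \<i> * of_nat (x k) / of_nat (m k)))"
    by (simp only: rad_def exp_of_nat_mult)
  also have "of_nat (m k) * (2 * of_real pi * \<i> * of_nat (x k) / of_nat (m k))
      = (2 * of_real pi * \<i> * of_nat (x k) :: complex)"
    using m_pos[of k] by simp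
  also have "\<dots> = of_nat (x k) * (2 * of_real pi * \<i>)" by simp
  also have "exp \<dots> = 1"
    by (simp only: exp_of_nat_mult exp_two_pi_i power_one)
  finally show ?thesis .
qed

lemma exp_2pi_eq_1D:
  assumes "exp (2 * of_real pi * \<i> * of_real r) = (1 :: complex)" "\<bar>r\<bar> < 1"
  shows "r = 0"
proof -
  from assms(1) obtain n :: int where "2 * pi * r = of_int (2 * n) * pi"
    by (auto simp: exp_eq_1)
  then have "r = of_int n" by simp
  with assms(2) show ?thesis by simp
qed

text \<open>The exponent is \<open>2 * pi * \<i>\<close> times a number of modulus less than 1, and
  such an exponential equals 1 only if that number is 0.\<close>

lemma rad_cnj_eq_1_iff:
  assumes "x k < m k" "t k < m k"
  shows "rad m k x * cnj (rad m k t) = 1 \<longleftrightarrow> x k = t k"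
proof
  assume *: "rad m k x * cnj (rad m k t) = 1"
  have "rad m k x * cnj (rad m k t)
      = exp (2 * of_real pi * \<i> * of_real ((real (x k) - real (t k)) / real (m k)))"
    by (simp add: rad_def exp_cnj exp_add[symmetric] diff_divide_distrib algebra_simps)
  with * have "(real (x k) - real (t k)) / real (m k) = 0"
    using assms by (intro exp_2pi_eq_1D) (auto simp: field_simps abs_less_iff)
  then show "x k = t k" using m_pos[of k] by simp
next
  assume "x k = t k"
  then have "rad m k x = rad m k t" by (simp add: rad_def)
  then show "rad m k x * cnj (rad m k t) = 1"
    by (simp add: complex_norm_square[symmetric] cmod_rad)
qed

lemma geometric_root_sum:
  fixes z :: complex
  assumes "z ^ n = 1" "z \<noteq> 1"
  shows "(\<Sum>c<n. z ^ c) = 0"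
  using assms by (simp add: sum_gp_strict)

lemma sum_rad_cnj_power:
  assumes "x k < m k" "t k < m k"
  shows "(\<Sum>c<m k. (rad m k x * cnj (rad m k t)) ^ c) = (if x k = t k then of_nat (m k) else 0)"
proof (cases "x k = t k")
  case True
  then show ?thesis using rad_cnj_eq_1_iff[of x k t] assms by simp
next
  case False
  have "(rad m k x * cnj (rad m k t)) ^ m k = 1"
    using rad_root_power[of k x] rad_root_power[of k t]
    by (simp add: power_mult_distrib flip: complex_cnj_power)
  then show ?thesis using False rad_cnj_eq_1_iff[of x k t] assms by (simp add: geometric_root_sum)
qed

lemma sum_exp_root:
  assumes "a < m k" "b < m k"
  shows "(\<Sum>c<m k. exp (2 * of_real pi * \<i> * of_nat c / of_nat (m k)) ^ a
      * cnj (exp (2 * of_real pi * \<i> * of_nat c / of_nat (m k)) ^ b))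
    = (if a = b then of_nat (m k) else 0)"
proof -
  \<comment> \<open>Point and exponent enter symmetrically, so the sum over the points
    \<open>c\<close> becomes a sum over powers at the constant points \<open>a\<close> and
    \<open>b\<close>.\<close>
  have e: "exp (2 * of_real pi * \<i> * of_nat c / of_nat (m k)) ^ a = rad m k (\<lambda>_. a) ^ c" for a c :: nat
    by (simp add: rad_def exp_of_nat_mult[symmetric] mult_ac)
  show ?thesis
    unfolding e using sum_rad_cnj_power[of "\<lambda>_. a" k "\<lambda>_. b"] assms
    by (simp add: power_mult_distrib)
qed

end

section \<open>Functions of finitely many coordinates\<close>

context vilenkin
begin

text \<open>One representative of each cylinder of order \<open>N\<close>.\<close>

definition reps :: "nat \<Rightarrow> (nat \<Rightarrow> nat) set" where
  "reps N = {x \<in> vgroup m. \<forall>i\<ge>N. x i = 0}"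

text \<open>Measurability with respect to the sigma-algebra of order \<open>N\<close>, phrased
  pointwise so that values of any type, including truth values, are covered.\<close>

definition depends_on :: "nat \<Rightarrow> ((nat \<Rightarrow> nat) \<Rightarrow> 'b) \<Rightarrow> bool" where
  "depends_on N g \<longleftrightarrow> (\<forall>x\<in>vgroup m. \<forall>y\<in>vgroup m. (\<forall>i<N. x i = y i) \<longrightarrow> g x = g y)"

text \<open>On functions of the first \<open>N\<close> coordinates this is the Haar integral, by
  \<open>depends_on_integral\<close> and \<open>depends_on_nn_integral\<close>. The type admits real
  and complex functions.\<close>

definition mean :: "nat \<Rightarrow> ((nat \<Rightarrow> nat) \<Rightarrow> 'a) \<Rightarrow> 'a :: real_normed_field" where
  "mean N g = (\<Sum>x\<in>reps N. g x) / of_nat (M N)"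

lemma in_vgroup: "x \<in> vgroup m \<longleftrightarrow> (\<forall>k. x k < m k)"
  by (auto simp: vgroup_def PiE_iff)

lemma reps_vgroup: "x \<in> reps N \<Longrightarrow> x \<in> vgroup m"
  by (simp add: reps_def)

lemma reps_0: "reps 0 = {\<lambda>_. 0}"
  using m_pos by (auto simp: reps_def in_vgroup)

lemma bij_reps_Suc: "bij_betw (\<lambda>(x, c). x(N := c)) (reps N \<times> {..<m N}) (reps (Suc N))"
proof (rule bij_betwI[where g = "\<lambda>y. (y(N := 0), y N)"])
  show "(\<lambda>(x, c). x(N := c)) \<in> reps N \<times> {..<m N} \<rightarrow> reps (Suc N)"
    by (auto simp: reps_def in_vgroup)
  show "(\<lambda>y. (y(N := 0), y N)) \<in> reps (Suc N) \<rightarrow> reps N \<times> {..<m N}"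
    using m_pos by (auto simp: reps_def in_vgroup not_less_eq_eq)
qed (auto simp: reps_def fun_eq_iff)

lemma finite_reps: "finite (reps N)"
proof (induction N)
  case (Suc N)
  then show ?case using bij_betw_finite[OF bij_reps_Suc[of N]] by simp
qed (simp add: reps_0)

lemma card_reps: "card (reps N) = M N"
proof (induction N)
  case (Suc N)
  then show ?case
    using bij_betw_same_card[OF bij_reps_Suc[of N]] by (simp add: card_cartesian_product gpow_Suc mult.commute)
qed (simp add: reps_0 gpow_0)

lemma depD: "depends_on N g \<Longrightarrow> x \<in> vgroup m \<Longrightarrow> y \<in> vgroup m \<Longrightarrow> (\<And>i. i < N \<Longrightarrow> x i = y i) \<Longrightarrow> g x = g y"
  unfolding depends_on_def by blast

lemma depI: "(\<And>x y. x \<in> vgroup m \<Longrightarrow> y \<in> vgroup m \<Longrightarrow> \<forall>i<N. x i = y i \<Longrightarrow> g x = g y) \<Longrightarrow> depends_on N g"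
  unfolding depends_on_def by blast

lemma depends_on_mono: "depends_on N g \<Longrightarrow> N \<le> N' \<Longrightarrow> depends_on N' g"
  by (rule depI) (rule depD, auto)

lemma depends_on_compose: "depends_on N g \<Longrightarrow> depends_on N (\<lambda>x. F (g x))"
  by (rule depI) (rule arg_cong[where f = F], rule depD, auto)

lemma depends_on_compose2: "depends_on N g \<Longrightarrow> depends_on N h \<Longrightarrow> depends_on N (\<lambda>x. F (g x) (h x))"
  by (rule depI) (rule arg_cong2[where f = F], (rule depD, auto)+)

lemma depends_on_sum: "(\<And>i. i \<in> I \<Longrightarrow> depends_on N (g i)) \<Longrightarrow> depends_on N (\<lambda>x. \<Sum>i\<in>I. g i x)"
  by (rule depI) (rule sum.cong[OF refl], rule depD, auto)

lemma depends_on_psi: "k < M N \<Longrightarrow> depends_on N (psi m k)"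
  unfolding depends_on_def by (auto simp: psi_eq_prod rad_def)

section \<open>Means over the representatives\<close>

lemma mean_cong: "(\<And>x. x \<in> reps N \<Longrightarrow> g x = h x) \<Longrightarrow> mean N g = mean N h"
  by (simp add: mean_def)

lemma mean_0: "mean N (\<lambda>_. 0) = 0"
  by (simp add: mean_def)

lemma mean_const: "mean N (\<lambda>_. c) = c"
  using M_pos[of N] by (simp add: mean_def card_reps)

lemma mean_add: "mean N (\<lambda>x. g x + h x) = mean N g + mean N h"
  by (simp add: mean_def sum.distrib add_divide_distrib)

lemma mean_cmult: "mean N (\<lambda>x. c * g x) = c * mean N g"
  by (simp add: mean_def sum_distrib_left[symmetric])

lemma mean_multc: "mean N (\<lambda>x. g x * c) = mean N g * c"
  by (simp add: mean_def sum_distrib_right[symmetric])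

lemma mean_sum: "mean N (\<lambda>x. \<Sum>i\<in>I. g i x) = (\<Sum>i\<in>I. mean N (g i))"
  by (simp add: mean_def sum.swap[of _ I] sum_divide_distrib)

lemma mean_swap: "mean N (\<lambda>x. mean N' (f x)) = mean N' (\<lambda>t. mean N (\<lambda>x. f x t))"
  by (simp add: mean_def sum_divide_distrib[symmetric] sum.swap[of _ "reps N'"] mult.commute)

lemma mean_mono:
  fixes g h :: "_ \<Rightarrow> real"
  shows "(\<And>x. x \<in> reps N \<Longrightarrow> g x \<le> h x) \<Longrightarrow> mean N g \<le> mean N h"
  unfolding mean_def by (intro divide_right_mono sum_mono) auto

lemma mean_nonneg:
  fixes g :: "_ \<Rightarrow> real"
  shows "(\<And>x. x \<in> reps N \<Longrightarrow> 0 \<le> g x) \<Longrightarrow> 0 \<le> mean N g"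
  using mean_mono[of N "\<lambda>_. 0" g] by (simp add: mean_0)

lemma norm_mean_le: "norm (mean N g) \<le> mean N (\<lambda>x. norm (g x))"
proof -
  have "norm (mean N g) = norm (\<Sum>x\<in>reps N. g x) / real (M N)"
    by (simp add: mean_def norm_divide)
  also have "\<dots> \<le> mean N (\<lambda>x. norm (g x))"
    unfolding mean_def of_nat_id by (intro divide_right_mono norm_sum) auto
  finally show ?thesis .
qed

text \<open>Independence: a weight that ignores coordinate \<open>A\<close> has the same sum over
  each of the \<open>m A\<close> slices of fixed \<open>t A\<close>, so the mean factorises.\<close>

lemma mean_coord:
  assumes A: "A < N" and w: "\<And>x c. x \<in> reps N \<Longrightarrow> c < m A \<Longrightarrow> w (x(A := c)) = w x"
  shows "mean N (\<lambda>t. w t * h (t A)) = mean N w * (\<Sum>c<m A. h c) / of_nat (m A)"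
proof -
  define W where "W c = (\<Sum>x\<in>{x\<in>reps N. x A = c}. w x)" for c
  define W0 where "W0 = W 0"
  have sub: "(\<lambda>x. x A) ` reps N \<subseteq> {..<m A}"
    by (auto simp: reps_def in_vgroup)
  have W: "W c = W0" if c: "c < m A" for c
    unfolding W0_def W_def
  proof (rule sum.reindex_bij_witness[where i = "\<lambda>x. x(A := c)" and j = "\<lambda>x. x(A := 0)"])
    fix x assume "x \<in> {x\<in>reps N. x A = c}"
    then show "w (x(A := 0)) = w x" "x(A := 0) \<in> {x \<in> reps N. x A = 0}"
      using m_pos[of A] w[of x 0] by (auto simp: reps_def in_vgroup)
  qed (use c A in \<open>auto simp: reps_def in_vgroup fun_eq_iff\<close>)
  have "(\<Sum>x\<in>reps N. w x * h (x A)) = (\<Sum>c<m A. \<Sum>x\<in>{x\<in>reps N. x A = c}. w x * h (x A))"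
    by (rule sum.group[symmetric]) (use finite_reps sub in auto)
  also have "\<dots> = (\<Sum>c<m A. W c * h c)"
    by (simp add: W_def sum_distrib_right)
  also have "\<dots> = W0 * (\<Sum>c<m A. h c)"
    unfolding sum_distrib_left by (rule sum.cong) (use W in auto)
  finally have 1: "(\<Sum>x\<in>reps N. w x * h (x A)) = W0 * (\<Sum>c<m A. h c)" .
  have "(\<Sum>x\<in>reps N. w x) = (\<Sum>c<m A. \<Sum>x\<in>{x\<in>reps N. x A = c}. w x)"
    by (rule sum.group[symmetric]) (use finite_reps sub in auto)
  also have "\<dots> = (\<Sum>c<m A. W0)"
    by (rule sum.cong) (use W in \<open>auto simp flip: W_def\<close>)
  finally have 2: "(\<Sum>x\<in>reps N. w x) = of_nat (m A) * W0" by simp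
  show ?thesis
    using m_pos[of A] by (simp add: mean_def 1 2)
qed

lemma depends_on_fun_upd:
  assumes "depends_on A w" "x \<in> reps N" "c < m B" "A \<le> B"
  shows "w (x(B := c)) = w x"
  by (rule depD[OF assms(1)]) (use assms in \<open>auto simp: reps_def in_vgroup\<close>)

lemma mean_coord_eq:
  fixes w :: "_ \<Rightarrow> real"
  assumes "A < N" "depends_on A w" "c < m A"
  shows "mean N (\<lambda>t. w t * of_bool (t A = c)) = mean N w / m A"
proof -
  have "(\<Sum>d<m A. of_bool (d = c)) = (1 :: real)"
    using assms(3) by (simp add: of_bool_def sum.delta')
  moreover have "w (x(A := d)) = w x" if "x \<in> reps N" "d < m A" for x d
    by (rule depends_on_fun_upd[OF assms(2) that order_refl])
  ultimately show ?thesis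
    using mean_coord[of A N w "\<lambda>d. of_bool (d = c)", OF assms(1)] by simp
qed

lemma mean_eq_on:
  assumes "finite S" "S \<subseteq> {..<N}" "x \<in> vgroup m"
  shows "mean N (\<lambda>t. of_bool (\<forall>i\<in>S. t i = x i)) = 1 / (\<Prod>i\<in>S. real (m i))"
  using assms(1,2)
proof (induction S)
  case empty
  then show ?case by (simp add: mean_const)
next
  case (insert A S)
  have "(\<Sum>d<m A. of_bool (d = x A)) = (1 :: real)"
    using assms(3) by (simp add: of_bool_def sum.delta' in_vgroup)
  moreover have "mean N (\<lambda>t. of_bool (\<forall>i\<in>insert A S. t i = x i))
      = mean N (\<lambda>t. of_bool (\<forall>i\<in>S. t i = x i) * of_bool (t A = x A) :: real)"
    by (rule mean_cong) auto
  moreover have "(\<forall>i\<in>S. (t(A := c)) i = x i) \<longleftrightarrow> (\<forall>i\<in>S. t i = x i)" for t c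
    using insert.hyps by auto
  ultimately show ?case
    using mean_coord[of A N "\<lambda>t. of_bool (\<forall>i\<in>S. t i = x i)" "\<lambda>d. of_bool (d = x A) :: real"] insert
    by (simp add: mult.commute)
qed

text \<open>The leading digit of such an index sits at position \<open>j\<close> and is nonzero. The
  remaining factors do not see coordinate \<open>j\<close>, and summing a nontrivial power of a root
  of unity over this coordinate gives 0. This is the martingale difference property.\<close>

lemma mean_psi_depends_on:
  assumes "j < N" "M j \<le> i" "i < M (Suc j)" "depends_on j w"
  shows "mean N (\<lambda>t. w t * psi m i t) = 0"
proof -
  define a where "a = i div M j"
  have "i < m j * M j" using assms(3) by (simp add: gpow_Suc)
  then have a: "a < m j" by (simp add: a_def less_mult_imp_div_less)
  have a0: "a \<noteq> 0" using assms(2) M_pos[of j] by (simp add: a_def div_eq_0_iff)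
  have i: "i = a * M j + i mod M j" by (simp only: a_def div_mult_mod_eq)
  define E where "E c = exp (2 * of_real pi * \<i> * of_nat c / of_nat (m j))" for c :: nat
  have "psi m i t = rad m j t ^ a * psi m (i mod M j) t" for t
    by (subst i, rule psi_add) (use a M_pos[of j] in auto)
  then have "mean N (\<lambda>t. w t * psi m i t) = mean N (\<lambda>t. (w t * psi m (i mod M j) t) * E (t j) ^ a)"
    by (simp add: E_def rad_def mult_ac)
  also have "\<dots> = mean N (\<lambda>t. w t * psi m (i mod M j) t) * (\<Sum>c<m j. E c ^ a) / of_nat (m j)"
  proof (rule mean_coord)
    have "depends_on j (\<lambda>t. w t * psi m (i mod M j) t)"
      using M_pos[of j] by (intro depends_on_compose2[where F = "(*)"] assms(4) depends_on_psi) simp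
    from depends_on_fun_upd[OF this _ _ order_refl]
    show "w (x(j := c)) * psi m (i mod M j) (x(j := c)) = w x * psi m (i mod M j) x"
      if "x \<in> reps N" "c < m j" for x c
      using that by blast
  qed (use assms in simp)
  also have "(\<Sum>c<m j. E c ^ a) = 0"
    using sum_exp_root[of a j 0] a a0 m_pos[of j] by (simp add: E_def)
  finally show ?thesis by simp
qed

lemma mean_orthonormal:
  assumes "i < M N" "j < M N"
  shows "mean N (\<lambda>t. psi m i t * cnj (psi m j t)) = of_bool (i = j)"
proof -
  \<comment> \<open>The induction peels off the leading digits of both indices and runs over their
    range \<open>M K\<close>; the order \<open>N\<close> of the mean stays fixed.\<close>
  have "mean N (\<lambda>t. psi m i t * cnj (psi m j t)) = of_bool (i = j)"
    if "i < M K" "j < M K" "K \<le> N" for K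
    using that
  proof (induction K arbitrary: i j)
    case 0
    then show ?case by (simp add: gpow_0 psi_0 mean_const)
  next
    case (Suc k)
    define a where "a = i div M k"
    define b where "b = j div M k"
    have a: "a < m k" and b: "b < m k"
      using Suc.prems by (auto simp: a_def b_def gpow_Suc less_mult_imp_div_less)
    define E where "E c = exp (2 * of_real pi * \<i> * of_nat c / of_nat (m k))" for c :: nat
    define w where "w t = psi m (i mod M k) t * cnj (psi m (j mod M k) t)" for t
    have p: "psi m l t = rad m k t ^ (l div M k) * psi m (l mod M k) t"
      if "l div M k < m k" for l and t :: "nat \<Rightarrow> nat"
      using psi_add[OF that mod_less_divisor[OF M_pos], of l t] by (simp only: div_mult_mod_eq)
    have "depends_on k w" unfolding w_def
      by (intro depends_on_compose2[where F = "\<lambda>u v. u * cnj v"] depends_on_psi) (use M_pos[of k] in auto)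
    have "psi m i t * cnj (psi m j t) = w t * (E (t k) ^ a * cnj (E (t k) ^ b))" for t
      using p[of i] p[of j] a b by (simp add: a_def b_def w_def E_def rad_def)
    then have "mean N (\<lambda>t. psi m i t * cnj (psi m j t)) = mean N (\<lambda>t. w t * (E (t k) ^ a * cnj (E (t k) ^ b)))"
      by simp
    also have "\<dots> = mean N w * (\<Sum>c<m k. E c ^ a * cnj (E c ^ b)) / of_nat (m k)"
      using Suc.prems depends_on_fun_upd[OF \<open>depends_on k w\<close> _ _ order_refl] by (intro mean_coord) auto
    also have "\<dots> = mean N w * of_bool (a = b)"
      unfolding E_def sum_exp_root[OF a b] using m_pos[of k] by simp
    also have "mean N w = of_bool (i mod M k = j mod M k)"
      unfolding w_def using Suc.prems M_pos[of k] by (intro Suc.IH) auto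
    also have "of_bool (i mod M k = j mod M k) * of_bool (a = b) = (of_bool (i = j) :: complex)"
      using div_mult_mod_eq[of i "M k"] div_mult_mod_eq[of j "M k"] by (auto simp: a_def b_def)
    finally show ?case .
  qed
  from this[of N] assms show ?thesis by simp
qed

section \<open>Transfer to the Haar measure\<close>

definition truncate :: "nat \<Rightarrow> (nat \<Rightarrow> nat) \<Rightarrow> nat \<Rightarrow> nat" where
  "truncate N x = (\<lambda>i. if i < N then x i else 0)"

lemma truncate_reps: "x \<in> vgroup m \<Longrightarrow> truncate N x \<in> reps N"
  using m_pos by (auto simp: truncate_def reps_def in_vgroup)

lemma depends_on_truncate: "depends_on N g \<Longrightarrow> x \<in> vgroup m \<Longrightarrow> g (truncate N x) = g x"
  by (rule depD, assumption, rule reps_vgroup, rule truncate_reps) (auto simp: truncate_def)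

lemma truncate_vimage:
  assumes "z \<in> reps N"
  shows "truncate N -` {z} \<inter> vgroup m = cylinder m N z"
  using assms by (auto simp: truncate_def reps_def cylinder_def fun_eq_iff)

lemma emeasure_cylinder:
  assumes "z \<in> vgroup m"
  shows "cylinder m N z \<in> sets (haar m)" "emeasure (haar m) (cylinder m N z) = ennreal (1 / M N)"
proof -
  have prob: "prob_space (uniform_count_measure {..<m k})" for k
    using m_pos[of k] by (intro prob_space_uniform_count_measure) auto
  interpret P: product_prob_space "\<lambda>k. uniform_count_measure {..<m k}" UNIV
    using prob by (rule product_prob_spaceI)
  have eq: "cylinder m N z = prod_emb UNIV (\<lambda>k. uniform_count_measure {..<m k}) {..<N} (Pi\<^sub>E {..<N} (\<lambda>k. {z k}))"
    using assms
    by (auto simp: cylinder_def prod_emb_def PiE_iff in_vgroup space_uniform_count_measure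
        extensional_def restrict_def)
  show "cylinder m N z \<in> sets (haar m)"
    unfolding eq haar_def using assms
    by (intro sets_PiM_I) (auto simp: sets_uniform_count_measure in_vgroup)
  have "emeasure (haar m) (cylinder m N z) = (\<Prod>k<N. emeasure (uniform_count_measure {..<m k}) {z k})"
    unfolding eq haar_def using assms
    by (intro P.emeasure_PiM_emb) (auto simp: sets_uniform_count_measure in_vgroup)
  also have "\<dots> = (\<Prod>k<N. ennreal (1 / m k))"
    using assms by (intro prod.cong refl)
      (auto simp: emeasure_uniform_count_measure in_vgroup)
  also have "\<dots> = ennreal (1 / M N)"
    by (simp add: prod_ennreal gpow_def prod_dividef)
  finally show "emeasure (haar m) (cylinder m N z) = ennreal (1 / M N)" .
qed

lemma truncate_measurable: "truncate N \<in> measurable (haar m) (count_space (reps N))"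
proof (rule measurable_count_space_eq2[THEN iffD2, OF finite_reps], intro conjI ballI)
  show "truncate N \<in> space (haar m) \<rightarrow> reps N"
    using truncate_reps by (auto simp: space_haar)
  show "truncate N -` {z} \<inter> space (haar m) \<in> sets (haar m)" if "z \<in> reps N" for z
    unfolding space_haar truncate_vimage[OF that]
    by (rule emeasure_cylinder) (rule reps_vgroup[OF that])
qed

text \<open>The fibres of \<open>truncate N\<close> are the cylinders of order \<open>N\<close>, all
  of measure \<open>1 / M N\<close>. Through this identity integrals of functions of finitely many
  coordinates become means.\<close>

lemma distr_truncate: "distr (haar m) (count_space (reps N)) (truncate N) = uniform_count_measure (reps N)"
proof (rule measure_eqI_finite[where A = "reps N"])
  show "emeasure (distr (haar m) (count_space (reps N)) (truncate N)) {z} = emeasure (uniform_count_measure (reps N)) {z}"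
    if "z \<in> reps N" for z
    using that truncate_measurable[of N] reps_vgroup[OF that] finite_reps[of N]
    by (simp add: emeasure_distr space_haar truncate_vimage emeasure_cylinder
        emeasure_uniform_count_measure card_reps)
qed (auto simp: sets_uniform_count_measure finite_reps)

lemma depends_on_measurable:
  assumes "depends_on N g" "\<And>x. x \<in> vgroup m \<Longrightarrow> g x \<in> space L"
  shows "g \<in> measurable (haar m) L"
proof -
  have "(\<lambda>x. g (truncate N x)) \<in> measurable (haar m) L"
    by (rule measurable_compose[OF truncate_measurable]) (use assms(2) reps_vgroup in \<open>auto simp: measurable_def\<close>)
  then show ?thesis
    by (rule measurable_cong[THEN iffD1, rotated]) (simp add: space_haar depends_on_truncate[OF assms(1)])
qed

lemma depends_on_sets:
  assumes "depends_on N P"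
  shows "{x \<in> space (haar m). P x} \<in> sets (haar m)"
  using depends_on_measurable[OF assms, of "count_space UNIV"] by (simp add: pred_def)

lemma depends_on_integral:
  fixes g :: "_ \<Rightarrow> complex"
  assumes "depends_on N g"
  shows "integrable (haar m) g" "(LINT x|haar m. g x) = mean N g"
proof -
  have int: "integrable (uniform_count_measure (reps N)) g"
    unfolding uniform_count_measure_def by (rule integrable_point_measure_finite[OF finite_reps])
  have "integrable (haar m) (\<lambda>x. g (truncate N x))"
    by (rule integrable_distr[OF truncate_measurable]) (simp add: distr_truncate int)
  then show "integrable (haar m) g"
    by (rule Bochner_Integration.integrable_cong[THEN iffD1, OF refl, rotated])
      (simp add: space_haar depends_on_truncate[OF assms])
  have "(LINT x|haar m. g x) = (LINT x|haar m. g (truncate N x))"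
    by (rule Bochner_Integration.integral_cong) (simp_all add: space_haar depends_on_truncate[OF assms])
  also have "\<dots> = (LINT x|uniform_count_measure (reps N). g x)"
    unfolding distr_truncate[symmetric] by (rule integral_distr[symmetric, OF truncate_measurable]) simp
  also have "\<dots> = mean N g"
    unfolding uniform_count_measure_def
    by (subst lebesgue_integral_point_measure_finite[OF finite_reps])
      (simp_all add: mean_def card_reps scaleR_conv_of_real sum_divide_distrib)
  finally show "(LINT x|haar m. g x) = mean N g" .
qed

lemma depends_on_nn_integral:
  fixes g :: "_ \<Rightarrow> real"
  assumes "depends_on N g" "\<And>x. x \<in> vgroup m \<Longrightarrow> 0 \<le> g x"
  shows "(\<integral>\<^sup>+x. ennreal (g x) \<partial>haar m) = ennreal (mean N g)"
proof -
  have "(\<integral>\<^sup>+x. ennreal (g x) \<partial>haar m) = (\<integral>\<^sup>+x. ennreal (g (truncate N x)) \<partial>haar m)"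
    by (rule nn_integral_cong) (simp add: space_haar depends_on_truncate[OF assms(1)])
  also have "\<dots> = (\<integral>\<^sup>+x. ennreal (g x) \<partial>uniform_count_measure (reps N))"
    unfolding distr_truncate[symmetric] by (rule nn_integral_distr[symmetric, OF truncate_measurable]) simp
  also have "\<dots> = (\<Sum>x\<in>reps N. ennreal (1 / M N) * ennreal (g x))"
    unfolding uniform_count_measure_def
    by (subst nn_integral_point_measure_finite[OF finite_reps]) (auto simp: card_reps mult.commute)
  also have "\<dots> = (\<Sum>x\<in>reps N. ennreal (1 / M N * g x))"
    using assms(2)[OF reps_vgroup] by (intro sum.cong refl ennreal_mult[symmetric]) auto
  also have "\<dots> = ennreal (mean N g)"
    using assms(2)[OF reps_vgroup] by (subst sum_ennreal) (auto simp: mean_def sum_divide_distrib)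
  finally show ?thesis .
qed

lemma depends_on_emeasure:
  assumes "depends_on N P"
  shows "emeasure (haar m) {x \<in> space (haar m). P x} = ennreal (mean N (\<lambda>x. of_bool (P x)))"
proof -
  have "emeasure (haar m) {x \<in> space (haar m). P x}
      = (\<integral>\<^sup>+x. indicator {x \<in> space (haar m). P x} x \<partial>haar m)"
    using depends_on_sets[OF assms] by simp
  also have "\<dots> = (\<integral>\<^sup>+x. ennreal (of_bool (P x)) \<partial>haar m)"
    by (rule nn_integral_cong) (auto simp: indicator_def)
  also have "\<dots> = ennreal (mean N (\<lambda>x. of_bool (P x)))"
    by (rule depends_on_nn_integral) (auto intro: depends_on_compose[OF assms])
  finally show ?thesis .
qed

end

section \<open>Dirichlet and Fejer kernels\<close>

context vilenkin
begin

text \<open>The kernels are functions of two points of the group, \<open>D\<^sub>n(x - t)\<close> and \<open>n K\<^sub>n(x - t)\<close> in the usual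
  notation.\<close>

definition dirichlet :: "nat \<Rightarrow> (nat \<Rightarrow> nat) \<Rightarrow> (nat \<Rightarrow> nat) \<Rightarrow> complex" where
  "dirichlet n x t = (\<Sum>k<n. psi m k x * cnj (psi m k t))"

definition fejer :: "nat \<Rightarrow> (nat \<Rightarrow> nat) \<Rightarrow> (nat \<Rightarrow> nat) \<Rightarrow> complex" where
  "fejer n x t = (\<Sum>k=1..n. dirichlet k x t)"

definition rad_kernel :: "nat \<Rightarrow> (nat \<Rightarrow> nat) \<Rightarrow> (nat \<Rightarrow> nat) \<Rightarrow> complex" where
  "rad_kernel A x t = rad m A x * cnj (rad m A t)"

definition agree :: "nat \<Rightarrow> (nat \<Rightarrow> nat) \<Rightarrow> (nat \<Rightarrow> nat) \<Rightarrow> bool" where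
  "agree A x t \<longleftrightarrow> (\<forall>i<A. t i = x i)"

definition agree_except :: "nat \<Rightarrow> nat \<Rightarrow> (nat \<Rightarrow> nat) \<Rightarrow> (nat \<Rightarrow> nat) \<Rightarrow> bool" where
  "agree_except A s x t \<longleftrightarrow> (\<forall>i<A. i \<noteq> s \<longrightarrow> t i = x i)"

text \<open>Up to a constant this dominates the Fejer kernel of index \<open>M A\<close>, see
  \<open>fejer_M_le\<close>. The summand \<open>s = A\<close> is the Dirichlet kernel of index
  \<open>M A\<close>; the others come from points that differ in one early coordinate
  \<open>s\<close>.\<close>

definition Phi :: "nat \<Rightarrow> (nat \<Rightarrow> nat) \<Rightarrow> (nat \<Rightarrow> nat) \<Rightarrow> real" where
  "Phi A x t = (\<Sum>s\<le>A. real (M s) * of_bool (agree_except A s x t))"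

section \<open>Dirichlet kernels\<close>

lemma norm_rad_kernel: "norm (rad_kernel A x t) = 1"
  by (simp add: rad_kernel_def norm_mult cmod_rad)

text \<open>The characters with indices from \<open>a * M A\<close> on are the initial characters
  multiplied by a power of \<open>rad m A\<close>.\<close>

lemma dirichlet_add:
  assumes "a < m A" "k \<le> M A"
  shows "dirichlet (a * M A + k) x t = dirichlet (a * M A) x t + rad_kernel A x t ^ a * dirichlet k x t"
  using assms(2)
proof (induction k)
  case (Suc k)
  then have "psi m (a * M A + k) y = rad m A y ^ a * psi m k y" for y
    using assms(1) by (intro psi_add) auto
  with Suc show ?case
    by (simp add: dirichlet_def rad_kernel_def algebra_simps power_mult_distrib)
qed (simp add: dirichlet_def)

lemma dirichlet_mult:
  assumes "a \<le> m A"
  shows "dirichlet (a * M A) x t = (\<Sum>i<a. rad_kernel A x t ^ i) * dirichlet (M A) x t"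
  using assms
proof (induction a)
  case (Suc a)
  then show ?case
    using dirichlet_add[of a A "M A" x t] by (simp add: algebra_simps)
qed (simp add: dirichlet_def)

lemma sum_rad_kernel:
  assumes "x \<in> vgroup m" "t \<in> vgroup m"
  shows "(\<Sum>c<m A. rad_kernel A x t ^ c) = of_nat (m A) * of_bool (t A = x A)"
  using sum_rad_cnj_power[of x A t] assms by (auto simp: in_vgroup rad_kernel_def)

text \<open>Paley's formula. Each step multiplies by a full geometric sum of roots of unity, which
  vanishes unless the points agree in coordinate \<open>A\<close>.\<close>

lemma dirichlet_M:
  assumes "x \<in> vgroup m" "t \<in> vgroup m"
  shows "dirichlet (M A) x t = of_nat (M A) * of_bool (agree A x t)"
proof (induction A)
  case 0
  then show ?case by (simp add: gpow_0 dirichlet_def psi_0 agree_def)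
next
  case (Suc A)
  have "dirichlet (M (Suc A)) x t = (\<Sum>i<m A. rad_kernel A x t ^ i) * dirichlet (M A) x t"
    using dirichlet_mult[of "m A" A x t] by (simp add: gpow_Suc)
  then show ?case
    unfolding sum_rad_kernel[OF assms] Suc.IH
    by (auto simp: gpow_Suc agree_def less_Suc_eq)
qed

lemma norm_sum_rad_kernel_le: "norm (\<Sum>i<a. rad_kernel A x t ^ i) \<le> a"
proof -
  have "norm (\<Sum>i<a. rad_kernel A x t ^ i) \<le> (\<Sum>i<a. norm (rad_kernel A x t ^ i))"
    by (rule norm_sum)
  then show ?thesis by (simp add: norm_power norm_rad_kernel)
qed

lemma norm_dirichlet_mult_le:
  assumes "x \<in> vgroup m" "t \<in> vgroup m" "a \<le> m A"
  shows "norm (dirichlet (a * M A) x t) \<le> real R * (real (M A) * of_bool (agree A x t))"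
proof -
  have "norm (\<Sum>i<a. rad_kernel A x t ^ i) \<le> R"
    using norm_sum_rad_kernel_le[of A x t a] assms(3) m_le[of A] by linarith
  then show ?thesis
    unfolding dirichlet_mult[OF assms(3)] dirichlet_M[OF assms(1,2)] norm_mult
    by (intro mult_mono) auto
qed

section \<open>Fejer kernels\<close>

lemma fejer_add:
  assumes "a < m A" "k \<le> M A"
  shows "fejer (a * M A + k) x t = fejer (a * M A) x t + of_nat k * dirichlet (a * M A) x t + rad_kernel A x t ^ a * fejer k x t"
  using assms(2)
proof (induction k)
  case (Suc k)
  have "fejer (a * M A + Suc k) x t = fejer (a * M A + k) x t + dirichlet (a * M A + Suc k) x t"
    by (simp add: fejer_def)
  also have "dirichlet (a * M A + Suc k) x t = dirichlet (a * M A) x t + rad_kernel A x t ^ a * dirichlet (Suc k) x t"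
    by (rule dirichlet_add) (use Suc assms in auto)
  also have "fejer (a * M A + k) x t = fejer (a * M A) x t + of_nat k * dirichlet (a * M A) x t + rad_kernel A x t ^ a * fejer k x t"
    using Suc by simp
  finally show ?case by (simp add: fejer_def algebra_simps)
qed (simp add: fejer_def)

lemma fejer_0: "fejer 0 x t = 0"
  by (simp add: fejer_def)

text \<open>Each of the \<open>a\<close> blocks contributes a modulated copy of
  \<open>fejer (M A)\<close> and \<open>M A\<close> times a Dirichlet kernel. The latter parts form
  the error and live where the first \<open>A\<close> coordinates agree.\<close>

lemma fejer_mult:
  assumes "x \<in> vgroup m" "t \<in> vgroup m" "a \<le> m A"
  shows "norm (fejer (a * M A) x t - (\<Sum>i<a. rad_kernel A x t ^ i) * fejer (M A) x t)
    \<le> real a * (real R * (real (M A) * (real (M A) * of_bool (agree A x t))))"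
  using assms(3)
proof (induction a)
  case (Suc a)
  have "fejer (Suc a * M A) x t = fejer (a * M A) x t + of_nat (M A) * dirichlet (a * M A) x t + rad_kernel A x t ^ a * fejer (M A) x t"
    using fejer_add[of a A "M A" x t] Suc.prems by (simp only: mult_Suc add.commute[of "M A"] order_refl Suc_le_eq)
  then have eq: "fejer (Suc a * M A) x t - (\<Sum>i<Suc a. rad_kernel A x t ^ i) * fejer (M A) x t
     = (fejer (a * M A) x t - (\<Sum>i<a. rad_kernel A x t ^ i) * fejer (M A) x t) + of_nat (M A) * dirichlet (a * M A) x t"
    by (simp only: sum.lessThan_Suc distrib_right) simp
  have "norm ((fejer (a * M A) x t - (\<Sum>i<a. rad_kernel A x t ^ i) * fejer (M A) x t) + of_nat (M A) * dirichlet (a * M A) x t) \<le> real a * (real R * (real (M A) * (real (M A) * of_bool (agree A x t)))) + norm (of_nat (M A) * dirichlet (a * M A) x t)"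
    by (rule norm_triangle_mono[OF Suc.IH order_refl]) (use Suc.prems in simp)
  also have "norm (of_nat (M A) * dirichlet (a * M A) x t) \<le> real (M A) * (real R * (real (M A) * of_bool (agree A x t)))"
    unfolding norm_mult norm_of_nat using Suc.prems
    by (intro mult_left_mono norm_dirichlet_mult_le assms) auto
  finally show ?case unfolding eq by (simp only: of_nat_Suc ring_distribs mult_1_left mult.left_commute[of "real R"] add.commute)
qed (simp add: fejer_0)

lemma Phi_nonneg: "0 \<le> Phi A x t"
  by (simp add: Phi_def sum_nonneg)

lemma agree_le_Phi: "real (M A) * of_bool (agree A x t) \<le> Phi A x t"
proof -
  have "real (M A) * of_bool (agree A x t) = real (M A) * of_bool (agree_except A A x t)"
    by (simp add: agree_def agree_except_def)
  also have "\<dots> \<le> Phi A x t"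
    unfolding Phi_def by (rule member_le_sum[where f = "\<lambda>s. real (M s) * of_bool (agree_except A s x t)"]) auto
  finally show ?thesis .
qed

text \<open>From \<open>M A\<close> to \<open>M (Suc A)\<close> the full geometric sum forces
  agreement in coordinate \<open>A\<close> on everything inherited, while the error from
  \<open>fejer_mult\<close> leaves this coordinate free and produces a new summand of
  \<open>Phi\<close>.\<close>

lemma fejer_M_le:
  assumes "x \<in> vgroup m" "t \<in> vgroup m"
  shows "norm (fejer (M A) x t) \<le> R\<^sup>2 * (M A * Phi A x t)"
proof (induction A)
  case 0
  have "1 \<le> (real R)\<^sup>2"
    using R_ge by (intro one_le_power) auto
  then show ?case by (simp add: gpow_0 fejer_def dirichlet_def psi_0 Phi_def agree_except_def)
next
  case (Suc A)
  let ?e = "of_bool (agree A x t) :: real" and ?d = "of_bool (t A = x A) :: real"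
  have "norm (fejer (M (Suc A)) x t) \<le> norm (fejer (m A * M A) x t - (\<Sum>i<m A. rad_kernel A x t ^ i) * fejer (M A) x t)
      + norm ((\<Sum>i<m A. rad_kernel A x t ^ i) * fejer (M A) x t)"
    unfolding gpow_Suc by (metis diff_add_cancel norm_triangle_ineq)
  also have "\<dots> \<le> m A * (R * (M A * (M A * ?e))) + m A * ?d * (R\<^sup>2 * (M A * Phi A x t))"
  proof (rule add_mono)
    show "norm (fejer (m A * M A) x t - (\<Sum>i<m A. rad_kernel A x t ^ i) * fejer (M A) x t)
        \<le> m A * (R * (M A * (M A * ?e)))"
      by (rule fejer_mult[OF assms order_refl])
    show "norm ((\<Sum>i<m A. rad_kernel A x t ^ i) * fejer (M A) x t) \<le> m A * ?d * (R\<^sup>2 * (M A * Phi A x t))"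
      using Suc.IH unfolding sum_rad_kernel[OF assms] norm_mult by (intro mult_mono) auto
  qed
  also have "m A * (R * (M A * (M A * ?e))) \<le> R * (R * (M A * (M A * ?e)))"
    using m_le[of A] by (intro mult_right_mono) auto
  also have "R * (R * (M A * (M A * ?e))) = R\<^sup>2 * (M A * (M A * ?e))"
    by (simp add: power2_eq_square)
  also have "R\<^sup>2 * (M A * (M A * ?e)) \<le> R\<^sup>2 * (M (Suc A) * (M A * ?e))"
    using M_mono[of A "Suc A"] by (intro mult_left_mono mult_right_mono) auto
  also have "R\<^sup>2 * (M (Suc A) * (M A * ?e)) + m A * ?d * (R\<^sup>2 * (M A * Phi A x t))
      = R\<^sup>2 * (M (Suc A) * (M A * ?e + ?d * Phi A x t))"
    by (simp add: gpow_Suc algebra_simps)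
  \<comment> \<open>The error is the new summand \<open>s = A\<close>. The inherited summands
    \<open>s < A\<close> keep their place with one more agreement, and the inherited summand
    \<open>s = A\<close> moves to \<open>s = Suc A\<close>.\<close>
  also have "M A * ?e + ?d * Phi A x t \<le> Phi (Suc A) x t"
  proof -
    have e: "?e = of_bool (agree_except (Suc A) A x t)"
      by (auto simp: agree_def agree_except_def less_Suc_eq)
    have "?d * Phi A x t = (\<Sum>s<A. real (M s) * (?d * of_bool (agree_except A s x t))) + real (M A) * (?d * of_bool (agree_except A A x t))"
      unfolding Phi_def by (simp add: lessThan_Suc_atMost[symmetric] algebra_simps sum_distrib_left)
    also have "(\<Sum>s<A. real (M s) * (?d * of_bool (agree_except A s x t))) = (\<Sum>s<A. real (M s) * of_bool (agree_except (Suc A) s x t))"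
      by (intro sum.cong) (auto simp: agree_except_def less_Suc_eq)
    also have "real (M A) * (?d * of_bool (agree_except A A x t)) \<le> real (M (Suc A)) * of_bool (agree_except (Suc A) (Suc A) x t)"
      using M_mono[of A "Suc A"] by (intro mult_mono) (auto simp: agree_except_def less_Suc_eq)
    finally show ?thesis
      unfolding Phi_def e by (simp add: lessThan_Suc_atMost[symmetric])
  qed
  finally show ?case by (simp add: mult_left_mono)
qed

text \<open>Induction over the digits of \<open>n\<close> from the top. The part of the leading
  digit costs two multiples of \<open>R ^ 3 * (M B * Phi B x t)\<close> for its full blocks and one
  for the Dirichlet term, hence the factor 3; the remainder \<open>k < M B\<close> is covered by the
  induction hypothesis.\<close>

lemma fejer_le:
  assumes "x \<in> vgroup m" "t \<in> vgroup m" "n < M B"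
  shows "norm (fejer n x t) \<le> 3 * R ^ 3 * (\<Sum>A<B. M A * Phi A x t)"
  using assms(3)
proof (induction B arbitrary: n)
  case 0
  then show ?case by (simp add: gpow_0 fejer_def)
next
  case (Suc B)
  define a where "a = n div M B"
  define k where "k = n mod M B"
  have a: "a < m B" using Suc.prems by (simp add: a_def gpow_Suc less_mult_imp_div_less)
  have k: "k < M B" using M_pos[of B] by (simp add: k_def)
  have n: "n = a * M B + k" by (simp only: a_def k_def div_mult_mod_eq)
  let ?P = "M B * Phi B x t"
  have P: "0 \<le> ?P" using Phi_nonneg by simp
  have e: "real (M B) * (real (M B) * of_bool (agree B x t)) \<le> ?P"
    using agree_le_Phi[of B x t] by (intro mult_left_mono) auto
  have R1: "1 \<le> real R" using R_ge by simp
  have aR: "real a \<le> R" using a m_le[of B] by linarith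
  have "norm (fejer (a * M B) x t) \<le> norm (fejer (a * M B) x t - (\<Sum>i<a. rad_kernel B x t ^ i) * fejer (M B) x t)
      + norm ((\<Sum>i<a. rad_kernel B x t ^ i) * fejer (M B) x t)"
    by (metis diff_add_cancel norm_triangle_ineq)
  also have "\<dots> \<le> real a * (real R * (real (M B) * (real (M B) * of_bool (agree B x t)))) + real a * (R\<^sup>2 * ?P)"
    unfolding norm_mult using a
    by (intro add_mono fejer_mult assms mult_mono norm_sum_rad_kernel_le fejer_M_le) auto
  also have "\<dots> \<le> R * (R * ?P) + R * (R\<^sup>2 * ?P)"
    by (intro add_mono mult_mono e aR order_refl) (use P in \<open>simp_all add: Phi_nonneg\<close>)
  also have "R * (R * ?P) \<le> R ^ 3 * ?P"
    using mult_right_mono[OF power_increasing[of 2 3 "real R"] P] R1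
    by (simp add: power2_eq_square mult.assoc)
  also have "R * (R\<^sup>2 * ?P) = R ^ 3 * ?P" by (simp add: power3_eq_cube power2_eq_square)
  finally have 1: "norm (fejer (a * M B) x t) \<le> R ^ 3 * ?P + R ^ 3 * ?P" by simp
  have "norm (of_nat k * dirichlet (a * M B) x t) \<le> real (M B) * (real R * (real (M B) * of_bool (agree B x t)))"
    unfolding norm_mult using a k
    by (intro mult_mono norm_dirichlet_mult_le assms) auto
  also have "\<dots> = real R * (real (M B) * (real (M B) * of_bool (agree B x t)))" by simp
  also have "\<dots> \<le> R ^ 3 * ?P"
    using R1 power_increasing[of 1 3 "real R"] by (intro mult_mono e) auto
  finally have 2: "norm (of_nat k * dirichlet (a * M B) x t) \<le> R ^ 3 * ?P" .
  have 3: "norm (rad_kernel B x t ^ a * fejer k x t) \<le> 3 * R ^ 3 * (\<Sum>A<B. M A * Phi A x t)"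
    using Suc.IH[OF k] by (simp add: norm_mult norm_power norm_rad_kernel)
  have "norm (fejer n x t) \<le> (R ^ 3 * ?P + R ^ 3 * ?P) + R ^ 3 * ?P + 3 * R ^ 3 * (\<Sum>A<B. M A * Phi A x t)"
    unfolding n fejer_add[OF a less_imp_le[OF k]]
    by (intro norm_triangle_mono 1 2 3)
  then show ?case by (simp add: algebra_simps)
qed

lemma gpow_bracket:
  assumes "1 \<le> n"
  obtains b where "M b \<le> n" "n < M (Suc b)"
proof -
  define K where "K = (LEAST K. n < M K)"
  have K: "n < M K" unfolding K_def by (rule LeastI) (rule gpow_gt[OF m_ge])
  have "K \<noteq> 0" using K assms by (cases K) (auto simp: gpow_0)
  then obtain b where b: "K = Suc b" by (cases K) auto
  have "M b \<le> n"
    using not_less_Least[of b "\<lambda>K. n < M K"] b by (simp add: K_def[symmetric] not_less)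
  with K b that show ?thesis by blast
qed

text \<open>Releasing the coordinate \<open>s\<close> enlarges the cylinder of measure
  \<open>1 / M A\<close> by a factor of at most \<open>R\<close>.\<close>

lemma mean_agree_except_le:
  assumes "x \<in> vgroup m" "A \<le> N"
  shows "mean N (\<lambda>t. of_bool (agree_except A s x t)) \<le> R / M A"
proof -
  let ?S = "{..<A} - {s}"
  have P: "(\<Prod>i\<in>?S. real (m i)) > 0" using m_pos by (simp add: prod_pos)
  have "real (M A) = (\<Prod>i<A. real (m i))" by (simp add: gpow_def)
  also have "\<dots> \<le> R * (\<Prod>i\<in>?S. real (m i))"
  proof (cases "s < A")
    case True
    have "(\<Prod>i<A. real (m i)) = m s * (\<Prod>i\<in>?S. real (m i))"
      by (rule prod.remove) (use True in auto)
    also have "\<dots> \<le> R * (\<Prod>i\<in>?S. real (m i))"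
      using m_le[of s] P by (intro mult_right_mono) auto
    finally show ?thesis .
  next
    case False
    then have "?S = {..<A}" by auto
    then show ?thesis using P R_ge by simp
  qed
  finally have "M A \<le> R * (\<Prod>i\<in>?S. real (m i))" .
  moreover have "mean N (\<lambda>t. of_bool (agree_except A s x t)) = 1 / (\<Prod>i\<in>?S. real (m i))"
  proof -
    have "agree_except A s x t \<longleftrightarrow> (\<forall>i\<in>?S. t i = x i)" for t
      by (auto simp: agree_except_def)
    moreover have "?S \<subseteq> {..<N}" using assms(2) by auto
    ultimately show ?thesis using mean_eq_on[of ?S N x] assms(1) by simp
  qed
  ultimately show ?thesis
    using P M_pos[of A] by (simp add: field_simps)
qed

lemma mean_Phi_le:
  assumes "x \<in> vgroup m" "A \<le> N"
  shows "mean N (Phi A x) \<le> 2 * R"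
proof -
  have "mean N (Phi A x) = (\<Sum>s\<le>A. real (M s) * mean N (\<lambda>t. of_bool (agree_except A s x t)))"
    unfolding Phi_def by (simp only: mean_sum mean_cmult)
  also have "\<dots> \<le> (\<Sum>s\<le>A. M s * (R / M A))"
    using assms by (intro sum_mono mult_left_mono mean_agree_except_le) auto
  also have "\<dots> = real (\<Sum>s\<le>A. M s) * (R / M A)"
    by (simp add: sum_distrib_right sum_divide_distrib)
  also have "\<dots> \<le> real (2 * M A) * (R / M A)"
    using sum_M_le[of A] by (intro mult_right_mono) (auto simp del: of_nat_sum)
  also have "\<dots> = 2 * R" using M_pos[of A] by simp
  finally show ?thesis .
qed

text \<open>Uniform boundedness of the Fejer kernels in \<open>L_1\<close>: all \<open>Phi A\<close>
  have bounded mean, and the weights \<open>M A\<close> with \<open>A <= b\<close> sum to at most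
  \<open>2 * M b\<close>, where \<open>M b <= n\<close>.\<close>

lemma mean_fejer_le:
  assumes "x \<in> vgroup m" "n < M N"
  shows "mean N (\<lambda>t. norm (fejer n x t)) \<le> 12 * R ^ 4 * n"
proof (cases "n = 0")
  case True
  then show ?thesis by (simp add: fejer_def mean_0)
next
  case False
  then obtain b where b: "M b \<le> n" "n < M (Suc b)" using gpow_bracket[of n] by auto
  have "M b < M N" using b(1) assms(2) by simp
  then have bN: "b < N" using M_mono[of N b] by (meson not_le)
  have "mean N (\<lambda>t. norm (fejer n x t)) \<le> mean N (\<lambda>t. 3 * R ^ 3 * (\<Sum>A<Suc b. M A * Phi A x t))"
    using b(2) assms(1) reps_vgroup by (intro mean_mono fejer_le) auto
  also have "\<dots> = 3 * R ^ 3 * (\<Sum>A<Suc b. M A * mean N (Phi A x))"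
    by (simp only: mean_cmult mean_sum)
  also have "\<dots> \<le> 3 * R ^ 3 * (\<Sum>A<Suc b. M A * real (2 * R))"
    using bN assms(1) by (intro mult_left_mono sum_mono mean_Phi_le) auto
  also have "\<dots> = 6 * R ^ 4 * real (\<Sum>A\<le>b. M A)"
    by (simp add: lessThan_Suc_atMost sum_distrib_right[symmetric] power4_eq_xxxx power3_eq_cube)
  also have "\<dots> \<le> 6 * R ^ 4 * real (2 * n)"
    using sum_M_le[of b] b(1) by (intro mult_left_mono of_nat_mono) auto
  finally show ?thesis by simp
qed

end

section \<open>Fejer means of an atom\<close>

text \<open>Pairs \<open>s <= A\<close> are regrouped by their gap \<open>d = A - s\<close>, and the
  triangle is enlarged to a square so that both sums can be treated separately.\<close>

lemma sum_triangle_le: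
  fixes h :: "nat \<Rightarrow> nat \<Rightarrow> real"
  assumes "\<And>s d. 0 \<le> h s d"
  shows "(\<Sum>A\<le>n. \<Sum>s\<le>A. h s (A - s)) \<le> (\<Sum>d\<le>n. \<Sum>s\<le>n. h s d)"
proof -
  have "(\<Sum>A\<le>n. \<Sum>s\<le>A. h s (A - s)) = (\<Sum>(s, d)\<in>{(s, d). s + d \<le> n}. h s d)"
    by (rule sum.triangle_reindex_eq[symmetric])
  also have "\<dots> \<le> (\<Sum>(s, d)\<in>{..n} \<times> {..n}. h s d)"
    using assms by (intro sum_mono2) auto
  also have "\<dots> = (\<Sum>d\<le>n. \<Sum>s\<le>n. h s d)"
    by (subst sum.swap) (simp add: sum.cartesian_product)
  finally show ?thesis .
qed

lemma sum_inv_sqrt2_le: "(\<Sum>d\<le>n. (1 / sqrt 2) ^ d) \<le> 4"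
proof -
  define r where "r = 1 / sqrt (2 :: real)"
  \<comment> \<open>This rational bound keeps the ratio at most \<open>3 / 4\<close>, so the
    geometric series is at most 4.\<close>
  have "4 / 3 \<le> sqrt (2 :: real)"
    by (rule real_le_rsqrt) (simp add: power2_eq_square)
  then have r: "0 < r" "r \<le> 3 / 4" by (auto simp: r_def field_simps)
  have "(\<Sum>d\<le>n. r ^ d) = (1 - r ^ Suc n) / (1 - r)"
    using r by (simp add: sum_gp0)
  also have "\<dots> \<le> 1 / (1 - r)"
    using r by (intro divide_right_mono) auto
  also have "\<dots> \<le> 4" using r by (simp add: field_simps)
  finally show ?thesis by (simp add: r_def)
qed

context vilenkin
begin

section \<open>Geometric sums along \<open>M\<close> and over pairs of orders\<close>

lemma sum_M_below:
  assumes "0 \<le> (T :: real)"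
  shows "(\<Sum>s\<le>n. if real (M s) \<le> T then real (M s) else 0) \<le> 2 * T"
proof (induction n)
  case 0
  have "(\<Sum>s\<le>0. if real (M s) \<le> T then real (M s) else 0) = (if real (M 0) \<le> T then real (M 0) else 0)"
    by simp
  then show ?case using assms by (auto split: if_splits)
next
  case (Suc n)
  show ?case
  proof (cases "real (M (Suc n)) \<le> T")
    case True
    have "(\<Sum>s\<le>Suc n. if real (M s) \<le> T then real (M s) else 0) \<le> (\<Sum>s\<le>Suc n. real (M s))"
      by (intro sum_mono) auto
    also have "\<dots> = real (\<Sum>s\<le>Suc n. M s)" by simp
    also have "\<dots> \<le> real (2 * M (Suc n))"
      by (intro of_nat_mono sum_M_le)
    finally show ?thesis using True by simp
  qed (use Suc in simp)
qed

lemma sum_inverse_M: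
  "(\<Sum>A=a..n. 1 / real (M A)) \<le> 2 / M a"
proof -
  have "(\<Sum>A=a..n. 1 / real (M A)) \<le> 2 / M a - 1 / M n" if "a \<le> n"
    using that
  proof (induction n rule: dec_induct)
    case (step n)
    have "2 * real (M n) \<le> real (M (Suc n))"
      using of_nat_mono[OF M_double[of n], where 'a = real] by simp
    then have "2 / real (M (Suc n)) \<le> 2 / (2 * real (M n))"
      using M_pos[of n] by (intro divide_left_mono) auto
    then have "2 / real (M (Suc n)) \<le> 1 / real (M n)" by simp
    with step show ?case by simp
  qed simp
  moreover have "0 \<le> 1 / real (M n)" by simp
  ultimately show ?thesis
    by (cases "a \<le> n") (linarith, simp)
qed

lemma sum_inverse_M_above:
  assumes "0 < (T :: real)"
  shows "(\<Sum>A\<le>n. if T < real (M A) then 1 / real (M A) else 0) \<le> 2 / T"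
proof (cases "\<exists>A\<le>n. T < M A")
  case True
  define a where "a = (LEAST A. T < M A)"
  have a: "T < M a" unfolding a_def by (rule LeastI_ex) (use True in blast)
  have a_min: "\<not> T < M A" if "A < a" for A
    using that unfolding a_def by (rule not_less_Least)
  have "(\<Sum>A\<le>n. if T < real (M A) then 1 / real (M A) else 0) = (\<Sum>A=a..n. if T < real (M A) then 1 / real (M A) else 0)"
    by (intro sum.mono_neutral_right) (auto simp: a_min not_le)
  also have "\<dots> \<le> (\<Sum>A=a..n. 1 / real (M A))"
    by (intro sum_mono) auto
  also have "\<dots> \<le> 2 / M a" by (rule sum_inverse_M)
  also have "\<dots> \<le> 2 / T" using a assms by (intro divide_left_mono) auto
  finally show ?thesis .
next
  case False
  then show ?thesis using assms by simp
qed

text \<open>A gap of \<open>d\<close> means \<open>M A >= 2 ^ d * M s\<close>, so the condition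
  forces \<open>M s <= \<tau> * r ^ d\<close> with \<open>r = 1 / sqrt 2\<close>. The sum over
  \<open>s\<close> is dominated by its largest term, and the remaining sum over \<open>d\<close> is
  geometric.\<close>

lemma sum_pairs_below:
  assumes "0 < (\<tau> :: real)"
  shows "(\<Sum>A\<le>n. \<Sum>s\<le>A. if real (M s) * real (M A) \<le> \<tau>\<^sup>2 then real (M s) else 0) \<le> 8 * \<tau>"
proof -
  define r where "r = 1 / sqrt (2 :: real)"
  have r: "0 < r" by (simp add: r_def)
  have "(r ^ d)\<^sup>2 = (r\<^sup>2) ^ d" for d
    by (simp only: power_mult[symmetric] mult.commute)
  then have rd: "(r ^ d)\<^sup>2 = 1 / 2 ^ d" for d
    by (simp add: r_def power_divide)
  define h where "h s d = (if real (M s) * real (M (s + d)) \<le> \<tau>\<^sup>2 then real (M s) else 0)" for s d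
  have "(\<Sum>A\<le>n. \<Sum>s\<le>A. if real (M s) * real (M A) \<le> \<tau>\<^sup>2 then real (M s) else 0)
      = (\<Sum>A\<le>n. \<Sum>s\<le>A. h s (A - s))"
    by (intro sum.cong refl) (simp add: h_def)
  also have "\<dots> \<le> (\<Sum>d\<le>n. \<Sum>s\<le>n. h s d)"
    by (rule sum_triangle_le) (simp add: h_def)
  also have "\<dots> \<le> (\<Sum>d\<le>n. 2 * (\<tau> * r ^ d))"
  proof (rule sum_mono)
    fix d
    have "h s d \<le> (if real (M s) \<le> \<tau> * r ^ d then real (M s) else 0)" for s
    proof (cases "real (M s) * real (M (s + d)) \<le> \<tau>\<^sup>2")
      case True
      have "real (2 ^ d * M s) \<le> real (M (s + d))"
        by (intro of_nat_mono M_power2_le)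
      then have "real (M s) * (2 ^ d * real (M s)) \<le> real (M s) * real (M (s + d))"
        by (intro mult_left_mono) auto
      with True have "(real (M s))\<^sup>2 * 2 ^ d \<le> \<tau>\<^sup>2"
        by (simp add: power2_eq_square mult_ac)
      then have "(real (M s))\<^sup>2 \<le> \<tau>\<^sup>2 / 2 ^ d" by (simp add: field_simps)
      also have "\<tau>\<^sup>2 / 2 ^ d = (\<tau> * r ^ d)\<^sup>2"
        by (simp add: power_mult_distrib rd)
      finally have "real (M s) \<le> \<tau> * r ^ d"
        by (rule power2_le_imp_le) (use r assms in simp)
      then show ?thesis by (simp add: h_def)
    qed (simp add: h_def)
    then have "(\<Sum>s\<le>n. h s d) \<le> (\<Sum>s\<le>n. if real (M s) \<le> \<tau> * r ^ d then real (M s) else 0)"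
      by (intro sum_mono)
    also have "\<dots> \<le> 2 * (\<tau> * r ^ d)"
      by (rule sum_M_below) (use r assms in simp)
    finally show "(\<Sum>s\<le>n. h s d) \<le> 2 * (\<tau> * r ^ d)" .
  qed
  also have "\<dots> = 2 * \<tau> * (\<Sum>d\<le>n. r ^ d)"
    by (simp only: sum_distrib_left mult.assoc)
  also have "\<dots> \<le> 2 * \<tau> * 4"
    using sum_inv_sqrt2_le[of n] assms by (intro mult_left_mono) (auto simp: r_def)
  finally show ?thesis by simp
qed

text \<open>Dual to \<open>sum_pairs_below\<close>: with gap \<open>d\<close>, exceeding the
  threshold forces \<open>M A > \<tau> / r ^ d\<close>, and the reciprocals of such
  \<open>M A\<close> sum to at most twice the reciprocal of this bound.\<close>

lemma sum_pairs_above: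
  assumes "0 < (\<tau> :: real)"
  shows "(\<Sum>A\<le>n. \<Sum>s\<le>A. if real (M s) * real (M A) \<le> \<tau>\<^sup>2 then 0 else 1 / real (M A)) \<le> 8 / \<tau>"
proof -
  define r where "r = 1 / sqrt (2 :: real)"
  have r: "0 < r" by (simp add: r_def)
  have "(r ^ d)\<^sup>2 = (r\<^sup>2) ^ d" for d
    by (simp only: power_mult[symmetric] mult.commute)
  then have rd: "(r ^ d)\<^sup>2 = 1 / 2 ^ d" for d
    by (simp add: r_def power_divide)
  define h where "h s d = (if real (M s) * real (M (s + d)) \<le> \<tau>\<^sup>2 then 0 else 1 / real (M (s + d)))" for s d
  have "(\<Sum>A\<le>n. \<Sum>s\<le>A. if real (M s) * real (M A) \<le> \<tau>\<^sup>2 then 0 else 1 / real (M A))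
      = (\<Sum>A\<le>n. \<Sum>s\<le>A. h s (A - s))"
    by (intro sum.cong refl) (simp add: h_def)
  also have "\<dots> \<le> (\<Sum>d\<le>n. \<Sum>s\<le>n. h s d)"
    by (rule sum_triangle_le) (simp add: h_def)
  also have "\<dots> \<le> (\<Sum>d\<le>n. 2 / \<tau> * r ^ d)"
  proof (rule sum_mono)
    fix d
    let ?g = "\<lambda>A. if \<tau> / r ^ d < real (M A) then 1 / real (M A) else 0"
    have "h s d \<le> ?g (s + d)" for s
    proof (cases "real (M s) * real (M (s + d)) \<le> \<tau>\<^sup>2")
      case False
      have "real (2 ^ d * M s) \<le> real (M (s + d))"
        by (intro of_nat_mono M_power2_le)
      then have "(2 ^ d * real (M s)) * real (M (s + d)) \<le> real (M (s + d)) * real (M (s + d))"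
        by (intro mult_right_mono) auto
      moreover have "2 ^ d * \<tau>\<^sup>2 < (2 ^ d * real (M s)) * real (M (s + d))"
        using False by (simp add: mult.assoc)
      ultimately have "2 ^ d * \<tau>\<^sup>2 < real (M (s + d)) * real (M (s + d))"
        by (rule less_le_trans[rotated])
      then have "2 ^ d * \<tau>\<^sup>2 < (real (M (s + d)))\<^sup>2"
        by (simp only: power2_eq_square)
      moreover have "2 ^ d * \<tau>\<^sup>2 = (\<tau> / r ^ d)\<^sup>2"
        by (simp add: power_divide rd)
      ultimately have "(\<tau> / r ^ d)\<^sup>2 < (real (M (s + d)))\<^sup>2" by simp
      then have "\<tau> / r ^ d < real (M (s + d))"
        by (rule power2_less_imp_less) simp
      then show ?thesis by (simp add: h_def)
    qed (simp add: h_def)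
    then have "(\<Sum>s\<le>n. h s d) \<le> (\<Sum>s\<le>n. ?g (s + d))"
      by (intro sum_mono)
    also have "\<dots> = (\<Sum>A\<in>(\<lambda>s. s + d) ` {..n}. ?g A)"
      by (subst sum.reindex) (auto simp: o_def)
    also have "\<dots> \<le> (\<Sum>A\<le>n + d. ?g A)"
      by (intro sum_mono2) auto
    also have "\<dots> \<le> 2 / (\<tau> / r ^ d)"
      by (rule sum_inverse_M_above) (use r assms in simp)
    finally show "(\<Sum>s\<le>n. h s d) \<le> 2 / \<tau> * r ^ d" by simp
  qed
  also have "\<dots> = 2 / \<tau> * (\<Sum>d\<le>n. r ^ d)"
    by (rule sum_distrib_left[symmetric])
  also have "\<dots> \<le> 2 / \<tau> * 4"
    using sum_inv_sqrt2_le[of n] assms by (intro mult_left_mono) (auto simp: r_def)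
  finally show ?thesis by simp
qed

section \<open>Overlap of a set with the kernel majorant\<close>

definition overlap :: "nat \<Rightarrow> ((nat \<Rightarrow> nat) \<Rightarrow> bool) \<Rightarrow> nat \<Rightarrow> nat \<Rightarrow> (nat \<Rightarrow> nat) \<Rightarrow> real" where
  "overlap N E A s x = mean N (\<lambda>t. of_bool (E t) * of_bool (agree_except A s x t))"

text \<open>The integral over \<open>E\<close> of the kernel majorant in \<open>fejer_le\<close>,
  restricted to the orders \<open>A <= n\<close> and without its constant.\<close>

definition overlap_sum :: "nat \<Rightarrow> ((nat \<Rightarrow> nat) \<Rightarrow> bool) \<Rightarrow> nat \<Rightarrow> (nat \<Rightarrow> nat) \<Rightarrow> real" where
  "overlap_sum N E n x = (\<Sum>A\<le>n. \<Sum>s\<le>A. real (M A) * (real (M s) * overlap N E A s x))"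

lemma overlap_nonneg: "0 \<le> overlap N E A s x"
  unfolding overlap_def by (rule mean_nonneg) simp

lemma depends_on_agree_except: "A \<le> N \<Longrightarrow> depends_on N (agree_except A s x)"
  by (rule depI) (auto simp: agree_except_def)

text \<open>Beyond order \<open>n\<close> each further coordinate is independent of \<open>E\<close>
  and of the earlier conditions. Requiring agreement there divides the overlap by
  \<open>m A\<close>, which the growth of \<open>M\<close> compensates exactly.\<close>

lemma overlap_stationary:
  assumes "depends_on n E" "s < n" "n \<le> A" "A \<le> N" "x \<in> vgroup m"
  shows "real (M A) * overlap N E A s x = real (M n) * overlap N E n s x"
  using assms(3,4)
proof (induction A rule: dec_induct)
  case (step A)
  have w: "depends_on A (\<lambda>t. of_bool (E t) * of_bool (agree_except A s x t) :: real)"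
    using depends_on_mono[OF assms(1) step(1)] depends_on_agree_except[of A A]
    by (intro depends_on_compose2[where F = "\<lambda>a b. of_bool a * of_bool b"]) auto
  have "overlap N E (Suc A) s x = mean N (\<lambda>t. (of_bool (E t) * of_bool (agree_except A s x t)) * of_bool (t A = x A))"
    unfolding overlap_def using assms(2) step(1)
    by (intro mean_cong) (auto simp: agree_except_def less_Suc_eq)
  also have "\<dots> = overlap N E A s x / m A"
    unfolding overlap_def by (rule mean_coord_eq[OF _ w]) (use step assms in \<open>auto simp: in_vgroup\<close>)
  finally show ?case using step m_pos[of A] by (simp add: gpow_Suc)
qed simp

text \<open>If the free coordinate \<open>s\<close> is not among the first \<open>n\<close>, then
  \<open>t\<close> and \<open>x\<close> agree in all coordinates that decide
  \<open>E\<close>.\<close>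

lemma overlap_outside:
  assumes "depends_on n E" "n \<le> s" "n \<le> A" "x \<in> vgroup m" "\<not> E x"
  shows "overlap N E A s x = 0"
proof -
  have "\<not> E t" if "t \<in> reps N" "agree_except A s x t" for t
    using depD[OF assms(1) reps_vgroup[OF that(1)] assms(4)] that(2) assms by (auto simp: agree_except_def)
  then have "overlap N E A s x = mean N (\<lambda>_. 0)"
    unfolding overlap_def by (intro mean_cong) auto
  then show ?thesis by (simp add: mean_0)
qed

lemma dirichlet_eq_0_of_cancel:
  assumes "\<And>k. k < M n \<Longrightarrow> mean N (\<lambda>t. b t * cnj (psi m k t)) = 0" "j \<le> M n"
  shows "mean N (\<lambda>t. b t * dirichlet j x t) = 0"
proof -
  have "mean N (\<lambda>t. b t * dirichlet j x t) = mean N (\<lambda>t. \<Sum>k<j. psi m k x * (b t * cnj (psi m k t)))"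
    by (simp add: dirichlet_def sum_distrib_left mult_ac)
  also have "\<dots> = 0"
    unfolding mean_sum mean_cmult using assms by (intro sum.neutral) auto
  finally show ?thesis .
qed

text \<open>By cancellation only \<open>j > M n\<close> matters. At an order \<open>A > n\<close>
  the terms with \<open>s >= n\<close> vanish outside the support and those with
  \<open>s < n\<close> equal the terms of order \<open>n\<close>, so each such order costs at most
  one further copy of \<open>overlap_sum\<close>.\<close>

lemma atom_fejer_le:
  assumes E: "depends_on n E" and b: "\<And>t. t \<in> reps N \<Longrightarrow> norm (b t) \<le> L * of_bool (E t)"
    and cancel: "\<And>k. k < M n \<Longrightarrow> mean N (\<lambda>t. b t * cnj (psi m k t)) = 0"
    and x: "x \<in> vgroup m" "\<not> E x" and n: "n \<le> N" and j: "j < M N" and L: "0 \<le> L"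
  shows "norm (mean N (\<lambda>t. b t * fejer j x t)) \<le> j * (3 * R ^ 3 * (L / M n * overlap_sum N E n x))"
proof (cases "j \<le> M n")
  case True
  have "mean N (\<lambda>t. b t * fejer j x t) = (\<Sum>k=1..j. mean N (\<lambda>t. b t * dirichlet k x t))"
    unfolding fejer_def by (simp only: sum_distrib_left mean_sum)
  also have "\<dots> = 0"
    using True by (intro sum.neutral ballI dirichlet_eq_0_of_cancel[OF cancel]) auto
  finally show ?thesis
    using L by (simp add: overlap_sum_def sum_nonneg overlap_nonneg)
next
  case False
  then have "1 \<le> j" by simp
  then obtain B where B: "M B \<le> j" "j < M (Suc B)" using gpow_bracket by blast
  have nB: "n \<le> B"
  proof (rule ccontr)
    assume "\<not> n \<le> B"
    then have "M (Suc B) \<le> M n" by (intro M_mono) simp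
    with False B show False by simp
  qed
  have BN: "B < N" using B(1) j M_mono[of N B] by (meson le_trans not_le)
  define T where "T A = (\<Sum>s\<le>A. real (M A) * (real (M s) * overlap N E A s x))" for A
  have distr: "e * (c * (\<Sum>s\<le>A. p s * q s)) = (\<Sum>s\<le>A. c * (p s * (e * q s)))"
    for e c :: real and p q and A :: nat
    by (simp add: sum_distrib_left mult.left_commute)
  have avT: "mean N (\<lambda>t. of_bool (E t) * (real (M A) * Phi A x t)) = T A" for A
  proof -
    have "mean N (\<lambda>t. of_bool (E t) * (real (M A) * Phi A x t))
      = mean N (\<lambda>t. \<Sum>s\<le>A. real (M A) * (real (M s) * (of_bool (E t) * of_bool (agree_except A s x t))))"
      unfolding Phi_def by (rule mean_cong) (rule distr)
    then show ?thesis unfolding T_def overlap_def by (simp only: mean_sum mean_cmult)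
  qed
  have W: "overlap_sum N E n x = (\<Sum>A\<le>n. T A)" by (simp add: overlap_sum_def T_def)
  have Tpos: "0 \<le> T A" for A unfolding T_def by (intro sum_nonneg mult_nonneg_nonneg overlap_nonneg) auto
  have TW: "T A \<le> overlap_sum N E n x" if "n < A" "A \<le> B" for A
  proof -
    have "T A = (\<Sum>s<n. real (M A) * (real (M s) * overlap N E A s x))"
      unfolding T_def using that overlap_outside[OF E _ _ x] by (intro sum.mono_neutral_right) auto
    also have "\<dots> = (\<Sum>s<n. real (M n) * (real (M s) * overlap N E n s x))"
    proof (rule sum.cong[OF refl])
      fix s assume "s \<in> {..<n}"
      then have "real (M A) * overlap N E A s x = real (M n) * overlap N E n s x"
        using that BN x(1) by (intro overlap_stationary[OF E]) auto
      then show "real (M A) * (real (M s) * overlap N E A s x) = real (M n) * (real (M s) * overlap N E n s x)"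
        by (metis mult.left_commute)
    qed
    also have "\<dots> \<le> T n"
      unfolding T_def by (intro sum_mono2) (auto simp: overlap_nonneg)
    also have "\<dots> \<le> overlap_sum N E n x"
      unfolding W using Tpos by (intro member_le_sum) auto
    finally show ?thesis .
  qed
  have W0: "0 \<le> overlap_sum N E n x" unfolding W using Tpos by (rule sum_nonneg)
  have "norm (mean N (\<lambda>t. b t * fejer j x t)) \<le> mean N (\<lambda>t. norm (b t * fejer j x t))"
    by (rule norm_mean_le)
  also have "\<dots> \<le> mean N (\<lambda>t. (3 * R ^ 3 * L) * (\<Sum>A<Suc B. of_bool (E t) * (real (M A) * Phi A x t)))"
  proof (rule mean_mono)
    fix t assume t: "t \<in> reps N"
    have "norm (b t * fejer j x t) \<le> (L * of_bool (E t)) * (3 * R ^ 3 * (\<Sum>A<Suc B. real (M A) * Phi A x t))"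
      unfolding norm_mult using L by (intro mult_mono b t fejer_le x reps_vgroup[OF t] B) auto
    then show "norm (b t * fejer j x t) \<le> (3 * R ^ 3 * L) * (\<Sum>A<Suc B. of_bool (E t) * (real (M A) * Phi A x t))"
      by (simp add: sum_distrib_left[symmetric] mult_ac)
  qed
  also have "\<dots> = (3 * R ^ 3 * L) * (\<Sum>A\<le>B. T A)"
    unfolding lessThan_Suc_atMost by (simp only: mean_cmult mean_sum avT)
  also have "\<dots> \<le> (3 * R ^ 3 * L) * (j / M n * overlap_sum N E n x)"
  proof (rule mult_left_mono)
    have "(\<Sum>A\<le>B. T A) = overlap_sum N E n x + (\<Sum>A=Suc n..B. T A)"
      unfolding W using nB sum.ub_add_nat[of 0 n T "B - n"]
      by (simp add: atLeast0AtMost)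
    also have "(\<Sum>A=Suc n..B. T A) \<le> (\<Sum>A=Suc n..B. overlap_sum N E n x)"
      using TW by (intro sum_mono) auto
    also have "overlap_sum N E n x + (\<Sum>A=Suc n..B. overlap_sum N E n x) = real (Suc (B - n)) * overlap_sum N E n x"
      using nB by (simp add: algebra_simps)
    \<comment> \<open>The number of copies is linear in \<open>B - n\<close>, whereas
      \<open>j / M n\<close> is at least \<open>2 ^ (B - n)\<close>.\<close>
    also have "\<dots> \<le> j / M n * overlap_sum N E n x"
    proof (rule mult_right_mono[OF _ W0])
      have "Suc (B - n) * M n \<le> 2 ^ (B - n) * M n"
        by (intro mult_le_mono1) (simp add: Suc_le_eq less_exp)
      also have "\<dots> \<le> M B" using M_power2_le[of "B - n" n] nB by simp
      also have "\<dots> \<le> j" by (rule B(1))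
      finally have "real (Suc (B - n) * M n) \<le> real j" by (rule of_nat_mono)
      then show "real (Suc (B - n)) \<le> j / M n"
        using M_pos[of n] by (simp add: pos_le_divide_eq del: of_nat_Suc flip: of_nat_mult)
    qed
    finally show "(\<Sum>A\<le>B. T A) \<le> j / M n * overlap_sum N E n x" by simp
  qed (use L in simp)
  finally show ?thesis by (simp add: mult_ac)
qed

text \<open>The coefficient of the term with indices \<open>s \<le> A\<close> exceeds the height of the estimate exactly if
  \<open>M\<^sub>s M\<^sub>A > \<tau>\<^sup>2\<close>. These terms are only counted, not summed: a nonzero overlap is at least \<open>1 / M\<^sub>n\<close>, so
  all of them vanish where \<open>overlap_above\<close> is below 1.\<close>

definition overlap_above :: "nat \<Rightarrow> ((nat \<Rightarrow> nat) \<Rightarrow> bool) \<Rightarrow> nat \<Rightarrow> real \<Rightarrow> (nat \<Rightarrow> nat) \<Rightarrow> real" where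
  "overlap_above N E n \<tau> x = (\<Sum>A\<le>n. \<Sum>s\<le>A. if real (M s) * real (M A) \<le> \<tau>\<^sup>2 then 0 else real (M n) * overlap N E A s x)"

definition overlap_below :: "nat \<Rightarrow> ((nat \<Rightarrow> nat) \<Rightarrow> bool) \<Rightarrow> nat \<Rightarrow> real \<Rightarrow> (nat \<Rightarrow> nat) \<Rightarrow> real" where
  "overlap_below N E n \<tau> x = (\<Sum>A\<le>n. \<Sum>s\<le>A. if real (M s) * real (M A) \<le> \<tau>\<^sup>2 then real (M A) * (real (M s) * overlap N E A s x) else 0)"

lemma overlap_above_nonneg: "0 \<le> overlap_above N E n \<tau> x"
  unfolding overlap_above_def by (intro sum_nonneg) (simp add: overlap_nonneg)

lemma overlap_below_nonneg: "0 \<le> overlap_below N E n \<tau> x"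
  unfolding overlap_below_def by (intro sum_nonneg) (simp add: overlap_nonneg)

lemma mean_agree:
  assumes "n \<le> N" "x \<in> vgroup m"
  shows "mean N (\<lambda>t. of_bool (agree n x t)) = 1 / real (M n)"
proof -
  have "agree n x t \<longleftrightarrow> (\<forall>i\<in>{..<n}. t i = x i)" for t
    by (auto simp: agree_def)
  then show ?thesis
    using mean_eq_on[of "{..<n}" N x] assms by (simp only: gpow_def of_nat_prod) auto
qed

text \<open>A single witness \<open>t\<close> brings its whole cylinder of order \<open>n\<close>,
  because both conditions depend on the first \<open>n\<close> coordinates only.\<close>

lemma overlap_pos_imp_ge:
  assumes "depends_on n E" "A \<le> n" "n \<le> N" "overlap N E A s x \<noteq> 0"
  shows "1 \<le> real (M n) * overlap N E A s x"
proof -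
  have "\<exists>t\<in>reps N. E t \<and> agree_except A s x t"
  proof (rule ccontr)
    assume *: "\<not> ?thesis"
    have "overlap N E A s x = mean N (\<lambda>_. 0)"
      unfolding overlap_def by (rule mean_cong) (use * in auto)
    with assms(4) show False by (simp add: mean_0)
  qed
  then obtain t where t: "t \<in> reps N" "E t" "agree_except A s x t" by blast
  have "1 / real (M n) = mean N (\<lambda>u. of_bool (agree n t u))"
    using mean_agree[OF assms(3) reps_vgroup[OF t(1)]] by simp
  also have "\<dots> \<le> overlap N E A s x"
    unfolding overlap_def
  proof (rule mean_mono)
    fix u assume u: "u \<in> reps N"
    have "E u" "agree_except A s x u" if "agree n t u"
      using that t depD[OF assms(1) reps_vgroup[OF t(1)] reps_vgroup[OF u]] assms(2)
      by (auto simp: agree_def agree_except_def)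
    then show "of_bool (agree n t u) \<le> (of_bool (E u) * of_bool (agree_except A s x u) :: real)" by auto
  qed
  finally show ?thesis using M_pos[of n] by (simp add: field_simps)
qed

lemma overlap_sum_le_overlap_below:
  assumes "depends_on n E" "n \<le> N" "overlap_above N E n \<tau> x < 1"
  shows "overlap_sum N E n x \<le> overlap_below N E n \<tau> x"
  unfolding overlap_sum_def overlap_below_def
proof (intro sum_mono)
  fix A s assume As: "A \<in> {..n}" "s \<in> {..A}"
  let ?y = "\<lambda>A s. if real (M s) * real (M A) \<le> \<tau>\<^sup>2 then 0 else real (M n) * overlap N E A s x"
  have "?y A s \<le> (\<Sum>s\<le>A. ?y A s)"
    using As by (intro member_le_sum[of s "{..A}" "?y A"]) (auto simp: overlap_nonneg)
  also have "\<dots> \<le> overlap_above N E n \<tau> x"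
    unfolding overlap_above_def using As
    by (intro member_le_sum[of A "{..n}" "\<lambda>A. \<Sum>s\<le>A. ?y A s"] sum_nonneg) (auto simp: overlap_nonneg)
  finally have "?y A s < 1" using assms(3) by simp
  then show "real (M A) * (real (M s) * overlap N E A s x)
      \<le> (if real (M s) * real (M A) \<le> \<tau>\<^sup>2 then real (M A) * (real (M s) * overlap N E A s x) else 0)"
    using overlap_pos_imp_ge[OF assms(1) _ assms(2), of A s x] As by (cases "overlap N E A s x = 0") auto
qed

text \<open>\<open>agree_except\<close> is symmetric in its two points, so after exchanging the
  means the inner one is bounded by \<open>mean_agree_except_le\<close>.\<close>

lemma mean_overlap_le:
  assumes "A \<le> N"
  shows "mean N (overlap N E A s) \<le> R / M A * mean N (\<lambda>t. of_bool (E t))"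
proof -
  have "mean N (overlap N E A s) = mean N (\<lambda>t. mean N (\<lambda>x. of_bool (E t) * of_bool (agree_except A s t x)))"
    unfolding overlap_def by (subst mean_swap) (simp only: agree_except_def eq_commute)
  also have "\<dots> \<le> mean N (\<lambda>t. of_bool (E t) * (R / M A))"
    unfolding mean_cmult using assms reps_vgroup by (intro mean_mono mult_left_mono mean_agree_except_le) auto
  also have "\<dots> = R / M A * mean N (\<lambda>t. of_bool (E t))"
    unfolding mean_multc by (rule mult.commute)
  finally show ?thesis .
qed

lemma mean_overlap_above_le:
  fixes \<tau> :: real
  assumes "n \<le> N" "0 < \<tau>"
  shows "mean N (overlap_above N E n \<tau>) \<le> 8 * R * (M n / \<tau>) * mean N (\<lambda>t. of_bool (E t))"
proof -
  let ?e = "mean N (\<lambda>t. of_bool (E t)) :: real"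
  have e: "0 \<le> ?e" by (rule mean_nonneg) simp
  have if0: "(\<lambda>x. if P then 0 else c * overlap N E A s x) = (\<lambda>x. (if P then 0 else c) * overlap N E A s x)" for P c A s
    by auto
  have "mean N (overlap_above N E n \<tau>) = (\<Sum>A\<le>n. \<Sum>s\<le>A. (if real (M s) * real (M A) \<le> \<tau>\<^sup>2 then 0 else real (M n)) * mean N (overlap N E A s))"
    unfolding overlap_above_def by (simp only: mean_sum if0 mean_cmult)
  also have "\<dots> \<le> (\<Sum>A\<le>n. \<Sum>s\<le>A. (if real (M s) * real (M A) \<le> \<tau>\<^sup>2 then 0 else real (M n)) * (R / M A * ?e))"
    using assms by (intro sum_mono mult_left_mono mean_overlap_le) auto
  also have "\<dots> = (\<Sum>A\<le>n. \<Sum>s\<le>A. (M n * R * ?e) * (if real (M s) * real (M A) \<le> \<tau>\<^sup>2 then 0 else 1 / real (M A)))"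
    by (intro sum.cong refl) auto
  also have "\<dots> = (M n * R * ?e) * (\<Sum>A\<le>n. \<Sum>s\<le>A. (if real (M s) * real (M A) \<le> \<tau>\<^sup>2 then 0 else 1 / real (M A)))"
    by (simp only: sum_distrib_left)
  also have "\<dots> \<le> (M n * R * ?e) * (8 / \<tau>)"
    using e by (intro mult_left_mono sum_pairs_above assms) auto
  finally show ?thesis by (simp add: mult_ac)
qed

lemma mean_overlap_below_le:
  fixes \<tau> :: real
  assumes "n \<le> N" "0 < \<tau>"
  shows "mean N (overlap_below N E n \<tau>) \<le> 8 * R * \<tau> * mean N (\<lambda>t. of_bool (E t))"
proof -
  let ?e = "mean N (\<lambda>t. of_bool (E t)) :: real"
  have e: "0 \<le> ?e" by (rule mean_nonneg) simp
  have if0: "(\<lambda>x. if P then c * (d * overlap N E A s x) else 0) = (\<lambda>x. (if P then c * d else 0) * overlap N E A s x)" for P c d A s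
    by auto
  have "mean N (overlap_below N E n \<tau>) = (\<Sum>A\<le>n. \<Sum>s\<le>A. (if real (M s) * real (M A) \<le> \<tau>\<^sup>2 then real (M A) * real (M s) else 0) * mean N (overlap N E A s))"
    unfolding overlap_below_def by (simp only: mean_sum if0 mean_cmult)
  also have "\<dots> \<le> (\<Sum>A\<le>n. \<Sum>s\<le>A. (if real (M s) * real (M A) \<le> \<tau>\<^sup>2 then real (M A) * real (M s) else 0) * (R / M A * ?e))"
    using assms by (intro sum_mono mult_left_mono mean_overlap_le) auto
  also have "\<dots> = (\<Sum>A\<le>n. \<Sum>s\<le>A. (R * ?e) * (if real (M s) * real (M A) \<le> \<tau>\<^sup>2 then real (M s) else 0))"
    using M_pos by (intro sum.cong refl) (auto simp: field_simps)
  also have "\<dots> = (R * ?e) * (\<Sum>A\<le>n. \<Sum>s\<le>A. (if real (M s) * real (M A) \<le> \<tau>\<^sup>2 then real (M s) else 0))"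
    by (simp only: sum_distrib_left)
  also have "\<dots> \<le> (R * ?e) * (8 * \<tau>)"
    using e by (intro mult_left_mono sum_pairs_below assms) auto
  finally show ?thesis by (simp add: mult_ac)
qed

end

section \<open>Stopped martingales\<close>

context vilenkin
begin

context
  fixes e :: "nat \<Rightarrow> complex"
begin

definition psum :: "nat \<Rightarrow> (nat \<Rightarrow> nat) \<Rightarrow> complex" where
  "psum n x = (\<Sum>i<n. e i * psi m i x)"

text \<open>Stopping one step early: the condition concerns level \<open>Suc j\<close> but ranges
  over the whole cylinder of order \<open>j\<close> around \<open>x\<close>, so it is decided by the
  first \<open>j\<close> coordinates. This keeps the stopped sums below \<open>L\<close>.\<close>

definition hit :: "real \<Rightarrow> nat \<Rightarrow> (nat \<Rightarrow> nat) \<Rightarrow> bool" where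
  "hit L n x \<longleftrightarrow> (\<exists>j\<le>n. \<exists>y\<in>vgroup m. agree j x y \<and> L < cmod (psum (M (Suc j)) y))"

definition first_hit :: "real \<Rightarrow> nat \<Rightarrow> (nat \<Rightarrow> nat) \<Rightarrow> bool" where
  "first_hit L n x \<longleftrightarrow> hit L n x \<and> (\<forall>j<n. \<not> hit L j x)"

definition increment :: "nat \<Rightarrow> (nat \<Rightarrow> nat) \<Rightarrow> complex" where
  "increment j x = psum (M (Suc j)) x - psum (M j) x"

text \<open>The stopped martingale is written as a martingale transform, so that cancellation can be
  checked on single increments.\<close>

definition stopped :: "nat \<Rightarrow> real \<Rightarrow> (nat \<Rightarrow> nat) \<Rightarrow> complex" where
  "stopped H L x = psum (M 0) x + (\<Sum>j<H. of_bool (\<not> hit L j x) * increment j x)"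

text \<open>The part of the difference between two stopping levels that lives where the lower one is
  first hit at order \<open>n\<close>; this set is a union of cylinders of order
  \<open>n\<close>.\<close>

definition atom :: "nat \<Rightarrow> real \<Rightarrow> real \<Rightarrow> nat \<Rightarrow> (nat \<Rightarrow> nat) \<Rightarrow> complex" where
  "atom H L L' n x = of_bool (first_hit L n x) * (stopped H L' x - stopped H L x)"

section \<open>First hits and stopped sums\<close>

lemma depends_on_psum: "n \<le> M N \<Longrightarrow> depends_on N (psum n)"
  unfolding psum_def by (rule depends_on_sum, rule depends_on_compose, rule depends_on_psi) auto

lemma depends_on_hit: "depends_on n (hit L n)"
proof (rule depI)
  fix x y :: "nat \<Rightarrow> nat" assume "\<forall>i<n. x i = y i"
  then have "agree j x z \<longleftrightarrow> agree j y z" if "j \<le> n" for j z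
    using that by (auto simp: agree_def)
  then show "hit L n x = hit L n y" unfolding hit_def by blast
qed

lemma hit_mono: "hit L i x \<Longrightarrow> i \<le> j \<Longrightarrow> hit L j x"
  unfolding hit_def by (meson order_trans)

lemma hit_anti: "hit L' j x \<Longrightarrow> L \<le> L' \<Longrightarrow> hit L j x"
  unfolding hit_def by (meson le_less_trans)

lemma depends_on_first_hit: "depends_on n (first_hit L n)"
proof (rule depI)
  fix x y assume *: "x \<in> vgroup m" "y \<in> vgroup m" "\<forall>i<n. x i = y i"
  have "hit L j x = hit L j y" if "j \<le> n" for j
    using depD[OF depends_on_hit, of x y j L] * that by auto
  then show "first_hit L n x = first_hit L n y" unfolding first_hit_def by auto
qed

lemma first_hit_exists:
  assumes "hit L j x" "j < H"
  obtains n where "n < H" "first_hit L n x"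
proof
  show "first_hit L (LEAST n. hit L n x) x"
    unfolding first_hit_def using LeastI[of "\<lambda>n. hit L n x", OF assms(1)] not_less_Least by blast
  show "(LEAST n. hit L n x) < H"
    using Least_le[of "\<lambda>n. hit L n x", OF assms(1)] assms(2) by simp
qed

lemma first_hit_unique: "first_hit L n x \<Longrightarrow> first_hit L n' x \<Longrightarrow> n = n'"
  unfolding first_hit_def by (meson linorder_neqE_nat)

lemma sum_first_hit:
  assumes "first_hit L n x" "n < H"
  shows "(\<Sum>n<H. of_bool (first_hit L n x)) = (1 :: 'b :: comm_semiring_1)"
proof -
  have "first_hit L n' x \<longleftrightarrow> n' = n" for n'
    using first_hit_unique assms(1) by blast
  then show ?thesis using assms(2) by simp
qed

lemma sum_first_hit_le: "(\<Sum>n<H. of_bool (first_hit L n x)) \<le> (1 :: real)"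
proof (cases "\<exists>n<H. first_hit L n x")
  case True
  then obtain n where "n < H" "first_hit L n x" by blast
  from sum_first_hit[OF this(2,1), where 'b = real] show ?thesis by simp
qed simp

lemma cmod_stopped_le:
  assumes "cmod (psum (M 0) x) \<le> L" "x \<in> vgroup m"
  shows "cmod (stopped H L x) \<le> L"
proof -
  \<comment> \<open>The second conjunct is needed for the induction: until the first hit the stopped
    sum is the partial sum itself, and the absence of a hit at order \<open>H\<close> bounds its
    next value.\<close>
  have "cmod (stopped H L x) \<le> L \<and> ((\<forall>j<H. \<not> hit L j x) \<longrightarrow> stopped H L x = psum (M H) x)"
  proof (induction H)
    case 0
    then show ?case using assms(1) by (simp add: stopped_def)
  next
    case (Suc H)
    have step: "stopped (Suc H) L x = stopped H L x + of_bool (\<not> hit L H x) * increment H x"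
      by (simp add: stopped_def)
    show ?case
    proof (cases "hit L H x")
      case True
      then show ?thesis using Suc step by auto
    next
      case False
      then have "\<forall>j<H. \<not> hit L j x" using hit_mono by (meson less_imp_le)
      with Suc have "stopped H L x = psum (M H) x" by simp
      then have "stopped (Suc H) L x = psum (M (Suc H)) x"
        using False step by (simp add: increment_def)
      moreover have "cmod (psum (M (Suc H)) x) \<le> L"
        using False assms(2) unfolding hit_def agree_def by (force simp: not_less)
      ultimately show ?thesis by simp
    qed
  qed
  then show ?thesis by simp
qed

lemma stopped_eq:
  assumes "\<And>j. j < H \<Longrightarrow> \<not> hit L j x"
  shows "stopped H L x = psum (M H) x"
proof -
  have "(\<Sum>j<H. of_bool (\<not> hit L j x) * increment j x) = (\<Sum>j<H. psum (M (Suc j)) x - psum (M j) x)"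
    using assms by (intro sum.cong) (auto simp: increment_def)
  also have "\<dots> = psum (M H) x - psum (M 0) x" by (rule sum_lessThan_telescope)
  finally show ?thesis by (simp add: stopped_def)
qed

text \<open>The first-hit sets are disjoint and cover all points where level \<open>L\<close> is
  hit. Elsewhere the higher level is not hit either, so both stopped sums coincide.\<close>

lemma sum_atom:
  assumes "L \<le> L'"
  shows "(\<Sum>n<H. atom H L L' n x) = stopped H L' x - stopped H L x"
proof (cases "\<exists>j<H. hit L j x")
  case True
  then obtain n where "n < H" "first_hit L n x" using first_hit_exists by blast
  from sum_first_hit[OF this(2,1), where 'b = complex] show ?thesis
    unfolding atom_def sum_distrib_right[symmetric] by simp
next
  case False
  then have "stopped H L' x = psum (M H) x" "stopped H L x = psum (M H) x"
    using hit_anti[OF _ assms] by (auto intro!: stopped_eq)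
  moreover have "\<not> first_hit L n x" if "n < H" for n
    using False that by (auto simp: first_hit_def)
  ultimately show ?thesis by (simp add: atom_def)
qed

lemma cmod_atom_le:
  assumes "cmod (psum (M 0) x) \<le> L" "L \<le> L'" "x \<in> vgroup m"
  shows "cmod (atom H L L' n x) \<le> (L + L') * of_bool (first_hit L n x)"
proof -
  have "cmod (stopped H L' x - stopped H L x) \<le> cmod (stopped H L' x) + cmod (stopped H L x)"
    by (rule norm_triangle_ineq4)
  also have "\<dots> \<le> L' + L"
    using assms by (intro add_mono cmod_stopped_le) auto
  finally show ?thesis by (simp add: atom_def norm_mult)
qed

section \<open>Cancellation and reproduction of partial sums\<close>

lemma mean_increment:
  assumes "j < N" "depends_on j w"
  shows "mean N (\<lambda>t. w t * increment j t) = 0"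
proof -
  have "{..<M (Suc j)} = {..<M j} \<union> {M j..<M (Suc j)}"
    using M_mono[of j "Suc j"] by auto
  then have "psum (M (Suc j)) t = psum (M j) t + (\<Sum>i=M j..<M (Suc j). e i * psi m i t)" for t
    unfolding psum_def by (simp add: sum.union_disjoint ivl_disj_int)
  then have "mean N (\<lambda>t. w t * increment j t) = mean N (\<lambda>t. \<Sum>i=M j..<M (Suc j). e i * (w t * psi m i t))"
    by (simp add: increment_def sum_distrib_left mult.left_commute)
  also have "\<dots> = 0"
    unfolding mean_sum mean_cmult using assms by (intro sum.neutral) (auto simp: mean_psi_depends_on)
  finally show ?thesis .
qed

text \<open>On the set of first hit at \<open>n\<close> neither level is hit before
  \<open>n\<close>, so the increments of order below \<open>n\<close> drop out. For
  \<open>j >= n\<close> the indicators and the character depend on the first \<open>j\<close>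
  coordinates, and the increment of order \<open>j\<close> is orthogonal to such functions.\<close>

lemma atom_cancel:
  assumes "L \<le> L'" "k < M n"
  shows "mean H (\<lambda>t. atom H L L' n t * cnj (psi m k t)) = 0"
proof -
  define w where "w j t = of_bool (first_hit L n t) * (of_bool (\<not> hit L' j t) - of_bool (\<not> hit L j t)) * cnj (psi m k t)"
    for j t
  have dist: "a * ((p + (\<Sum>j<H. f j * d j)) - (p + (\<Sum>j<H. g j * d j))) * c = (\<Sum>j<H. (a * (f j - g j) * c) * d j)"
    for a p c :: complex and f g d :: "nat \<Rightarrow> complex"
    by (simp only: add_diff_cancel_left sum_subtractf[symmetric] left_diff_distrib[symmetric]
        sum_distrib_left sum_distrib_right) (simp add: mult_ac)
  have "atom H L L' n t * cnj (psi m k t) = (\<Sum>j<H. w j t * increment j t)" for t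
    unfolding atom_def stopped_def w_def by (rule dist)
  then have "mean H (\<lambda>t. atom H L L' n t * cnj (psi m k t)) = (\<Sum>j<H. mean H (\<lambda>t. w j t * increment j t))"
    by (simp add: mean_sum)
  also have "\<dots> = 0"
  proof (intro sum.neutral ballI)
    fix j assume j: "j \<in> {..<H}"
    show "mean H (\<lambda>t. w j t * increment j t) = 0"
    proof (cases "j < n")
      case True
      have "w j t = 0" for t
        using True hit_anti[OF _ assms(1), of j t] by (auto simp: w_def first_hit_def)
      then show ?thesis by (simp add: mean_0)
    next
      case False
      then have nj: "n \<le> j" by simp
      have "depends_on j (w j)" unfolding w_def
        by (intro depends_on_compose2[where F = "(*)"] depends_on_compose2[where F = "(-)"] depends_on_compose[where F = of_bool]
            depends_on_compose[where F = Not] depends_on_compose[where F = cnj] depends_on_hit depends_on_mono[OF depends_on_first_hit nj]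
            depends_on_mono[OF depends_on_psi[OF assms(2)] nj])
      then show ?thesis using j by (intro mean_increment) auto
    qed
  qed
  finally show ?thesis .
qed

lemma mean_psum_psi:
  assumes "k < M H"
  shows "mean H (\<lambda>t. psum (M H) t * cnj (psi m k t)) = e k"
proof -
  have "mean H (\<lambda>t. psum (M H) t * cnj (psi m k t)) = mean H (\<lambda>t. \<Sum>i<M H. e i * (psi m i t * cnj (psi m k t)))"
    by (simp add: psum_def sum_distrib_right mult.assoc)
  also have "\<dots> = (\<Sum>i<M H. e i * of_bool (i = k))"
    unfolding mean_sum mean_cmult using assms by (intro sum.cong) (simp_all add: mean_orthonormal)
  also have "\<dots> = e k" using assms by (simp add: of_bool_def if_distrib cong: if_cong)
  finally show ?thesis .
qed

lemma mean_psum_dirichlet: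
  assumes "j \<le> M H"
  shows "mean H (\<lambda>t. psum (M H) t * dirichlet j x t) = psum j x"
proof -
  have "mean H (\<lambda>t. psum (M H) t * dirichlet j x t) = (\<Sum>k<j. psi m k x * mean H (\<lambda>t. psum (M H) t * cnj (psi m k t)))"
    unfolding mean_cmult[symmetric] mean_sum[symmetric] dirichlet_def
    by (simp add: sum_distrib_left mult.left_commute)
  then show ?thesis
    using assms mean_psum_psi unfolding psum_def by (simp add: mult.commute)
qed

lemma mean_psum_fejer:
  assumes "j \<le> M H"
  shows "mean H (\<lambda>t. psum (M H) t * fejer j x t) = (\<Sum>k=1..j. psum k x)"
proof -
  have "mean H (\<lambda>t. psum (M H) t * fejer j x t) = (\<Sum>k=1..j. mean H (\<lambda>t. psum (M H) t * dirichlet k x t))"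
    unfolding fejer_def sum_distrib_left mean_sum by (rule refl)
  also have "\<dots> = (\<Sum>k=1..j. psum k x)"
    using assms by (intro sum.cong mean_psum_dirichlet) auto
  finally show ?thesis .
qed

text \<open>A first hit at \<open>n\<close> is caused by a cylinder of order \<open>Suc n\<close> on
  which the level is exceeded. It fills the share \<open>1 / m n\<close>, hence at least
  \<open>1 / R\<close>, of the surrounding cylinder of order \<open>n\<close>: this is the price of
  stopping early.\<close>

lemma mean_first_hit_le:
  assumes "n < H"
  shows "mean H (\<lambda>x. of_bool (first_hit L n x))
    \<le> R * mean H (\<lambda>t. of_bool (first_hit L n t) * of_bool (L < cmod (psum (M (Suc n)) t)))"
proof -
  define w :: "_ \<Rightarrow> real" where "w t = of_bool (first_hit L n t) * of_bool (L < cmod (psum (M (Suc n)) t))" for t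
  have w: "0 \<le> w t" for t by (simp add: w_def)
  \<comment> \<open>The inner mean times \<open>M (Suc n)\<close> is at least 1 at every first hit;
    exchanging the means leaves the factor \<open>M (Suc n) / M n = m n\<close>.\<close>
  have "mean H (\<lambda>x. of_bool (first_hit L n x)) \<le> mean H (\<lambda>x. M (Suc n) * mean H (\<lambda>t. w t * of_bool (agree n t x)))"
  proof (rule mean_mono)
    fix x assume x: "x \<in> reps H"
    show "of_bool (first_hit L n x) \<le> M (Suc n) * mean H (\<lambda>t. w t * of_bool (agree n t x))"
    proof (cases "first_hit L n x")
      case True
      then obtain j y where jy: "j \<le> n" "y \<in> vgroup m" "agree j x y" "L < cmod (psum (M (Suc j)) y)"
        and nh: "\<forall>j<n. \<not> hit L j x"
        unfolding first_hit_def hit_def by blast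
      have "j = n"
      proof (rule ccontr)
        assume "j \<noteq> n"
        then have "hit L j x" "j < n" using jy unfolding hit_def by auto
        with nh show False by blast
      qed
      have "1 / real (M (Suc n)) = mean H (\<lambda>t. of_bool (agree (Suc n) y t))"
        using assms jy(2) by (intro mean_agree[symmetric]) auto
      also have "\<dots> \<le> mean H (\<lambda>t. w t * of_bool (agree n t x))"
      proof (rule mean_mono)
        fix t assume t: "t \<in> reps H"
        show "of_bool (agree (Suc n) y t) \<le> w t * of_bool (agree n t x)"
        proof (cases "agree (Suc n) y t")
          case True
          have "agree n t x" using True jy(3) \<open>j = n\<close> by (auto simp: agree_def)
          moreover have "first_hit L n t = first_hit L n x"
            using \<open>agree n t x\<close> by (intro depD[OF depends_on_first_hit] reps_vgroup[OF t] reps_vgroup[OF x]) (auto simp: agree_def)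
          moreover have "psum (M (Suc n)) t = psum (M (Suc n)) y"
            using True by (intro depD[OF depends_on_psum[OF order_refl]] reps_vgroup[OF t] jy) (auto simp: agree_def)
          ultimately show ?thesis
            using \<open>first_hit L n x\<close> jy(4) \<open>j = n\<close> by (simp add: w_def)
        qed (simp add: w)
      qed
      finally show ?thesis using True M_pos[of "Suc n"] by (simp add: field_simps)
    qed (simp add: mean_nonneg w)
  qed
  also have "\<dots> = M (Suc n) * mean H (\<lambda>t. w t * mean H (\<lambda>x. of_bool (agree n t x)))"
    unfolding mean_cmult by (subst mean_swap) (simp only: mean_cmult)
  also have "\<dots> = M (Suc n) * (mean H w * (1 / M n))"
  proof -
    have "mean H (\<lambda>t. w t * mean H (\<lambda>x. of_bool (agree n t x))) = mean H (\<lambda>t. w t * (1 / M n))"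
      using assms by (intro mean_cong) (simp add: mean_agree[OF _ reps_vgroup])
    then show ?thesis by (simp only: mean_multc)
  qed
  also have "\<dots> = m n * mean H w" using M_pos[of n] by (simp add: gpow_Suc)
  also have "\<dots> \<le> R * mean H w"
    using m_le[of n] w by (intro mult_right_mono mean_nonneg) auto
  finally show ?thesis unfolding w_def .
qed

text \<open>The first-hit sets are disjoint, so the sum over \<open>n\<close> collapses to the
  measure of the set where the maximal function exceeds \<open>L\<close>.\<close>

lemma sum_mean_first_hit_le:
  assumes "\<And>n t. n \<le> H \<Longrightarrow> t \<in> reps H \<Longrightarrow> cmod (psum (M n) t) \<le> Fs t"
  shows "(\<Sum>n<H. mean H (\<lambda>x. of_bool (first_hit L n x))) \<le> R * mean H (\<lambda>t. of_bool (L < Fs t))"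
proof -
  have "(\<Sum>n<H. mean H (\<lambda>x. of_bool (first_hit L n x)))
      \<le> (\<Sum>n<H. R * mean H (\<lambda>t. of_bool (first_hit L n t) * of_bool (L < Fs t)))"
  proof (rule sum_mono)
    fix n assume "n \<in> {..<H}"
    then have n: "n < H" by simp
    have "mean H (\<lambda>t. of_bool (first_hit L n t) * of_bool (L < cmod (psum (M (Suc n)) t)))
      \<le> mean H (\<lambda>t. of_bool (first_hit L n t) * of_bool (L < Fs t) :: real)"
      using assms[of "Suc n"] n by (intro mean_mono mult_left_mono) (auto intro: less_le_trans)
    then have "R * mean H (\<lambda>t. of_bool (first_hit L n t) * of_bool (L < cmod (psum (M (Suc n)) t)))
      \<le> R * mean H (\<lambda>t. of_bool (first_hit L n t) * of_bool (L < Fs t))"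
      by (intro mult_left_mono) auto
    with mean_first_hit_le[OF n, of L]
    show "mean H (\<lambda>x. of_bool (first_hit L n x)) \<le> R * mean H (\<lambda>t. of_bool (first_hit L n t) * of_bool (L < Fs t))"
      by (rule order_trans)
  qed
  also have "\<dots> = R * mean H (\<lambda>t. \<Sum>n<H. of_bool (first_hit L n t) * of_bool (L < Fs t))"
    by (simp only: sum_distrib_left[symmetric] mean_sum)
  also have "\<dots> \<le> R * mean H (\<lambda>t. of_bool (L < Fs t))"
    unfolding sum_distrib_right[symmetric]
    using sum_first_hit_le by (intro mult_left_mono mean_mono) (auto intro: mult_left_le_one_le sum_nonneg)
  finally show ?thesis .
qed

end

end

text \<open>A geometric sum with ratio \<open>sqrt 2\<close> is dominated by its last nonzero term,
  which lies below \<open>sqrt y\<close>.\<close>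

lemma sum_sqrt_levels_le:
  assumes "0 < (l :: real)" "0 \<le> y"
  shows "(\<Sum>k<K. sqrt (l * 2 ^ k) * of_bool (l * 2 ^ k < y)) \<le> 4 * sqrt y"
proof (induction K)
  case (Suc K)
  have all: "(\<Sum>k\<le>n. sqrt (l * 2 ^ k)) \<le> 4 * sqrt (l * 2 ^ n)" for n
  proof (induction n)
    case (Suc n)
    define s where "s = sqrt (l * 2 ^ n)"
    have s: "0 \<le> s" using assms by (simp add: s_def)
    \<comment> \<open>The induction step with constant 4 amounts to
      \<open>4 \<le> 3 * sqrt 2\<close>.\<close>
    have "4 / 3 \<le> sqrt (2 :: real)"
      by (rule real_le_rsqrt) (simp add: power2_eq_square)
    then have "4 * s \<le> 3 * (sqrt 2 * s)"
      using mult_right_mono[of "4 / 3" "sqrt 2" s] s by simp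
    moreover have "sqrt (l * 2 ^ Suc n) = sqrt 2 * s"
      by (simp add: s_def real_sqrt_mult)
    ultimately show ?case
      using Suc unfolding sum.atMost_Suc s_def[symmetric] by linarith
  qed (use assms in simp)
  show ?case
  proof (cases "l * 2 ^ K < y")
    case True
    have "(\<Sum>k<Suc K. sqrt (l * 2 ^ k) * of_bool (l * 2 ^ k < y)) \<le> (\<Sum>k\<le>K. sqrt (l * 2 ^ k))"
      unfolding lessThan_Suc_atMost using assms by (intro sum_mono) (auto simp: of_bool_def)
    also have "\<dots> \<le> 4 * sqrt (l * 2 ^ K)" by (rule all)
    also have "\<dots> \<le> 4 * sqrt y" using True by simp
    finally show ?thesis .
  qed (use Suc in simp)
qed (use assms in simp)

section \<open>The weak type estimate for Fejer means\<close>

context vilenkin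
begin

lemma cmod_psum_le: "cmod (psum e n x) \<le> (\<Sum>i<n. cmod (e i))"
  unfolding psum_def by (rule order_trans[OF norm_sum]) (simp add: norm_mult cmod_psi)

definition fejer_const :: real where "fejer_const = 12 * R ^ 4"

text \<open>The three summands pay for the set where the lowest level is hit, for the discarded
  pairs and for the integrated pairs. The factor \<open>R\<close> comes from
  \<open>sum_mean_first_hit_le\<close>, the factor 4 from \<open>sum_sqrt_levels_le\<close>.\<close>

definition weak_const :: real where "weak_const = 4 * R * (sqrt (2 * fejer_const) + 8 * R + 144 * R ^ 4)"

lemma fejer_const_pos: "0 < fejer_const"
  using R_ge by (simp add: fejer_const_def)

lemma weak_const_ge: "sqrt (2 * fejer_const) \<le> weak_const"
proof -
  have "sqrt (2 * fejer_const) \<le> sqrt (2 * fejer_const) + 8 * R + 144 * R ^ 4"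
    by simp
  also have "\<dots> = 1 * (sqrt (2 * fejer_const) + 8 * R + 144 * R ^ 4)" by simp
  also have "\<dots> \<le> (4 * R) * (sqrt (2 * fejer_const) + 8 * R + 144 * R ^ 4)"
    using R_ge fejer_const_pos by (intro mult_right_mono) auto
  finally show ?thesis by (simp add: weak_const_def)
qed

text \<open>Partial sums up to \<open>M H\<close> are bounded by the sum of the moduli of their
  coefficients, so a high enough level is never hit before \<open>H\<close>. The differences of
  consecutive dyadic levels telescope.\<close>

lemma stopped_decomposition:
  assumes l: "0 < (l :: real)"
  obtains K where "1 \<le> K"
    "\<And>t. t \<in> vgroup m \<Longrightarrow>
      psum e (M H) t = stopped e H l t + (\<Sum>k<K. \<Sum>n<H. atom e H (l * 2 ^ k) (l * 2 ^ Suc k) n t)"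
proof -
  define B where "B = (\<Sum>i<M H. cmod (e i))"
  obtain K0 :: nat where "B / l < K0" using reals_Archimedean2 by blast
  also have "real K0 < 2 ^ K0" by (rule of_nat_less_two_power)
  finally have "B < l * 2 ^ K0" using l by (simp add: field_simps)
  \<comment> \<open>The successor guarantees \<open>1 \<le> K\<close>, so that the lowest level
    \<open>k = 0\<close> occurs among the atoms.\<close>
  define K where "K = Suc K0"
  have "l * 2 ^ K0 \<le> l * 2 ^ K" using l by (simp add: K_def)
  with \<open>B < l * 2 ^ K0\<close> have K: "B < l * 2 ^ K" by simp
  have nohit: "\<not> hit e (l * 2 ^ K) j t" if "j < H" for j t
  proof
    assume "hit e (l * 2 ^ K) j t"
    then obtain i y where i: "i \<le> j" "l * 2 ^ K < cmod (psum e (M (Suc i)) y)"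
      unfolding hit_def by blast
    have "cmod (psum e (M (Suc i)) y) \<le> (\<Sum>i<M (Suc i). cmod (e i))" by (rule cmod_psum_le)
    also have "\<dots> \<le> B"
      unfolding B_def using M_mono[of "Suc i" H] i(1) that by (intro sum_mono2) auto
    finally show False using i(2) K by simp
  qed
  have "psum e (M H) t = stopped e H l t + (\<Sum>k<K. \<Sum>n<H. atom e H (l * 2 ^ k) (l * 2 ^ Suc k) n t)" for t
  proof -
    have "(\<Sum>k<K. \<Sum>n<H. atom e H (l * 2 ^ k) (l * 2 ^ Suc k) n t)
        = (\<Sum>k<K. stopped e H (l * 2 ^ Suc k) t - stopped e H (l * 2 ^ k) t)"
      using l by (intro sum.cong sum_atom) auto
    also have "\<dots> = stopped e H (l * 2 ^ K) t - stopped e H (l * 2 ^ 0) t"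
      by (rule sum_lessThan_telescope)
    also have "stopped e H (l * 2 ^ K) t = psum e (M H) t"
      by (rule stopped_eq) (rule nohit)
    finally show ?thesis by simp
  qed
  then show ?thesis by (intro that[of K]) (simp only: K_def, simp)
qed

lemma weak_type_discrete:
  fixes e :: "nat \<Rightarrow> complex" and Fs :: "(nat \<Rightarrow> nat) \<Rightarrow> real" and lam :: real
  assumes Fs: "\<And>n t. n \<le> H \<Longrightarrow> t \<in> reps H \<Longrightarrow> cmod (psum e (M n) t) \<le> Fs t" and lam: "0 < lam"
  shows "mean H (\<lambda>x. of_bool (\<exists>j. 1 \<le> j \<and> j < M H \<and> lam * j < cmod (\<Sum>k=1..j. psum e k x)))
    \<le> weak_const / sqrt lam * mean H (\<lambda>x. sqrt (Fs x))"
proof -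
  define bad where "bad x \<longleftrightarrow> (\<exists>j. 1 \<le> j \<and> j < M H \<and> lam * j < cmod (\<Sum>k=1..j. psum e k x))" for x
  \<comment> \<open>Chosen so that the Fejer sums of the part bounded by \<open>l\<close> stay below
    \<open>lam * j / 2\<close>.\<close>
  define l where "l = lam / (2 * fejer_const)"
  have l: "0 < l" using lam fejer_const_pos by (simp add: l_def)
  have lam_l: "lam = 2 * fejer_const * l" using fejer_const_pos by (simp add: l_def)
  have Fs0: "0 \<le> Fs t" if "t \<in> reps H" for t
    using Fs[of 0 t] that norm_ge_zero order_trans by blast
  have P0: "psum e (M 0) x = e 0" for x
    by (simp add: psum_def gpow_0 psi_0)
  have "mean H (\<lambda>x. of_bool (bad x)) \<le> weak_const / sqrt lam * mean H (\<lambda>x. sqrt (Fs x))"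
  \<comment> \<open>Stopping at level \<open>l\<close> needs an initial value within this level.
    Otherwise \<open>Fs\<close> is at least \<open>l\<close> everywhere and the trivial bound 1 for
    the left side suffices.\<close>
  proof (cases "cmod (e 0) \<le> l")
    case False
    have "mean H (\<lambda>x. of_bool (bad x)) \<le> mean H (\<lambda>x. weak_const / sqrt lam * sqrt (Fs x))"
    proof (rule mean_mono)
      fix x assume x: "x \<in> reps H"
      have "l \<le> Fs x" using Fs[of 0 x] x False P0 by simp
      then have "sqrt lam \<le> sqrt (2 * fejer_const) * sqrt (Fs x)"
        unfolding lam_l real_sqrt_mult[symmetric] using fejer_const_pos by simp
      also have "\<dots> \<le> weak_const * sqrt (Fs x)"
        using weak_const_ge Fs0[OF x] by (intro mult_right_mono) auto
      finally have "1 \<le> weak_const / sqrt lam * sqrt (Fs x)" using lam by (simp add: field_simps)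
      then show "of_bool (bad x) \<le> weak_const / sqrt lam * sqrt (Fs x)" by (simp add: of_bool_def)
    qed
    then show ?thesis by (simp only: mean_cmult)
  next
    case True
    obtain K where K: "1 \<le> K" and dec: "\<And>t. t \<in> vgroup m \<Longrightarrow>
        psum e (M H) t = stopped e H l t + (\<Sum>k<K. \<Sum>n<H. atom e H (l * 2 ^ k) (l * 2 ^ Suc k) n t)"
      by (rule stopped_decomposition[OF l, where e = e and H = H]) (rule that)
    define L where "L k = l * 2 ^ k" for k :: nat
    define E where "E k n = first_hit e (L k) n" for k n
    \<comment> \<open>A pair \<open>(A, s)\<close> satisfies
      \<open>M s * M A \<le> (\<tau> k n)\<^sup>2\<close> exactly if its coefficient
      \<open>L k * M A * M s / (M n)\<^sup>2\<close> is at most \<open>lam\<close>.\<close>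
    define \<tau> where "\<tau> k n = M n * sqrt (lam / L k)" for k n
    define G where "G k n x = 3 * R ^ 3 * ((L k + L (Suc k)) / M n * overlap_below H (E k n) n (\<tau> k n) x)" for k n x
    define Y where "Y k n x = overlap_above H (E k n) n (\<tau> k n) x" for k n x
    define \<mu> where "\<mu> k n = mean H (\<lambda>x. of_bool (E k n x) :: real)" for k n
    have L: "0 < L k" "L k \<le> L (Suc k)" "l \<le> L k" for k
      using l by (auto simp: L_def)
    have \<tau>: "0 < \<tau> k n" for k n
      using lam L M_pos by (simp add: \<tau>_def)
    have \<mu>: "0 \<le> \<mu> k n" for k n unfolding \<mu>_def by (rule mean_nonneg) simp
    have depE: "depends_on n (E k n)" for k n unfolding E_def by (rule depends_on_first_hit)
    have Y0: "0 \<le> Y k n x" for k n x by (simp add: Y_def overlap_above_nonneg)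
    have G0: "0 \<le> G k n x" for k n x using L[of k] L[of "Suc k"] by (simp add: G_def overlap_below_nonneg)
    \<comment> \<open>At a bad point one of three things happens, and each makes the corresponding
      sum at least 1: the lowest level is hit, the discarded pairs are present, or the kept pairs
      must supply at least \<open>lam / 2\<close>.\<close>
    have pointwise: "of_bool (bad x) \<le> (\<Sum>n<H. of_bool (E 0 n x)) + (\<Sum>k<K. \<Sum>n<H. Y k n x)
        + 2 / lam * (\<Sum>k<K. \<Sum>n<H. G k n x)" if x: "x \<in> reps H" for x
    proof -
      let ?S = "\<Sum>k<K. \<Sum>n<H. G k n x"
      have SY: "0 \<le> (\<Sum>k<K. \<Sum>n<H. Y k n x)" by (intro sum_nonneg Y0)
      have SG: "0 \<le> 2 / lam * ?S" using lam by (intro mult_nonneg_nonneg sum_nonneg G0) auto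
      have SE: "0 \<le> (\<Sum>n<H. of_bool (E 0 n x) :: real)" by (intro sum_nonneg) auto
      consider "\<exists>j<H. hit e l j x" | "1 \<le> (\<Sum>k<K. \<Sum>n<H. Y k n x)" | "\<not> bad x"
        | "\<forall>j<H. \<not> hit e l j x" "(\<Sum>k<K. \<Sum>n<H. Y k n x) < 1" "bad x"
        using not_le by blast
      then show ?thesis
      proof cases
        case 1
        then obtain n where n: "n < H" "first_hit e l n x" using first_hit_exists by blast
        have "(\<Sum>n<H. of_bool (E 0 n x)) = (1 :: real)"
          unfolding E_def L_def using sum_first_hit[OF n(2,1), where 'b = real] by simp
        with SY SG show ?thesis by (simp add: of_bool_def)
      next
        case 2
        with SE SG show ?thesis by (simp add: of_bool_def)
      next
        case 3
        with SY SE SG show ?thesis by simp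
      next
        case 4
        have xv: "x \<in> vgroup m" using x by (rule reps_vgroup)
        \<comment> \<open>Not hitting the lowest level excludes all higher ones, so \<open>x\<close>
          lies outside the support of every atom.\<close>
        have nE: "\<not> E k n x" if "n < H" for k n
          using 4(1) that hit_anti[OF _ L(3)[of k], of e n x] by (auto simp: E_def first_hit_def)
        have Y1: "Y k n x < 1" if "k < K" "n < H" for k n
        proof -
          have "Y k n x \<le> (\<Sum>n<H. Y k n x)"
            using that Y0 by (intro member_le_sum) auto
          also have "\<dots> \<le> (\<Sum>k<K. \<Sum>n<H. Y k n x)"
            using that Y0 by (intro member_le_sum[of k "{..<K}" "\<lambda>k. \<Sum>n<H. Y k n x"] sum_nonneg) auto
          finally show ?thesis using 4(2) by simp
        qed
        obtain j where j: "1 \<le> j" "j < M H" "lam * j < cmod (\<Sum>k=1..j. psum e k x)"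
          using 4(3) unfolding bad_def by blast
        have good: "cmod (mean H (\<lambda>t. stopped e H l t * fejer j x t)) \<le> l * (fejer_const * j)"
        proof -
          have "cmod (mean H (\<lambda>t. stopped e H l t * fejer j x t)) \<le> mean H (\<lambda>t. cmod (stopped e H l t * fejer j x t))"
            by (rule norm_mean_le)
          also have "\<dots> \<le> mean H (\<lambda>t. l * cmod (fejer j x t))"
            unfolding norm_mult using True P0 reps_vgroup
            by (intro mean_mono mult_right_mono cmod_stopped_le) auto
          also have "\<dots> = l * mean H (\<lambda>t. cmod (fejer j x t))" by (rule mean_cmult)
          also have "\<dots> \<le> l * (fejer_const * j)"
            unfolding fejer_const_def using l mean_fejer_le[OF xv j(2)] by (intro mult_left_mono) auto
          finally show ?thesis .
        qed
        have at: "cmod (mean H (\<lambda>t. atom e H (L k) (L (Suc k)) n t * fejer j x t)) \<le> j * G k n x"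
          if kn: "k < K" "n < H" for k n
        proof -
          have "cmod (mean H (\<lambda>t. atom e H (L k) (L (Suc k)) n t * fejer j x t))
              \<le> j * (3 * R ^ 3 * ((L k + L (Suc k)) / M n * overlap_sum H (E k n) n x))"
          proof (rule atom_fejer_le[OF depE])
            show "cmod (atom e H (L k) (L (Suc k)) n t) \<le> (L k + L (Suc k)) * of_bool (E k n t)"
              if "t \<in> reps H" for t
              unfolding E_def using True P0 L(3)[of k] reps_vgroup[OF that]
              by (intro cmod_atom_le L(2)) auto
            show "mean H (\<lambda>t. atom e H (L k) (L (Suc k)) n t * cnj (psi m i t)) = 0" if "i < M n" for i
              by (rule atom_cancel[OF L(2) that])
          qed (use xv nE kn j L(1)[of k] L(1)[of "Suc k"] in auto)
          also have "\<dots> \<le> j * G k n x"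
            unfolding G_def using L(1)[of k] L(1)[of "Suc k"] kn Y1[OF kn]
            by (intro mult_left_mono overlap_sum_le_overlap_below depE) (auto simp: Y_def)
          finally show ?thesis .
        qed
        have "(\<Sum>k=1..j. psum e k x) = mean H (\<lambda>t. psum e (M H) t * fejer j x t)"
          using j by (intro mean_psum_fejer[symmetric]) auto
        also have "\<dots> = mean H (\<lambda>t. stopped e H l t * fejer j x t
            + (\<Sum>k<K. \<Sum>n<H. atom e H (L k) (L (Suc k)) n t * fejer j x t))"
          using dec[OF reps_vgroup] unfolding L_def
          by (intro mean_cong) (simp add: distrib_right sum_distrib_right)
        also have "\<dots> = mean H (\<lambda>t. stopped e H l t * fejer j x t)
            + (\<Sum>k<K. \<Sum>n<H. mean H (\<lambda>t. atom e H (L k) (L (Suc k)) n t * fejer j x t))"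
          by (simp only: mean_add mean_sum)
        finally have eq: "(\<Sum>k=1..j. psum e k x) = mean H (\<lambda>t. stopped e H l t * fejer j x t)
            + (\<Sum>k<K. \<Sum>n<H. mean H (\<lambda>t. atom e H (L k) (L (Suc k)) n t * fejer j x t))" .
        have sumat: "cmod (\<Sum>k<K. \<Sum>n<H. mean H (\<lambda>t. atom e H (L k) (L (Suc k)) n t * fejer j x t))
            \<le> (\<Sum>k<K. \<Sum>n<H. j * G k n x)"
          by (intro sum_norm_le at) auto
        \<comment> \<open>The factor \<open>j\<close> is common to all terms and cancels; the
          bounded part uses up \<open>lam / 2\<close>.\<close>
        have "lam * j < l * (fejer_const * j) + (\<Sum>k<K. \<Sum>n<H. j * G k n x)"
          using j(3) unfolding eq by (rule less_le_trans) (rule norm_triangle_mono[OF good sumat])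
        also have "(\<Sum>k<K. \<Sum>n<H. j * G k n x) = j * ?S"
          by (simp only: sum_distrib_left)
        also have "l * (fejer_const * j) = j * (lam / 2)" by (simp add: lam_l)
        finally have "j * lam < j * (lam / 2 + ?S)" by (simp add: distrib_left mult.commute)
        then have "lam < lam / 2 + ?S" using j(1) by (simp add: mult_less_cancel_left)
        then have "1 \<le> 2 / lam * ?S" using lam by (simp add: field_simps)
        then show ?thesis using SE SY by (simp add: of_bool_def)
      qed
    qed
    have Yav: "mean H (Y k n) \<le> 8 * R * (sqrt (L k / lam) * \<mu> k n)" if "n < H" for k n
    proof -
      have "mean H (Y k n) \<le> 8 * R * (M n / \<tau> k n) * \<mu> k n"
        unfolding Y_def \<mu>_def using that by (intro mean_overlap_above_le \<tau>) auto
      also have "M n / \<tau> k n = sqrt (L k / lam)"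
        using M_pos[of n] lam L(1)[of k] by (simp add: \<tau>_def real_sqrt_divide)
      finally show ?thesis by simp
    qed
    \<comment> \<open>The constant is \<open>2 * 3 * 3 * 8\<close>; one factor 3 comes from
      \<open>L k + L (Suc k) = 3 * L k\<close>.\<close>
    have Gav: "2 / lam * mean H (G k n) \<le> 144 * R ^ 4 * (sqrt (L k / lam) * \<mu> k n)" if "n < H" for k n
    proof -
      have "mean H (G k n) = 3 * R ^ 3 * ((L k + L (Suc k)) / M n * mean H (overlap_below H (E k n) n (\<tau> k n)))"
        unfolding G_def by (simp only: mean_cmult)
      also have "\<dots> \<le> 3 * R ^ 3 * ((L k + L (Suc k)) / M n * (8 * R * \<tau> k n * \<mu> k n))"
        unfolding \<mu>_def using that L(1)[of k] L(1)[of "Suc k"] by (intro mult_left_mono mean_overlap_below_le \<tau>) auto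
      also have "\<dots> = 72 * R ^ 4 * (L k * sqrt (lam / L k) * \<mu> k n)"
        using M_pos[of n] by (simp add: \<tau>_def L_def power4_eq_xxxx power3_eq_cube)
      finally have "2 / lam * mean H (G k n) \<le> 2 / lam * (72 * R ^ 4 * (L k * sqrt (lam / L k) * \<mu> k n))"
        using lam by (intro mult_left_mono) auto
      also have "\<dots> = 144 * R ^ 4 * ((L k * sqrt (lam / L k) / lam) * \<mu> k n)" by simp
      also have "L k * sqrt (lam / L k) / lam = sqrt (L k / lam)"
      proof -
        have "sqrt (L k) * sqrt (L k) = L k" "sqrt lam * sqrt lam = lam"
          using L(1)[of k] lam by auto
        then show ?thesis
          using L(1)[of k] lam by (simp add: real_sqrt_divide field_simps)
      qed
      finally show ?thesis .
    qed
    \<comment> \<open>The measure of the lowest hit set is absorbed into the summand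
      \<open>k = 0\<close>, where
      \<open>sqrt (2 * fejer_const) * sqrt (L 0 / lam) = 1\<close>.\<close>
    have first: "(\<Sum>n<H. \<mu> 0 n) \<le> sqrt (2 * fejer_const) * (\<Sum>k<K. \<Sum>n<H. sqrt (L k / lam) * \<mu> k n)"
    proof -
      have "sqrt (2 * fejer_const) * sqrt (L 0 / lam) = 1"
        unfolding real_sqrt_mult[symmetric] using lam fejer_const_pos l by (simp add: L_def lam_l)
      then have "(\<Sum>n<H. \<mu> 0 n) = sqrt (2 * fejer_const) * (\<Sum>n<H. sqrt (L 0 / lam) * \<mu> 0 n)"
        by (simp add: sum_distrib_left[symmetric] mult.assoc[symmetric])
      also have "\<dots> \<le> sqrt (2 * fejer_const) * (\<Sum>k<K. \<Sum>n<H. sqrt (L k / lam) * \<mu> k n)"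
        using fejer_const_pos K lam L(1) \<mu>
        by (intro mult_left_mono member_le_sum[of 0 "{..<K}" "\<lambda>k. \<Sum>n<H. sqrt (L k / lam) * \<mu> k n"] sum_nonneg)
          (auto simp: less_imp_le)
      finally show ?thesis .
    qed
    define Q where "Q = (\<Sum>k<K. \<Sum>n<H. sqrt (L k / lam) * \<mu> k n)"
    have "mean H (\<lambda>x. of_bool (bad x)) \<le> mean H (\<lambda>x. (\<Sum>n<H. of_bool (E 0 n x)) + (\<Sum>k<K. \<Sum>n<H. Y k n x)
        + 2 / lam * (\<Sum>k<K. \<Sum>n<H. G k n x))"
      by (rule mean_mono) (rule pointwise)
    also have "\<dots> = (\<Sum>n<H. \<mu> 0 n) + (\<Sum>k<K. \<Sum>n<H. mean H (Y k n)) + (\<Sum>k<K. \<Sum>n<H. 2 / lam * mean H (G k n))"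
      unfolding \<mu>_def by (simp only: mean_add mean_sum mean_cmult sum_distrib_left)
    also have "\<dots> \<le> sqrt (2 * fejer_const) * Q + (\<Sum>k<K. \<Sum>n<H. 8 * R * (sqrt (L k / lam) * \<mu> k n))
        + (\<Sum>k<K. \<Sum>n<H. 144 * R ^ 4 * (sqrt (L k / lam) * \<mu> k n))"
      using first unfolding Q_def
      by (intro add_mono sum_mono Yav Gav) auto
    also have "\<dots> = (sqrt (2 * fejer_const) + 8 * R + 144 * R ^ 4) * Q"
    proof -
      have "(\<Sum>k<K. \<Sum>n<H. c * (sqrt (L k / lam) * \<mu> k n)) = c * Q" for c
        unfolding Q_def by (simp only: sum_distrib_left)
      then show ?thesis by (simp add: distrib_right)
    qed
    also have "Q \<le> (\<Sum>k<K. sqrt (L k / lam) * (R * mean H (\<lambda>t. of_bool (L k < Fs t))))"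
      unfolding Q_def sum_distrib_left[symmetric]
    proof (intro sum_mono mult_left_mono)
      show "(\<Sum>n<H. \<mu> k n) \<le> R * mean H (\<lambda>t. of_bool (L k < Fs t))" for k
        unfolding \<mu>_def E_def by (rule sum_mean_first_hit_le) (rule Fs)
    qed (use lam L(1) in \<open>auto simp: less_imp_le\<close>)
    also have "\<dots> = R / sqrt lam * mean H (\<lambda>t. \<Sum>k<K. sqrt (L k) * of_bool (L k < Fs t))"
      by (simp only: mean_sum mean_cmult) (simp add: sum_distrib_left real_sqrt_divide mult_ac)
    also have "\<dots> \<le> R / sqrt lam * mean H (\<lambda>t. 4 * sqrt (Fs t))"
      using lam l Fs0 unfolding L_def by (intro mult_left_mono mean_mono sum_sqrt_levels_le) auto
    also have "\<dots> = 4 * R / sqrt lam * mean H (\<lambda>t. sqrt (Fs t))"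
      by (simp add: mean_cmult)
    also have "(sqrt (2 * fejer_const) + 8 * R + 144 * R ^ 4) * \<dots> = weak_const / sqrt lam * mean H (\<lambda>x. sqrt (Fs x))"
      by (simp add: weak_const_def mult_ac)
    finally show ?thesis
      using fejer_const_pos by (simp add: mult_left_mono)
  qed
  then show ?thesis by (simp only: bad_def)
qed

end

section \<open>The two parts of the theorem\<close>

lemma epowr_mono: "x \<le> y \<Longrightarrow> 0 < p \<Longrightarrow> epowr x p \<le> epowr y p"
  unfolding epowr_def
  by (auto simp: top_unique less_top[symmetric] intro!: ennreal_leI powr_mono2 enn2real_mono)

lemma epowr_ennreal: "0 \<le> r \<Longrightarrow> epowr (ennreal r) p = ennreal (r powr p)"
  by (simp add: epowr_def)

lemma epowr_less_top: "epowr x p < \<infinity> \<longleftrightarrow> x < \<infinity>"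
  by (simp add: epowr_def less_top)

text \<open>Taking \<open>p\<close>-th roots bounds every \<open>u n\<close> by the root of
  \<open>B\<close>, hence also their supremum.\<close>

lemma epowr_SUP_le:
  assumes "0 < p" "\<And>n. epowr (u n) p \<le> B"
  shows "epowr (SUP n. u n) p \<le> B"
proof (cases "B = \<infinity>")
  case False
  have "u n \<le> ennreal (enn2real B powr (1 / p))" for n
  proof -
    have fin: "u n \<noteq> \<infinity>"
      using assms(2)[of n] False by (auto simp: epowr_def top_unique)
    have "ennreal (enn2real (u n) powr p) \<le> ennreal (enn2real B)"
    proof (cases "u n" "B" rule: ennreal2_cases)
      case (real_real r b)
      then show ?thesis using assms(2)[of n] by (simp add: epowr_def)
    qed (use fin False in auto)
    then have "enn2real (u n) powr p \<le> enn2real B" by (simp add: ennreal_le_iff)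
    then have "(enn2real (u n) powr p) powr (1 / p) \<le> enn2real B powr (1 / p)"
      using assms(1) by (intro powr_mono2) auto
    then have "enn2real (u n) \<le> enn2real B powr (1 / p)"
      using assms(1) by (simp add: powr_powr)
    then have "ennreal (enn2real (u n)) \<le> ennreal (enn2real B powr (1 / p))"
      by (rule ennreal_leI)
    then show ?thesis using fin by (cases "u n") auto
  qed
  then have "(SUP n. u n) \<le> ennreal (enn2real B powr (1 / p))" by (intro SUP_least)
  then have "epowr (SUP n. u n) p \<le> epowr (ennreal (enn2real B powr (1 / p))) p"
    using assms(1) by (rule epowr_mono)
  also have "\<dots> = B"
    using assms(1) False by (simp add: epowr_ennreal powr_powr less_top)
  finally show ?thesis .
qed simp

text \<open>After division by \<open>a + b\<close> both terms lie in the unit interval, where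
  \<open>u \<le> u powr p\<close>.\<close>

lemma powr_add_le:
  fixes a b :: real
  assumes "0 \<le> a" "0 \<le> b" "0 < p" "p \<le> 1"
  shows "(a + b) powr p \<le> a powr p + b powr p"
proof (cases "a + b = 0")
  case False
  then have s: "0 < a + b" using assms by simp
  have frac: "u / (a + b) \<le> (u / (a + b)) powr p" if "0 \<le> u" "u \<le> a + b" for u
    using powr_mono'[of p 1 "u / (a + b)"] that s assms by (simp add: powr_one)
  have "1 = a / (a + b) + b / (a + b)" using s by (simp add: add_divide_distrib[symmetric])
  also have "\<dots> \<le> (a / (a + b)) powr p + (b / (a + b)) powr p"
    using assms by (intro add_mono frac) auto
  also have "\<dots> = (a powr p + b powr p) / (a + b) powr p"
    using assms s by (simp add: powr_divide add_divide_distrib)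
  finally show ?thesis using s by (simp add: field_simps)
qed (use assms in simp)

lemma powr_sum_le:
  fixes u :: "nat \<Rightarrow> real"
  assumes "\<And>i. 0 \<le> u i" "0 < p" "p \<le> 1"
  shows "(\<Sum>i<n. u i) powr p \<le> (\<Sum>i<n. u i powr p)"
proof (induction n)
  case (Suc n)
  have "(\<Sum>i<Suc n. u i) powr p \<le> (\<Sum>i<n. u i) powr p + u n powr p"
    using powr_add_le[of "\<Sum>i<n. u i" "u n" p] assms by (simp add: sum_nonneg)
  with Suc show ?case by simp
qed simp

text \<open>Abel summation: the weighted sum is a combination of the partial sums \<open>T j\<close>
  with the nonnegative coefficients \<open>w j - w (Suc j)\<close> and, at the end,
  \<open>w n\<close>.\<close>

lemma weighted_sum_le:
  fixes S :: "nat \<Rightarrow> complex" and w :: "nat \<Rightarrow> real" and lam :: real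
  assumes w: "\<And>k. w (Suc k) \<le> w k" "\<And>k. 0 \<le> w k"
    and S: "\<And>j. 1 \<le> j \<Longrightarrow> j \<le> n \<Longrightarrow> cmod (\<Sum>k=1..j. S k) \<le> lam * j"
  shows "cmod (\<Sum>k=1..n. of_real (w k) * S k) \<le> lam * (\<Sum>k=1..n. w k)"
proof -
  define T where "T j = (\<Sum>k=1..j. S k)" for j
  have T: "cmod (T j) \<le> lam * j" if "j \<le> n" for j
    using S[of j] that by (cases "j = 0") (auto simp: T_def)
  \<comment> \<open>The boundary term \<open>w N * T N\<close> is left out of the induction, so that
    each step adds just one decrement of the weights.\<close>
  have "cmod ((\<Sum>k=1..N. of_real (w k) * S k) - of_real (w N) * T N) \<le> lam * ((\<Sum>k=1..N. w k) - w N * N)"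
    if "N \<le> n" for N
    using that
  proof (induction N)
    case 0
    then show ?case by (simp add: T_def)
  next
    case (Suc N)
    have eq: "(\<Sum>k=1..Suc N. of_real (w k) * S k) - of_real (w (Suc N)) * T (Suc N)
        = ((\<Sum>k=1..N. of_real (w k) * S k) - of_real (w N) * T N) + of_real (w N - w (Suc N)) * T N"
      by (simp add: T_def algebra_simps)
    have "cmod (of_real (w N - w (Suc N)) * T N) \<le> (w N - w (Suc N)) * (lam * N)"
      unfolding norm_mult norm_of_real using w(1)[of N] Suc.prems
      by (intro mult_mono T) auto
    with Suc have "cmod ((\<Sum>k=1..Suc N. of_real (w k) * S k) - of_real (w (Suc N)) * T (Suc N))
        \<le> lam * ((\<Sum>k=1..N. w k) - w N * N) + (w N - w (Suc N)) * (lam * N)"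
      unfolding eq by (intro norm_triangle_mono) auto
    also have "\<dots> = lam * ((\<Sum>k=1..Suc N. w k) - w (Suc N) * Suc N)"
      by (simp add: algebra_simps)
    finally show ?case .
  qed
  from this[of n] have 1: "cmod ((\<Sum>k=1..n. of_real (w k) * S k) - of_real (w n) * T n)
      \<le> lam * ((\<Sum>k=1..n. w k) - w n * n)" by simp
  have 2: "cmod (of_real (w n) * T n) \<le> w n * (lam * n)"
    unfolding norm_mult norm_of_real using w(2)[of n] by (intro mult_mono T) auto
  have "cmod (\<Sum>k=1..n. of_real (w k) * S k)
      = cmod (((\<Sum>k=1..n. of_real (w k) * S k) - of_real (w n) * T n) + of_real (w n) * T n)"
    by simp
  also have "\<dots> \<le> lam * ((\<Sum>k=1..n. w k) - w n * n) + w n * (lam * n)"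
    by (rule norm_triangle_mono[OF 1 2])
  also have "\<dots> = lam * (\<Sum>k=1..n. w k)" by (simp add: algebra_simps)
  finally show ?thesis .
qed

lemma sum_reverse_Qsum: "(\<Sum>k=1..n. q (n - k)) = Qsum q n"
proof -
  have "(\<Sum>k=1..n. q (n - k)) = (\<Sum>k<n. q (n - Suc k))"
    using sum.atLeast1_atMost_eq[of "\<lambda>k. q (n - k)" n] by simp
  also have "\<dots> = Qsum q n"
    unfolding Qsum_def by (rule sum.nat_diff_reindex)
  finally show ?thesis .
qed

lemma Qsum_pos:
  fixes q :: "nat \<Rightarrow> real"
  assumes "\<And>k. 0 \<le> q k" "0 < q 0" "1 \<le> n"
  shows "0 < Qsum q n"
proof -
  have "q 0 \<le> Qsum q n"
    unfolding Qsum_def using assms by (intro member_le_sum) auto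
  then show ?thesis using assms(2) by simp
qed

context vilenkin
begin

section \<open>Martingales and their coefficients\<close>

lemma msum_eq_psum: "msum m n f x = psum (mcoeff m f) n x"
  by (simp add: msum_def psum_def)

lemma fsum_eq_psum: "fsum m n g x = psum (fcoeff m g) n x"
  by (simp add: fsum_def psum_def)

lemma fcoeff_psum:
  assumes "i < M n" "\<And>x. x \<in> vgroup m \<Longrightarrow> g x = psum e (M n) x"
  shows "fcoeff m g i = e i"
proof -
  have d: "depends_on n (\<lambda>x. psum e (M n) x * cnj (psi m i x))"
    by (rule depends_on_compose2[where F = "\<lambda>a b. a * cnj b"]) (intro depends_on_psum depends_on_psi assms order_refl)+
  have "fcoeff m g i = (LINT x|haar m. psum e (M n) x * cnj (psi m i x))"
    unfolding fcoeff_def by (rule Bochner_Integration.integral_cong) (simp_all add: space_haar assms(2))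
  also have "\<dots> = mean n (\<lambda>x. psum e (M n) x * cnj (psi m i x))"
    by (rule depends_on_integral[OF d])
  also have "\<dots> = e i" by (rule mean_psum_psi[OF assms(1)])
  finally show ?thesis .
qed

text \<open>By the martingale property the sequence defining the limit is constant from index
  \<open>n\<close> on.\<close>

lemma mcoeff_eq_fcoeff:
  assumes "martingale m f" "i < M n"
  shows "mcoeff m f i = fcoeff m (f n) i"
proof -
  have "fcoeff m (f k) i = fcoeff m (f n) i" if "n \<le> k" for k
    using assms that by (intro fcoeff_psum[symmetric, OF assms(2)]) (auto simp: martingale_def fsum_eq_psum)
  then have "\<forall>\<^sub>F k in sequentially. fcoeff m (f k) i = fcoeff m (f n) i"
    unfolding eventually_sequentially by blast
  then have "(\<lambda>k. fcoeff m (f k) i) \<longlonglongrightarrow> fcoeff m (f n) i"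
    by (rule tendsto_eventually)
  then show ?thesis
    unfolding mcoeff_def fcoeff_def by (rule limI)
qed

text \<open>A martingale is determined by its coefficients, so the results on \<open>psum\<close>
  apply to it with \<open>e = mcoeff m f\<close>.\<close>

lemma martingale_eq_psum:
  assumes "martingale m f" "x \<in> vgroup m"
  shows "f n x = psum (mcoeff m f) (M n) x"
proof -
  have "f n x = psum (fcoeff m (f n)) (M n) x"
    using assms by (auto simp: martingale_def fsum_eq_psum)
  also have "\<dots> = psum (mcoeff m f) (M n) x"
    unfolding psum_def using mcoeff_eq_fcoeff[OF assms(1)] by (intro sum.cong) auto
  finally show ?thesis .
qed

section \<open>Weak type of the maximal Noerlund operator\<close>

lemma norlund_le:
  fixes lam :: real
  assumes "\<And>k. 0 \<le> q k" "0 < q 0" "mono q" "1 \<le> n"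
    and "\<And>j. 1 \<le> j \<Longrightarrow> j \<le> n \<Longrightarrow> cmod (\<Sum>k=1..j. psum (mcoeff m f) k x) \<le> lam * j"
  shows "cmod (norlund m q n f x) \<le> lam"
proof -
  have Q: "0 < Qsum q n" using assms by (intro Qsum_pos) auto
  \<comment> \<open>For \<open>k > n\<close> the truncated subtraction keeps the weight at
    \<open>q 0\<close>, so the weights are non-increasing in all \<open>k\<close>.\<close>
  have "cmod (\<Sum>k=1..n. of_real (q (n - k)) * msum m k f x) \<le> lam * (\<Sum>k=1..n. q (n - k))"
    unfolding msum_eq_psum using assms by (intro weighted_sum_le) (auto intro: monoD)
  then have "cmod (\<Sum>k=1..n. of_real (q (n - k)) * msum m k f x) \<le> lam * Qsum q n"
    unfolding sum_reverse_Qsum .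
  then show ?thesis
    using Q by (simp add: norlund_def norm_divide field_simps)
qed

text \<open>The level set lies in an increasing union of sets \<open>B H\<close> of finite order.
  The discrete estimate applies to each of them with a bound independent of
  \<open>H\<close>.\<close>

lemma weak_type_measure:
  assumes f: "martingale m f" and q: "\<And>k. 0 \<le> q k" "0 < q 0" "mono q" and l: "0 < l"
  shows "emeasure (haar m) {x \<in> space (haar m). ennreal l < norlund_max m q f x}
    \<le> ennreal (weak_const / sqrt l) * (\<integral>\<^sup>+x. epowr (mart_max f x) (1 / 2) \<partial>haar m)"
proof -
  define e where "e = mcoeff m f"
  define B where "B H x \<longleftrightarrow> (\<exists>j. 1 \<le> j \<and> j < M H \<and> l * j < cmod (\<Sum>k=1..j. psum e k x))" for H x
  have B: "depends_on H (B H)" for H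
  proof (rule depI)
    fix x y assume xy: "x \<in> vgroup m" "y \<in> vgroup m" "\<forall>i<H. x i = y i"
    have "psum e k x = psum e k y" if "k < M H" for k
      using that xy by (intro depD[OF depends_on_psum, of k H]) auto
    then have "(\<Sum>k=1..j. psum e k x) = (\<Sum>k=1..j. psum e k y)" if "j < M H" for j
      using that by (intro sum.cong) auto
    then show "B H x = B H y" unfolding B_def by metis
  qed
  have Bsets: "{x \<in> space (haar m). B H x} \<in> sets (haar m)" for H
    by (rule depends_on_sets[OF B])
  \<comment> \<open>If all Fejer means at \<open>x\<close> were at most \<open>l\<close>, so would
    be all Noerlund means. An index \<open>j\<close> violating this bound is covered by
    \<open>B j\<close>, since \<open>j < M j\<close>.\<close>
  have "{x \<in> space (haar m). ennreal l < norlund_max m q f x} \<subseteq> (\<Union>H. {x \<in> space (haar m). B H x})"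
  proof
    fix x assume x: "x \<in> {x \<in> space (haar m). ennreal l < norlund_max m q f x}"
    then obtain n where n: "1 \<le> n" "ennreal l < ennreal (cmod (norlund m q n f x))"
      unfolding norlund_max_def by (auto simp: less_SUP_iff)
    then have "\<not> cmod (norlund m q n f x) \<le> l"
      using l by (simp add: ennreal_less_iff)
    with norlund_le[where lam = l and f = f and x = x, OF q n(1)] obtain j where j: "1 \<le> j" "l * j < cmod (\<Sum>k=1..j. psum e k x)"
      unfolding e_def by force
    have "B j x" unfolding B_def using j gpow_gt[of m j] m_ge by blast
    then show "x \<in> (\<Union>H. {x \<in> space (haar m). B H x})" using x by auto
  qed
  then have "emeasure (haar m) {x \<in> space (haar m). ennreal l < norlund_max m q f x}
      \<le> emeasure (haar m) (\<Union>H. {x \<in> space (haar m). B H x})"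
    using Bsets by (intro emeasure_mono) auto
  also have "\<dots> = (SUP H. emeasure (haar m) {x \<in> space (haar m). B H x})"
  proof (rule SUP_emeasure_incseq[symmetric])
    show "incseq (\<lambda>H. {x \<in> space (haar m). B H x})"
      unfolding incseq_def B_def using M_mono by (blast intro: less_le_trans)
  qed (use Bsets in auto)
  also have "\<dots> \<le> ennreal (weak_const / sqrt l) * (\<integral>\<^sup>+x. epowr (mart_max f x) (1 / 2) \<partial>haar m)"
  proof (rule SUP_least)
    fix H
    \<comment> \<open>The maximal function restricted to orders up to \<open>H\<close>: it depends
      on finitely many coordinates and lies below \<open>mart_max f\<close>.\<close>
    define Fs where "Fs x = Max ((\<lambda>n. cmod (psum e (M n) x)) ` {..H})" for x
    have Fs_ge: "cmod (psum e (M n) x) \<le> Fs x" if "n \<le> H" for n x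
      unfolding Fs_def using that by (intro Max_ge) auto
    have Fs0: "0 \<le> Fs x" for x
      using Fs_ge[of 0 x] norm_ge_zero order_trans by blast
    have dF: "depends_on H Fs"
    proof (rule depI)
      fix x y assume xy: "x \<in> vgroup m" "y \<in> vgroup m" "\<forall>i<H. x i = y i"
      have "psum e (M n) x = psum e (M n) y" if "n \<le> H" for n
        using that xy M_mono[OF that] by (intro depD[OF depends_on_psum, of "M n" H]) auto
      then show "Fs x = Fs y" unfolding Fs_def by (metis (no_types, lifting) atMost_iff image_cong)
    qed
    have "ennreal (sqrt (Fs x)) \<le> epowr (mart_max f x) (1 / 2)" if x: "x \<in> vgroup m" for x
    proof -
      have "Fs x \<in> (\<lambda>n. cmod (psum e (M n) x)) ` {..H}"
        unfolding Fs_def by (intro Max_in) auto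
      then obtain n where n: "Fs x = cmod (psum e (M n) x)" by auto
      have "ennreal (sqrt (Fs x)) = epowr (ennreal (Fs x)) (1 / 2)"
        using Fs0 by (simp add: epowr_ennreal powr_half_sqrt)
      also have "\<dots> \<le> epowr (mart_max f x) (1 / 2)"
        unfolding n mart_max_def e_def martingale_eq_psum[OF f x, symmetric]
        by (intro epowr_mono SUP_upper) auto
      finally show ?thesis .
    qed
    then have int: "ennreal (mean H (\<lambda>x. sqrt (Fs x))) \<le> (\<integral>\<^sup>+x. epowr (mart_max f x) (1 / 2) \<partial>haar m)"
      using depends_on_compose[OF dF, of sqrt] Fs0
      by (subst depends_on_nn_integral[symmetric]) (auto intro!: nn_integral_mono simp: space_haar)
    have "emeasure (haar m) {x \<in> space (haar m). B H x} = ennreal (mean H (\<lambda>x. of_bool (B H x)))"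
      by (rule depends_on_emeasure[OF B])
    also have "\<dots> \<le> ennreal (weak_const / sqrt l * mean H (\<lambda>x. sqrt (Fs x)))"
      unfolding B_def by (intro ennreal_leI weak_type_discrete Fs_ge l)
    also have "\<dots> = ennreal (weak_const / sqrt l) * ennreal (mean H (\<lambda>x. sqrt (Fs x)))"
      using l weak_const_ge fejer_const_pos Fs0
      by (intro ennreal_mult mean_nonneg divide_nonneg_nonneg) (auto intro: order_trans[OF _ weak_const_ge])
    also have "\<dots> \<le> ennreal (weak_const / sqrt l) * (\<integral>\<^sup>+x. epowr (mart_max f x) (1 / 2) \<partial>haar m)"
      by (intro mult_left_mono int) auto
    finally show "emeasure (haar m) {x \<in> space (haar m). B H x}
        \<le> ennreal (weak_const / sqrt l) * (\<integral>\<^sup>+x. epowr (mart_max f x) (1 / 2) \<partial>haar m)" .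
  qed
  finally show ?thesis .
qed

text \<open>For \<open>p = 1/2\<close> both quasi-norms involve a square; squaring the measure
  estimate makes \<open>l\<close> cancel and turns the integral into the Hardy norm.\<close>

lemma norlund_max_weak_type:
  assumes f: "f \<in> Hp m (1 / 2)" and q: "\<And>k. 0 \<le> q k" "0 < q 0" "mono q"
  shows "weak_Lp_norm (haar m) (1 / 2) (norlund_max m q f) \<le> ennreal (weak_const\<^sup>2) * Hp_norm m (1 / 2) f"
proof -
  have mart: "martingale m f" and fin: "Hp_norm m (1 / 2) f < \<infinity>" using f by (auto simp: Hp_def)
  define I where "I = (\<integral>\<^sup>+x. epowr (mart_max f x) (1 / 2) \<partial>haar m)"
  have norm: "Hp_norm m (1 / 2) f = epowr I 2"
    by (simp add: Hp_norm_def Lp_norm_def I_def)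
  have "I < \<infinity>" using fin unfolding norm epowr_less_top .
  then obtain i where i: "I = ennreal i" "0 \<le> i" by (cases I) auto
  have weak_const: "0 \<le> weak_const" using weak_const_ge fejer_const_pos by (auto intro: order_trans[OF _ weak_const_ge])
  show ?thesis
    unfolding weak_Lp_norm_def
  proof (rule SUP_least)
    fix l :: real assume "l \<in> {0<..}"
    then have l: "0 < l" by simp
    let ?\<mu> = "emeasure (haar m) {x \<in> space (haar m). ennreal l < norlund_max m q f x}"
    have "?\<mu> \<le> ennreal (weak_const / sqrt l) * ennreal i"
      using weak_type_measure[OF mart q l] unfolding I_def[symmetric] i(1) .
    also have "\<dots> = ennreal (weak_const / sqrt l * i)"
      using l weak_const i(2) by (intro ennreal_mult[symmetric]) auto
    finally have "epowr ?\<mu> (1 / (1 / 2)) \<le> epowr (ennreal (weak_const / sqrt l * i)) (1 / (1 / 2))"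
      by (rule epowr_mono) simp
    also have "\<dots> = ennreal ((weak_const / sqrt l * i)\<^sup>2)"
      using l weak_const i(2) by (simp add: epowr_ennreal powr_numeral)
    finally have "ennreal l * epowr ?\<mu> (1 / (1 / 2)) \<le> ennreal l * ennreal ((weak_const / sqrt l * i)\<^sup>2)"
      by (rule mult_left_mono) simp
    also have "\<dots> = ennreal (l * (weak_const / sqrt l * i)\<^sup>2)"
      using l by (intro ennreal_mult[symmetric]) auto
    also have "l * (weak_const / sqrt l * i)\<^sup>2 = weak_const\<^sup>2 * i\<^sup>2"
      using l by (simp add: power_mult_distrib power_divide)
    also have "ennreal (weak_const\<^sup>2 * i\<^sup>2) = ennreal (weak_const\<^sup>2) * Hp_norm m (1 / 2) f"
      using i(2) by (simp add: norm i(1) epowr_ennreal powr_numeral ennreal_mult)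
    finally show "ennreal l * epowr ?\<mu> (1 / (1 / 2)) \<le> ennreal (weak_const\<^sup>2) * Hp_norm m (1 / 2) f" .
  qed
qed

section \<open>Martingales with coefficients constant between consecutive \<open>M n\<close>\<close>

text \<open>For \<open>i = 0\<close> the subtraction is truncated; \<open>lcoeff\<close> below avoids this value.\<close>

definition level :: "nat \<Rightarrow> nat" where
  "level i = (LEAST K. i < M K) - 1"

lemma level_eq:
  assumes "M A \<le> i" "i < M (Suc A)"
  shows "level i = A"
proof -
  have "(LEAST K. i < M K) = Suc A"
  proof (rule Least_equality)
    show "Suc A \<le> K" if "i < M K" for K
      using that assms(1) M_mono[of K A] by (meson le_less_trans not_less_eq_eq not_less)
  qed (rule assms(2))
  then show ?thesis by (simp add: level_def)
qed

definition lcoeff :: "(nat \<Rightarrow> real) \<Rightarrow> nat \<Rightarrow> complex" where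
  "lcoeff a i = (if i = 0 then 0 else of_real (a (level i)))"

lemma lcoeff_eq: "M A \<le> i \<Longrightarrow> i < M (Suc A) \<Longrightarrow> lcoeff a i = of_real (a A)"
  using M_pos[of A] by (auto simp: lcoeff_def level_eq)

lemma sum_levels:
  fixes g :: "nat \<Rightarrow> 'b :: comm_monoid_add"
  assumes "g 0 = 0"
  shows "(\<Sum>i<M n. g i) = (\<Sum>A<n. \<Sum>i=M A..<M (Suc A). g i)"
proof (induction n)
  case 0
  then show ?case using assms by (simp add: gpow_0)
next
  case (Suc n)
  have "(\<Sum>i<M (Suc n). g i) = (\<Sum>i<M n. g i) + (\<Sum>i=M n..<M (Suc n). g i)"
    using M_mono[of n "Suc n"] sum.atLeastLessThan_concat[of 0 "M n" "M (Suc n)" g]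
    by (simp add: atLeast0LessThan)
  then show ?case using Suc by simp
qed

abbreviation zero :: "nat \<Rightarrow> nat" where "zero \<equiv> \<lambda>_. 0"

lemma zero_vgroup: "zero \<in> vgroup m"
  using m_pos by (simp add: in_vgroup)

lemma psi_zero: "psi m i zero = 1"
  by (simp add: psi_def rad_def)

text \<open>With base point \<open>zero\<close> the block is the difference of the Dirichlet kernels
  of index \<open>M (Suc A)\<close> and \<open>M A\<close>, both supported in the cylinder of order
  \<open>A\<close> around \<open>zero\<close>.\<close>

lemma cmod_block_le:
  assumes "x \<in> vgroup m"
  shows "cmod (\<Sum>i=M A..<M (Suc A). psi m i x) \<le> R * M A * of_bool (agree A zero x)"
proof -
  have "(\<Sum>i<M (Suc A). psi m i x) = (\<Sum>i<M A. psi m i x) + (\<Sum>i=M A..<M (Suc A). psi m i x)"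
    using M_mono[of A "Suc A"] sum.atLeastLessThan_concat[of 0 "M A" "M (Suc A)" "\<lambda>i. psi m i x"]
    by (simp add: atLeast0LessThan)
  then have "(\<Sum>i=M A..<M (Suc A). psi m i x) = dirichlet (M (Suc A)) x zero - dirichlet (M A) x zero"
    by (simp add: dirichlet_def psi_zero)
  also have "\<dots> = of_real (real (M (Suc A)) * of_bool (agree (Suc A) zero x) - real (M A) * of_bool (agree A zero x))"
    unfolding dirichlet_M[OF assms zero_vgroup] by (auto simp: agree_def)
  finally have "cmod (\<Sum>i=M A..<M (Suc A). psi m i x)
      = \<bar>real (M (Suc A)) * of_bool (agree (Suc A) zero x) - real (M A) * of_bool (agree A zero x)\<bar>"
    by (simp only: norm_of_real)
  also have "\<dots> \<le> real (M (Suc A)) * of_bool (agree A zero x)"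
    using M_mono[of A "Suc A"] by (auto simp: agree_def of_bool_def)
  also have "\<dots> \<le> real (R * M A) * of_bool (agree A zero x)"
    by (intro mult_right_mono of_nat_mono M_Suc_le) auto
  finally show ?thesis by simp
qed

lemma cmod_psum_lcoeff_le:
  assumes "x \<in> vgroup m" "\<And>A. 0 \<le> a A"
  shows "cmod (psum (lcoeff a) (M n) x) \<le> (\<Sum>A<n. a A * R * M A * of_bool (agree A zero x))"
proof -
  have "psum (lcoeff a) (M n) x = (\<Sum>A<n. \<Sum>i=M A..<M (Suc A). lcoeff a i * psi m i x)"
    unfolding psum_def by (rule sum_levels) (simp add: lcoeff_def)
  also have "\<dots> = (\<Sum>A<n. of_real (a A) * (\<Sum>i=M A..<M (Suc A). psi m i x))"
    unfolding sum_distrib_left by (intro sum.cong refl) (simp add: lcoeff_eq)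
  finally have "cmod (psum (lcoeff a) (M n) x) \<le> (\<Sum>A<n. cmod (of_real (a A) * (\<Sum>i=M A..<M (Suc A). psi m i x)))"
    using norm_sum by metis
  also have "\<dots> \<le> (\<Sum>A<n. a A * (R * M A * of_bool (agree A zero x)))"
  proof (rule sum_mono)
    fix A
    show "cmod (of_real (a A) * (\<Sum>i=M A..<M (Suc A). psi m i x)) \<le> a A * (R * M A * of_bool (agree A zero x))"
      unfolding norm_mult norm_of_real abs_of_nonneg[OF assms(2)]
      by (rule mult_left_mono[OF cmod_block_le[OF assms(1)] assms(2)])
  qed
  finally show ?thesis by (simp add: mult.assoc)
qed

lemma sum_cmod_lcoeff_le:
  assumes "\<And>A. 0 \<le> a A"
  shows "(\<Sum>i<M n. cmod (lcoeff a i)) \<le> (\<Sum>A<n. a A * R * M A)"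
proof -
  have "(\<Sum>i<M n. cmod (lcoeff a i)) = (\<Sum>A<n. \<Sum>i=M A..<M (Suc A). cmod (lcoeff a i))"
    by (rule sum_levels) (simp add: lcoeff_def)
  also have "\<dots> = (\<Sum>A<n. real (M (Suc A) - M A) * a A)"
  proof (rule sum.cong[OF refl])
    fix A
    have "(\<Sum>i=M A..<M (Suc A). cmod (lcoeff a i)) = (\<Sum>i=M A..<M (Suc A). a A)"
      by (intro sum.cong refl) (auto simp: lcoeff_eq[of A] assms)
    then show "(\<Sum>i=M A..<M (Suc A). cmod (lcoeff a i)) = real (M (Suc A) - M A) * a A" by simp
  qed
  also have "\<dots> \<le> (\<Sum>A<n. real (R * M A) * a A)"
    using assms M_Suc_le by (intro sum_mono mult_right_mono of_nat_mono) (auto intro: le_trans[OF diff_le_self])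
  finally show ?thesis by (simp add: mult_ac)
qed

text \<open>Every preimage is a finite union of generating cylinders, one for each representative
  with value in the given set.\<close>

lemma depends_on_filt_measurable:
  fixes g :: "_ \<Rightarrow> complex"
  assumes "depends_on n g"
  shows "g \<in> borel_measurable (filt m n)"
proof (rule measurableI)
  have sub: "{cylinder m n x |x. x \<in> vgroup m} \<subseteq> Pow (vgroup m)"
    by (auto simp: cylinder_def)
  have space: "space (filt m n) = vgroup m"
    unfolding filt_def using sub by (rule space_measure_of)
  have cyl: "cylinder m n z \<in> sets (filt m n)" if "z \<in> vgroup m" for z
    unfolding filt_def sets_measure_of[OF sub] using that by (intro sigma_sets.Basic) auto
  fix A :: "complex set"
  have "g -` A \<inter> space (filt m n) = (\<Union>z\<in>{z\<in>reps n. g z \<in> A}. cylinder m n z)"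
  proof (intro equalityI subsetI)
    fix x assume "x \<in> g -` A \<inter> space (filt m n)"
    then have x: "x \<in> vgroup m" "g x \<in> A" by (auto simp: space)
    then have "truncate n x \<in> {z\<in>reps n. g z \<in> A}"
      using truncate_reps depends_on_truncate[OF assms] by auto
    moreover have "x \<in> cylinder m n (truncate n x)" using x by (auto simp: cylinder_def truncate_def)
    ultimately show "x \<in> (\<Union>z\<in>{z\<in>reps n. g z \<in> A}. cylinder m n z)" by blast
  next
    fix x assume "x \<in> (\<Union>z\<in>{z\<in>reps n. g z \<in> A}. cylinder m n z)"
    then obtain z where z: "z \<in> reps n" "g z \<in> A" "x \<in> cylinder m n z" by blast
    then have "g x = g z"
      by (intro depD[OF assms]) (auto simp: cylinder_def reps_vgroup)
    with z show "x \<in> g -` A \<inter> space (filt m n)" by (auto simp: cylinder_def space)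
  qed
  also have "\<dots> \<in> sets (filt m n)"
    using finite_reps[of n] cyl reps_vgroup by (intro sets.finite_UN) auto
  finally show "g -` A \<inter> space (filt m n) \<in> sets (filt m n)" .
qed simp

lemma martingale_psum: "martingale m (\<lambda>n. psum e (M n))"
proof -
  have "fsum m (M n) (psum e (M k)) x = psum e (M n) x" if "n \<le> k" for n k x
  proof -
    have "fcoeff m (psum e (M k)) i = e i" if "i < M n" for i
      using that M_mono[OF \<open>n \<le> k\<close>] by (intro fcoeff_psum[of _ k]) auto
    then show ?thesis unfolding fsum_def psum_def by (intro sum.cong) auto
  qed
  then show ?thesis
    unfolding martingale_def
    using depends_on_integral(1)[OF depends_on_psum[OF order_refl]] depends_on_filt_measurable[OF depends_on_psum[OF order_refl]] by blast
qed

lemma mcoeff_psum: "mcoeff m (\<lambda>n. psum e (M n)) i = e i"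
proof -
  have i: "i < M i" by (rule gpow_gt[OF m_ge])
  show ?thesis
    unfolding mcoeff_eq_fcoeff[OF martingale_psum i] by (rule fcoeff_psum[OF i]) (rule refl)
qed

text \<open>Subadditivity of the \<open>p\<close>-th power separates the blocks. Block
  \<open>A\<close> contributes at most \<open>R powr p * M A powr (p * g + p - 1)\<close> to the
  integral; the exponent is negative and \<open>M A\<close> is at least \<open>2 ^ A\<close>, so the
  series converges.\<close>

lemma lcoeff_Hp:
  assumes a: "\<And>A. 0 \<le> a A" "\<And>A. a A \<le> M A powr g" and p: "0 < p" "p \<le> 1" "p * g + p < 1"
  shows "(\<lambda>n. psum (lcoeff a) (M n)) \<in> Hp m p"
proof -
  let ?f = "\<lambda>n. psum (lcoeff a) (M n)"
  define w where "w A = (a A * R * M A) powr p" for A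
  define s where "s A x = w A * of_bool (agree A zero x)" for A x
  have w: "0 \<le> w A" for A by (simp add: w_def)
  have s: "0 \<le> s A x" for A x by (simp add: s_def w)
  have ds: "depends_on A (s A)" for A
    unfolding s_def by (rule depends_on_compose) (rule depI, simp add: agree_def)
  have "epowr (mart_max ?f x) p \<le> (\<Sum>A. ennreal (s A x))" if x: "x \<in> vgroup m" for x
    unfolding mart_max_def
  proof (rule epowr_SUP_le[OF p(1)])
    fix n
    let ?u = "\<lambda>A. a A * R * M A * of_bool (agree A zero x)"
    have u: "0 \<le> ?u A" for A using a by simp
    have "cmod (?f n x) powr p \<le> (\<Sum>A<n. ?u A) powr p"
      using p by (intro powr_mono2 cmod_psum_lcoeff_le x a) auto
    also have "\<dots> \<le> (\<Sum>A<n. ?u A powr p)"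
      by (rule powr_sum_le) (use u p in auto)
    also have "\<dots> = (\<Sum>A<n. s A x)"
      by (intro sum.cong) (auto simp: s_def w_def)
    finally have "epowr (ennreal (cmod (?f n x))) p \<le> ennreal (\<Sum>A<n. s A x)"
      by (simp add: epowr_ennreal ennreal_leI)
    also have "\<dots> = (\<Sum>A<n. ennreal (s A x))"
      using s by (intro sum_ennreal[symmetric]) auto
    also have "\<dots> \<le> (\<Sum>A. ennreal (s A x))"
      by (intro sum_le_suminf) auto
    finally show "epowr (ennreal (cmod (?f n x))) p \<le> (\<Sum>A. ennreal (s A x))" .
  qed
  then have "(\<integral>\<^sup>+x. epowr (mart_max ?f x) p \<partial>haar m) \<le> (\<integral>\<^sup>+x. (\<Sum>A. ennreal (s A x)) \<partial>haar m)"
    by (intro nn_integral_mono) (simp add: space_haar)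
  also have "\<dots> = (\<Sum>A. \<integral>\<^sup>+x. ennreal (s A x) \<partial>haar m)"
    using depends_on_measurable[OF depends_on_compose[OF ds, where F = ennreal]] by (intro nn_integral_suminf) auto
  also have "\<dots> = (\<Sum>A. ennreal (w A / M A))"
  proof (rule suminf_cong)
    fix A
    have "(\<integral>\<^sup>+x. ennreal (s A x) \<partial>haar m) = ennreal (mean A (s A))"
      by (rule depends_on_nn_integral[OF ds s])
    also have "mean A (s A) = w A * (1 / M A)"
      unfolding s_def mean_cmult using mean_agree[OF order_refl zero_vgroup] by simp
    finally show "(\<integral>\<^sup>+x. ennreal (s A x) \<partial>haar m) = ennreal (w A / M A)" by simp
  qed
  also have "\<dots> \<le> (\<Sum>A. ennreal (R powr p * (2 powr (p * g + p - 1)) ^ A))"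
  proof (intro suminf_le ennreal_leI)
    fix A
    have MA: "0 < real (M A)" using M_pos by simp
    have "w A \<le> (M A powr g * R * M A) powr p"
      unfolding w_def using a p by (intro powr_mono2 mult_right_mono) auto
    also have "\<dots> = R powr p * M A powr (p * g + p)"
      using MA by (simp add: powr_mult powr_powr powr_add mult.commute)
    finally have "w A / M A \<le> R powr p * M A powr (p * g + p) / M A"
      using MA by (intro divide_right_mono) auto
    also have "\<dots> = R powr p * M A powr (p * g + p - 1)"
      using MA by (simp add: powr_diff powr_one)
    also have "\<dots> \<le> R powr p * (2 ^ A) powr (p * g + p - 1)"
    proof (intro mult_left_mono powr_mono2')
      have "2 ^ A \<le> M A" using M_power2_le[of A 0] by (simp add: gpow_0)
      then have "real (2 ^ A) \<le> real (M A)" by (rule of_nat_mono)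
      then show "2 ^ A \<le> real (M A)" by simp
    qed (use p in auto)
    also have "(2 ^ A) powr (p * g + p - 1) = (2 powr (p * g + p - 1)) ^ A"
      by (simp add: powr_realpow[symmetric] powr_powr mult.commute)
    finally show "w A / M A \<le> R powr p * (2 powr (p * g + p - 1)) ^ A" .
  qed auto
  also have "\<dots> < \<infinity>"
  proof -
    have "2 powr (p * g + p - 1) < 2 powr (0 :: real)"
      using p by (intro powr_less_mono) auto
    then have "summable (\<lambda>A. R powr p * (2 powr (p * g + p - 1)) ^ A)"
      by (intro summable_mult summable_geometric) auto
    then show ?thesis
      by (subst suminf_ennreal2) auto
  qed
  finally have "(\<integral>\<^sup>+x. epowr (mart_max ?f x) p \<partial>haar m) < \<infinity>" .
  then have "Hp_norm m p ?f < \<infinity>"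
    unfolding Hp_norm_def Lp_norm_def epowr_less_top .
  then show ?thesis using martingale_psum by (simp add: Hp_def)
qed

text \<open>The character of index \<open>N\<close> occurs only in the last partial sum, which
  carries the weight \<open>q 0\<close>. All the rest is an average of partial sums of order at most
  \<open>N\<close>.\<close>

lemma norlund_lower:
  assumes q: "\<And>k. 0 \<le> q k" "0 < q 0" and n: "n = Suc N"
  shows "cmod (e N) * (q 0 / Qsum q n) - (\<Sum>i<N. cmod (e i)) \<le> cmod (norlund m q n (\<lambda>n. psum e (M n)) x)"
proof -
  have Q: "0 < Qsum q n" using q n by (intro Qsum_pos) auto
  define B where "B = (\<Sum>i<N. cmod (e i))"
  have B: "cmod (psum e k x) \<le> B" if "k \<le> N" for k
    unfolding B_def using that by (intro order_trans[OF cmod_psum_le] sum_mono2) auto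
  have B0: "0 \<le> B" by (simp add: B_def sum_nonneg)
  \<comment> \<open>Everything but the new character. The last partial sum enters with its first
    \<open>N\<close> terms, so the weights still add up to \<open>Qsum q n\<close>.\<close>
  define Z where "Z = (\<Sum>k=1..N. of_real (q (n - k)) * psum e k x) + of_real (q 0) * psum e N x"
  have "(\<Sum>k=1..n. of_real (q (n - k)) * msum m k (\<lambda>n. psum e (M n)) x)
      = (\<Sum>k=1..n. of_real (q (n - k)) * psum e k x)"
    unfolding msum_eq_psum by (intro sum.cong) (simp_all add: psum_def mcoeff_psum)
  also have "\<dots> = Z + of_real (q 0) * (e N * psi m N x)"
    by (simp add: Z_def n psum_def algebra_simps)
  finally have eq: "norlund m q n (\<lambda>n. psum e (M n)) x = (Z + of_real (q 0) * (e N * psi m N x)) / of_real (Qsum q n)"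
    by (simp add: norlund_def)
  have "cmod Z \<le> (\<Sum>k=1..N. q (n - k) * B) + q 0 * B"
    unfolding Z_def using q B
    by (intro norm_triangle_mono sum_norm_le) (auto simp: norm_mult intro!: mult_left_mono)
  also have "\<dots> = Qsum q n * B"
    using sum_reverse_Qsum[of q n] by (simp add: n sum_distrib_right[symmetric] distrib_right[symmetric])
  finally have Z: "cmod Z \<le> Qsum q n * B" .
  have "q 0 * cmod (e N) - Qsum q n * B \<le> cmod (of_real (q 0) * (e N * psi m N x)) - cmod Z"
    using Z q by (simp add: norm_mult cmod_psi)
  also have "\<dots> \<le> cmod (Z + of_real (q 0) * (e N * psi m N x))"
    by (metis add.commute norm_diff_ineq)
  finally have "(q 0 * cmod (e N) - Qsum q n * B) / Qsum q n \<le> cmod (norlund m q n (\<lambda>n. psum e (M n)) x)"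
    unfolding eq norm_divide using Q by (simp add: divide_right_mono)
  then show ?thesis using Q by (simp add: B_def diff_divide_distrib mult.commute)
qed

lemma weak_Lp_norm_ge:
  assumes "0 < l" "0 < p" "\<And>x. x \<in> vgroup m \<Longrightarrow> ennreal l < g x"
  shows "ennreal l \<le> weak_Lp_norm (haar m) p g"
proof -
  interpret prob_space "haar m" by (rule prob_space_haar[OF m_ge])
  have "{x \<in> space (haar m). ennreal l < g x} = space (haar m)"
    using assms(3) by (auto simp: space_haar)
  then have "ennreal l = ennreal l * epowr (emeasure (haar m) {x \<in> space (haar m). ennreal l < g x}) (1 / p)"
    using epowr_ennreal[of 1 "1 / p"] by (simp add: emeasure_space_1)
  also have "\<dots> \<le> weak_Lp_norm (haar m) p g"
    unfolding weak_Lp_norm_def by (rule SUP_upper) (use assms in auto)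
  finally show ?thesis .
qed

lemma norlund_unbounded:
  assumes q: "\<And>k. 0 \<le> q k" "0 < q 0" and p: "0 < p" "p < 1 / 2"
    and c: "0 < c" "\<And>n. 1 \<le> n \<Longrightarrow> c / real n \<le> q 0 / Qsum q n"
  shows "\<exists>f\<in>Hp m p. (SUP n\<in>{1..}. weak_Lp_norm (haar m) p (\<lambda>x. ennreal (cmod (norlund m q n f x)))) = \<infinity>"
proof -
  \<comment> \<open>An exponent strictly between 1 and \<open>1 / p - 1\<close>, available because
    \<open>p < 1 / 2\<close>.\<close>
  define g where "g = 1 / (2 * p)"
  have g: "1 < g" "p * g + p < 1" using p by (auto simp: g_def field_simps)
  \<comment> \<open>Bounds the moduli of all coefficients up to block \<open>A\<close>, whichever
    blocks are selected later.\<close>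
  define T where "T A = (\<Sum>A'<Suc A. M A' powr g * R * M A')" for A
  have ex: "\<exists>A>B. X \<le> M A powr (g - 1)" for B :: nat and X :: real
  proof -
    have "filterlim (\<lambda>A. real A powr (g - 1)) at_top sequentially"
      using g by (intro filterlim_compose[OF real_powr_at_top filterlim_real_sequentially]) auto
    then have "\<forall>\<^sub>F A in sequentially. X \<le> real A powr (g - 1)"
      by (simp add: filterlim_at_top)
    then obtain A0 where A0: "\<And>A. A0 \<le> A \<Longrightarrow> X \<le> real A powr (g - 1)"
      unfolding eventually_sequentially by blast
    define A where "A = max A0 (Suc B)"
    have "X \<le> real A powr (g - 1)" using A0 by (simp add: A_def)
    also have "\<dots> \<le> M A powr (g - 1)"
      using g gpow_gt[of m A] m_ge by (intro powr_mono2) auto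
    finally show ?thesis by (intro exI[of _ A]) (simp add: A_def)
  qed
  \<comment> \<open>Each new block is chosen so far out that its contribution beats all earlier
    blocks by \<open>k + 2\<close>.\<close>
  have "\<exists>\<alpha>::nat \<Rightarrow> nat. \<forall>k. True \<and> (\<alpha> k < \<alpha> (Suc k) \<and> 2 / c * (k + 2 + T (\<alpha> k)) \<le> M (\<alpha> (Suc k)) powr (g - 1))"
    by (rule dependent_nat_choice) (use ex in auto)
  then obtain \<alpha> :: "nat \<Rightarrow> nat" where \<alpha>: "\<And>k. \<alpha> k < \<alpha> (Suc k)"
    and grow: "\<And>k. 2 / c * (k + 2 + T (\<alpha> k)) \<le> M (\<alpha> (Suc k)) powr (g - 1)"
    by blast
  have mono: "strict_mono \<alpha>" using \<alpha> by (rule strict_mono_Suc_iff[THEN iffD2, rule_format])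
  define a where "a A = (if A \<in> range \<alpha> then M A powr g else 0)" for A
  define f where "f n = psum (lcoeff a) (M n)" for n
  have f: "f \<in> Hp m p"
    unfolding f_def by (rule lcoeff_Hp) (use p g in \<open>auto simp: a_def\<close>)
  \<comment> \<open>The growth condition yields \<open>k + 2\<close>, one more than claimed, because
    \<open>weak_Lp_norm_ge\<close> asks for a strict inequality.\<close>
  have low: "ennreal (k + 1) \<le> weak_Lp_norm (haar m) p (\<lambda>x. ennreal (cmod (norlund m q (Suc (M (\<alpha> (Suc k)))) f x)))" for k
  proof (rule weak_Lp_norm_ge)
    fix x assume "x \<in> vgroup m"
    define A where "A = \<alpha> (Suc k)"
    have MA: "1 \<le> real (M A)" using M_pos[of A] by simp
    have "(\<Sum>i<M A. cmod (lcoeff a i)) \<le> (\<Sum>A'<A. a A' * R * M A')"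
      by (rule sum_cmod_lcoeff_le) (simp add: a_def)
    also have "\<dots> = (\<Sum>A'<Suc (\<alpha> k). a A' * R * M A')"
    proof (rule sum.mono_neutral_right)
      show "{..<Suc (\<alpha> k)} \<subseteq> {..<A}" using \<alpha>[of k] by (auto simp: A_def)
      have "A' \<notin> range \<alpha>" if "\<alpha> k < A'" "A' < A" for A'
      proof
        assume "A' \<in> range \<alpha>"
        then obtain j where "A' = \<alpha> j" by blast
        with that mono have "k < j" "j < Suc k" by (auto simp: A_def strict_mono_less)
        then show False by simp
      qed
      then show "\<forall>A'\<in>{..<A} - {..<Suc (\<alpha> k)}. a A' * R * M A' = 0"
        by (auto simp: a_def)
    qed simp
    also have "\<dots> \<le> T (\<alpha> k)"
      unfolding T_def by (intro sum_mono mult_right_mono) (auto simp: a_def)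
    finally have B: "(\<Sum>i<M A. cmod (lcoeff a i)) \<le> T (\<alpha> k)" .
    have eN: "cmod (lcoeff a (M A)) = M A powr g"
      using lcoeff_eq[of A "M A" a] M_strict[of A "Suc A"] by (simp add: a_def A_def)
    have "2 / c * (k + 2 + T (\<alpha> k)) \<le> M A powr (g - 1)"
      using grow[of k] unfolding A_def by (simp add: algebra_simps)
    then have "k + 2 + T (\<alpha> k) \<le> c * M A powr (g - 1) / 2"
      using c(1) by (simp add: field_simps)
    also have "\<dots> = M A powr g * (c / (2 * M A))"
      using MA by (simp add: powr_diff powr_one field_simps)
    \<comment> \<open>\<open>Suc (M A) \<le> 2 * M A\<close> accounts for the factor 2 in the growth
      condition.\<close>
    also have "\<dots> \<le> M A powr g * (c / Suc (M A))"
      using MA c(1) by (intro mult_left_mono divide_left_mono) auto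
    also have "\<dots> \<le> M A powr g * (q 0 / Qsum q (Suc (M A)))"
      by (intro mult_left_mono c) auto
    finally have "k + 2 \<le> cmod (lcoeff a (M A)) * (q 0 / Qsum q (Suc (M A))) - (\<Sum>i<M A. cmod (lcoeff a i))"
      using B by (simp add: eN)
    also have "\<dots> \<le> cmod (norlund m q (Suc (M A)) f x)"
      unfolding f_def by (rule norlund_lower[of q, OF q refl])
    finally show "ennreal (real k + 1) < ennreal (cmod (norlund m q (Suc (M (\<alpha> (Suc k)))) f x))"
      unfolding A_def by (intro ennreal_lessI) auto
  qed (use p in auto)
  let ?S = "SUP n\<in>{1..}. weak_Lp_norm (haar m) p (\<lambda>x. ennreal (cmod (norlund m q n f x)))"
  have "of_nat k \<le> ?S" for k
  proof -
    have "(of_nat k :: ennreal) = ennreal (real k)" by (simp add: ennreal_of_nat_eq_real_of_nat)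
    also have "\<dots> \<le> ennreal (real k + 1)" by (rule ennreal_leI) simp
    also have "\<dots> \<le> ?S"
      by (rule order_trans[OF low[of k]]) (rule SUP_upper, simp)
    finally show ?thesis .
  qed
  then have "?S = \<infinity>"
    by (metis ennreal_Ex_less_of_nat infinity_ennreal_def less_top not_less)
  with f show ?thesis by blast
qed

end

theorem theorem4p1:
  fixes m :: "nat \<Rightarrow> nat" and q :: "nat \<Rightarrow> real"
  assumes m_ge: "\<And>k. 2 \<le> m k"
    and m_bdd: "bdd_above (range m)"
    and q_nonneg: "\<And>k. 0 \<le> q k"
    and q0_pos: "0 < q 0"
    and Q_lim: "filterlim (Qsum q) at_top sequentially"
    and q_mono: "mono q"
  shows "(\<exists>C::real. \<forall>f\<in>Hp m (1/2).
            weak_Lp_norm (haar m) (1/2) (norlund_max m q f) \<le> ennreal C * Hp_norm m (1/2) f) \<and>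
         (\<forall>p::real. 0 < p \<longrightarrow> p < 1/2 \<longrightarrow>
            (\<exists>c::real. c > 0 \<and> (\<forall>n\<ge>1. q 0 / Qsum q n \<ge> c / real n)) \<longrightarrow>
            (\<exists>f\<in>Hp m p. (SUP n\<in>{1..}.
               weak_Lp_norm (haar m) p (\<lambda>x. ennreal (cmod (norlund m q n f x)))) = \<infinity>))"
proof -
  obtain R where "\<And>k. m k \<le> R" using m_bdd by (auto simp: bdd_above_def)
  then interpret vilenkin m R using m_ge by unfold_locales
  \<comment> \<open>The constant in the first part is \<open>weak_const\<^sup>2\<close>, which
    depends on the bound \<open>R\<close> only.\<close>
  show ?thesis
    using norlund_max_weak_type[of _ q, OF _ q_nonneg q0_pos q_mono] norlund_unbounded[of q, OF q_nonneg q0_pos] by blast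
qed

end
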